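(* Assume that the linear evolution process $\{L(t,\tau)\colon t\ge\tau\}$ generated by $u_t=A(t)u$ on the Banach space $X$ has exponential splitting with bound $M\ge 1$, exponents $\gamma>\rho$ and projections $\{Q(\tau)\colon\tau\in\mathbb R\}$. Let $\Gamma$ be an admissible norm on $\mathbb R^2$, let $f\colon\mathbb R\times X\to X$ be continuous, with $f(t,0)=0$ for all $t$, satisfying the Lipschitz conditions with constants $L_1,L_2>0$, let $\{T(t,\tau)\colon t\ge\tau\}$ be the evolution process generated by $u_t=A(t)u+f(t,u)$, satisfying the variation of constants formula, and assume that the gap condition $\Gamma\left(\frac{L_1}{\sigma-\rho},\frac{L_2}{\gamma-\sigma}\right)<1$ holds for some $\sigma\in(\rho,\gamma)$. Assume moreover that $f$ is Fréchet differentiable with respect to the second variable, with derivative $Df(t,u)\in\mathcal L(X)$ for $(t,u)\in\mathbb R\times X$. Then the function $\Sigma\colon\mathbb R\times X\to X$ that defines the invariant manifold $\mathcal M(t)=\{Q(t)\eta+\Sigma(t,Q(t)\eta)\colon\eta\in X\}$, $t\in\mathbb R$, is (Fréchet) differentiable with respect to the second variable and $$D_\eta\Sigma(\tau,\eta)=\int_{-\infty}^\tau L(\tau,s)(I-Q(s))Df(s,z_{\tau,\eta}(s))D_\eta[z_{\tau,\eta}(s)]\,ds,\qquad\tau\in\mathbb R,\ \eta\in X,$$ where the integral is understood pointwise on vectors of $X$.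
   Context: Setting. $(X,\|\cdot\|)$ is a Banach space, $\mathcal L(X)$ the bounded linear operators on $X$, $J=\{(t,\tau)\in\mathbb R^2\colon t\ge\tau\}$. A linear evolution process is a family $\{L(t,\tau)\colon(t,\tau)\in J\}\subset\mathcal L(X)$ with $L(t,\tau)=L(t,s)L(s,\tau)$ for $t\ge s\ge\tau$, $L(t,t)=I$, and $J\ni(t,\tau)\mapsto L(t,\tau)\eta\in X$ continuous for each $\eta\in X$. The (possibly unbounded) linear operators $A(t)$, $t\in\mathbb R$, generate such a process: $t\mapsto L(t,\tau)\eta$ is the mild solution of $u_t=A(t)u$, $u(\tau)=\eta$. Exponential splitting with bound $M\ge1$, exponents $\gamma>\rho$ and projections $Q(t)\in\mathcal L(X)$: (i) $Q(t)L(t,\tau)=L(t,\tau)Q(\tau)$ for $t\ge\tau$; (ii) $L(t,\tau)|_{Q(\tau)X}\colon Q(\tau)X\to Q(t)X$ is an isomorphism for $t\ge\tau$, with inverse denoted $L(\tau,t)\colon Q(t)X\to Q(\tau)X$; (iii) $e^{\gamma(t-\tau)}\|L(t,\tau)(I-Q(\tau))\|\le M$ for $t\ge\tau$ and $e^{\rho(t-\tau)}\|L(t,\tau)Q(\tau)\|\le M$ for $t\le\tau$. Norms. $N(\tau)=Q(\tau)X$, $S(\tau)=(I-Q(\tau))X$; $|x|_{N(\tau)}=\sup_{t\le\tau}e^{\rho(t-\tau)}\|L(t,\tau)x\|$ for $x\in N(\tau)$; $|x|_{S(\tau)}=\sup_{t\ge\tau}e^{\gamma(t-\tau)}\|L(t,\tau)x\|$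 for $x\in S(\tau)$. A norm $\Gamma\colon\mathbb R^2\to[0,\infty)$ is admissible if for all $a,b\ge0$ the functions $\Gamma(a,\cdot)$ and $\Gamma(\cdot,b)$ are non-decreasing on $[0,\infty)$. For such $\Gamma$, $\|x\|_\tau=\Gamma(|Q(\tau)x|_{N(\tau)},|(I-Q(\tau))x|_{S(\tau)})$, an equivalent norm on $X$. Lipschitz conditions: for all $t\in\mathbb R$, $u,v\in X$, $|Q(t)(f(t,u)-f(t,v))|_{N(t)}\le L_1\|u-v\|_t$ and $|(I-Q(t))(f(t,u)-f(t,v))|_{S(t)}\le L_2\|u-v\|_t$. Nonlinear process: maps $T(t,\tau)\colon X\to X$, $t\ge\tau$, with $T(t,t)=I$, $T(t,s)T(s,\tau)=T(t,\tau)$ for $t\ge s\ge\tau$, $t\mapsto T(t,\tau)\eta$ continuous on $[\tau,\infty)$, and $T(t,\tau)\eta=L(t,\tau)\eta+\int_\tau^tL(t,s)f(s,T(s,\tau)\eta)\,ds$ for $t\ge\tau$, $\eta\in X$ (variation of constants formula). Fréchet differentiability of $f$: $f(t,u+h)-f(t,u)-Df(t,u)h=\varepsilon(t,u,h)\|h\|_t$ for $t\in\mathbb R$, $u,h\in X$, where $\varepsilon(t,u,h)\to\varepsilon(t,u,0)=0$ as $h\to0$ for each fixed $t,u$. Definition of $z_{\tau,\eta}$ and $\Sigma$. For $\tau\in\mathbb R$ let $E_{\sigma,\tau}=\{z\in C((-\infty,\tau];X)\colon\|z\|_{E_{\sigma,\tau}}=\sup_{t\le\tau}e^{\sigma(t-\tau)}\|z(t)\|_t<\infty\}$.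 For $\eta\in X$ let $z_{\tau,\eta}$ be the unique function in $E_{\sigma,\tau}$ with $$z_{\tau,\eta}(t)=L(t,\tau)Q(\tau)\eta-\int_t^\tau L(t,s)Q(s)f(s,z_{\tau,\eta}(s))\,ds+\int_{-\infty}^tL(t,s)(I-Q(s))f(s,z_{\tau,\eta}(s))\,ds,\quad t\le\tau$$ (it exists and is unique under the gap condition). Then $\Sigma(\tau,\eta)=(I-Q(\tau))z_{\tau,\eta}(\tau)$. $D_\eta[z_{\tau,\eta}(s)]\in\mathcal L(X)$ denotes the Fréchet derivative of the map $X\ni\eta\mapsto z_{\tau,\eta}(s)\in X$, for fixed $s\le\tau$ (part of the assertion is that it exists). *)

theory Defs
  imports "HOL-Analysis.Analysis"
begin

text \<open>Processes are families indexed by all pairs of reals; for a process \<open>L\<close>,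
  the values \<open>L t \<tau>\<close> with \<open>t < \<tau>\<close> are never constrained and never used.\<close>

definition linear_evolution_process :: "(real \<Rightarrow> real \<Rightarrow> 'a::banach \<Rightarrow>\<^sub>L 'a) \<Rightarrow> bool" where
  "linear_evolution_process L \<longleftrightarrow>
     (\<forall>t s \<tau>. \<tau> \<le> s \<and> s \<le> t \<longrightarrow> L t \<tau> = L t s o\<^sub>L L s \<tau>) \<and>
     (\<forall>t. L t t = id_blinfun) \<and>
     (\<forall>\<eta>. continuous_on {(t, \<tau>). \<tau> \<le> t} (\<lambda>(t, \<tau>). blinfun_apply (L t \<tau>) \<eta>))"

text \<open>For \<open>t < \<tau>\<close> this is the inverse \<open>Q(\<tau>)X \<rightarrow> Q(t)X\<close> of the restriction of \<open>L \<tau> t\<close>;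
  it is only meaningful on \<open>Q(\<tau>)X\<close>.\<close>

definition ext_process ::
  "(real \<Rightarrow> real \<Rightarrow> 'a::banach \<Rightarrow>\<^sub>L 'a) \<Rightarrow> (real \<Rightarrow> 'a \<Rightarrow>\<^sub>L 'a) \<Rightarrow> real \<Rightarrow> real \<Rightarrow> 'a \<Rightarrow> 'a" where
  "ext_process L Q t \<tau> x =
     (if \<tau> \<le> t then blinfun_apply (L t \<tau>) x
      else inv_into (range (blinfun_apply (Q t))) (blinfun_apply (L \<tau> t)) x)"

text \<open>Isomorphisms are those of normed spaces: the bounded linear map \<open>L t \<tau>\<close> restricts to a
  bijection with continuous inverse. Hence the operator whose \<open>onorm\<close> occurs in the last clause
  is bounded.\<close>

definition exponential_splitting ::
  "(real \<Rightarrow> real \<Rightarrow> 'a::banach \<Rightarrow>\<^sub>L 'a) \<Rightarrow> (real \<Rightarrow> 'a \<Rightarrow>\<^sub>L 'a) \<Rightarrow> real \<Rightarrow> real \<Rightarrow> real \<Rightarrow> bool" where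
  "exponential_splitting L Q M \<gamma> \<rho> \<longleftrightarrow>
     M \<ge> 1 \<and> \<rho> < \<gamma> \<and>
     (\<forall>t. Q t o\<^sub>L Q t = Q t) \<and>
     (\<forall>t \<tau>. \<tau> \<le> t \<longrightarrow> Q t o\<^sub>L L t \<tau> = L t \<tau> o\<^sub>L Q \<tau>) \<and>
     (\<forall>t \<tau>. \<tau> \<le> t \<longrightarrow>
        (\<exists>g. homeomorphism (range (blinfun_apply (Q \<tau>))) (range (blinfun_apply (Q t)))
               (blinfun_apply (L t \<tau>)) g)) \<and>
     (\<forall>t \<tau>. \<tau> \<le> t \<longrightarrow> exp (\<gamma> * (t - \<tau>)) * norm (L t \<tau> o\<^sub>L (id_blinfun - Q \<tau>)) \<le> M) \<and>
     (\<forall>t \<tau>. t \<le> \<tau> \<longrightarrow>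
        exp (\<rho> * (t - \<tau>)) * onorm (\<lambda>x. ext_process L Q t \<tau> (blinfun_apply (Q \<tau>) x)) \<le> M)"

text \<open>The norms on \<open>N(\<tau>) = Q(\<tau>)X\<close> and \<open>S(\<tau>) = (I - Q(\<tau>))X\<close>. On these subspaces the suprema are
  finite under an exponential splitting; elsewhere the values are irrelevant.\<close>

definition norm_N ::
  "(real \<Rightarrow> real \<Rightarrow> 'a::banach \<Rightarrow>\<^sub>L 'a) \<Rightarrow> (real \<Rightarrow> 'a \<Rightarrow>\<^sub>L 'a) \<Rightarrow> real \<Rightarrow> real \<Rightarrow> 'a \<Rightarrow> real" where
  "norm_N L Q \<rho> \<tau> x = (SUP t\<in>{..\<tau>}. exp (\<rho> * (t - \<tau>)) * norm (ext_process L Q t \<tau> x))"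

definition norm_S :: "(real \<Rightarrow> real \<Rightarrow> 'a::banach \<Rightarrow>\<^sub>L 'a) \<Rightarrow> real \<Rightarrow> real \<Rightarrow> 'a \<Rightarrow> real" where
  "norm_S L \<gamma> \<tau> x = (SUP t\<in>{\<tau>..}. exp (\<gamma> * (t - \<tau>)) * norm (blinfun_apply (L t \<tau>) x))"

definition admissible_norm :: "(real \<times> real \<Rightarrow> real) \<Rightarrow> bool" where
  "admissible_norm \<Gamma> \<longleftrightarrow>
     (\<forall>p. 0 \<le> \<Gamma> p) \<and>
     (\<forall>p. \<Gamma> p = 0 \<longleftrightarrow> p = 0) \<and>
     (\<forall>c p. \<Gamma> (c *\<^sub>R p) = \<bar>c\<bar> * \<Gamma> p) \<and>
     (\<forall>p q. \<Gamma> (p + q) \<le> \<Gamma> p + \<Gamma> q) \<and>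
     (\<forall>a\<ge>0. mono_on {0..} (\<lambda>b. \<Gamma> (a, b))) \<and>
     (\<forall>b\<ge>0. mono_on {0..} (\<lambda>a. \<Gamma> (a, b)))"

definition split_norm ::
  "(real \<Rightarrow> real \<Rightarrow> 'a::banach \<Rightarrow>\<^sub>L 'a) \<Rightarrow> (real \<Rightarrow> 'a \<Rightarrow>\<^sub>L 'a) \<Rightarrow> real \<Rightarrow> real \<Rightarrow>
   (real \<times> real \<Rightarrow> real) \<Rightarrow> real \<Rightarrow> 'a \<Rightarrow> real" where
  "split_norm L Q \<gamma> \<rho> \<Gamma> \<tau> x =
     \<Gamma> (norm_N L Q \<rho> \<tau> (blinfun_apply (Q \<tau>) x),
        norm_S L \<gamma> \<tau> (blinfun_apply (id_blinfun - Q \<tau>) x))"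

definition splitting_lipschitz ::
  "(real \<Rightarrow> real \<Rightarrow> 'a::banach \<Rightarrow>\<^sub>L 'a) \<Rightarrow> (real \<Rightarrow> 'a \<Rightarrow>\<^sub>L 'a) \<Rightarrow> real \<Rightarrow> real \<Rightarrow>
   (real \<times> real \<Rightarrow> real) \<Rightarrow> (real \<Rightarrow> 'a \<Rightarrow> 'a) \<Rightarrow> real \<Rightarrow> real \<Rightarrow> bool" where
  "splitting_lipschitz L Q \<gamma> \<rho> \<Gamma> f L\<^sub>1 L\<^sub>2 \<longleftrightarrow>
     (\<forall>t u v.
        norm_N L Q \<rho> t (blinfun_apply (Q t) (f t u - f t v))
          \<le> L\<^sub>1 * split_norm L Q \<gamma> \<rho> \<Gamma> t (u - v) \<and>
        norm_S L \<gamma> t (blinfun_apply (id_blinfun - Q t) (f t u - f t v))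
          \<le> L\<^sub>2 * split_norm L Q \<gamma> \<rho> \<Gamma> t (u - v))"

text \<open>All integrals are Henstock--Kurzweil integrals: the library's Bochner integral needs a
  second countable range, whereas the Banach space here is arbitrary.\<close>

definition nonlinear_process ::
  "(real \<Rightarrow> real \<Rightarrow> 'a::banach \<Rightarrow>\<^sub>L 'a) \<Rightarrow> (real \<Rightarrow> 'a \<Rightarrow> 'a) \<Rightarrow> (real \<Rightarrow> real \<Rightarrow> 'a \<Rightarrow> 'a) \<Rightarrow> bool" where
  "nonlinear_process L f T \<longleftrightarrow>
     (\<forall>t. T t t = id) \<and>
     (\<forall>t s \<tau>. \<tau> \<le> s \<and> s \<le> t \<longrightarrow> T t s \<circ> T s \<tau> = T t \<tau>) \<and>
     (\<forall>\<tau> \<eta>. continuous_on {\<tau>..} (\<lambda>t. T t \<tau> \<eta>)) \<and>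
     (\<forall>t \<tau> \<eta>. \<tau> \<le> t \<longrightarrow>
        T t \<tau> \<eta> = blinfun_apply (L t \<tau>) \<eta>
          + integral {\<tau>..t} (\<lambda>s. blinfun_apply (L t s) (f s (T s \<tau> \<eta>))))"

text \<open>The space \<open>E\<^sub>\<sigma>\<^sub>,\<^sub>\<tau>\<close>. Functions on \<open>(-\<infinity>, \<tau>]\<close> are represented by functions on the reals
  that are \<open>undefined\<close> to the right of \<open>\<tau>\<close>, so that they are determined by their values on
  \<open>(-\<infinity>, \<tau>]\<close>.\<close>

definition backward_space ::
  "(real \<Rightarrow> real \<Rightarrow> 'a::banach \<Rightarrow>\<^sub>L 'a) \<Rightarrow> (real \<Rightarrow> 'a \<Rightarrow>\<^sub>L 'a) \<Rightarrow> real \<Rightarrow> real \<Rightarrow>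
   (real \<times> real \<Rightarrow> real) \<Rightarrow> real \<Rightarrow> real \<Rightarrow> (real \<Rightarrow> 'a) set" where
  "backward_space L Q \<gamma> \<rho> \<Gamma> \<sigma> \<tau> =
     {z \<in> extensional {..\<tau>}. continuous_on {..\<tau>} z \<and>
        bdd_above ((\<lambda>t. exp (\<sigma> * (t - \<tau>)) * split_norm L Q \<gamma> \<rho> \<Gamma> t (z t)) ` {..\<tau>})}"

text \<open>The function \<open>z\<^sub>\<tau>\<^sub>,\<^sub>\<eta>\<close>. For \<open>z\<close> in \<open>backward_space\<close> and \<open>f\<close> continuous, Lipschitz and vanishing
  at \<open>0\<close>, both integrands are continuous and the improper one decays exponentially, so the
  integrals exist.\<close>

definition backward_solution ::
  "(real \<Rightarrow> real \<Rightarrow> 'a::banach \<Rightarrow>\<^sub>L 'a) \<Rightarrow> (real \<Rightarrow> 'a \<Rightarrow>\<^sub>L 'a) \<Rightarrow> real \<Rightarrow> real \<Rightarrow>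
   (real \<times> real \<Rightarrow> real) \<Rightarrow> (real \<Rightarrow> 'a \<Rightarrow> 'a) \<Rightarrow> real \<Rightarrow> real \<Rightarrow> 'a \<Rightarrow> real \<Rightarrow> 'a" where
  "backward_solution L Q \<gamma> \<rho> \<Gamma> f \<sigma> \<tau> \<eta> =
     (THE z. z \<in> backward_space L Q \<gamma> \<rho> \<Gamma> \<sigma> \<tau> \<and>
        (\<forall>t\<le>\<tau>. z t =
           ext_process L Q t \<tau> (blinfun_apply (Q \<tau>) \<eta>)
           - integral {t..\<tau>} (\<lambda>s. ext_process L Q t s (blinfun_apply (Q s) (f s (z s))))
           + integral {..t} (\<lambda>s. blinfun_apply (L t s)
                                   (blinfun_apply (id_blinfun - Q s) (f s (z s))))))"

definition manifold_map ::
  "(real \<Rightarrow> real \<Rightarrow> 'a::banach \<Rightarrow>\<^sub>L 'a) \<Rightarrow> (real \<Rightarrow> 'a \<Rightarrow>\<^sub>L 'a) \<Rightarrow> real \<Rightarrow> real \<Rightarrow>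
   (real \<times> real \<Rightarrow> real) \<Rightarrow> (real \<Rightarrow> 'a \<Rightarrow> 'a) \<Rightarrow> real \<Rightarrow> real \<Rightarrow> 'a \<Rightarrow> 'a" where
  "manifold_map L Q \<gamma> \<rho> \<Gamma> f \<sigma> \<tau> \<eta> =
     blinfun_apply (id_blinfun - Q \<tau>) (backward_solution L Q \<gamma> \<rho> \<Gamma> f \<sigma> \<tau> \<eta> \<tau>)"

end

theory Submission
  imports Defs
begin

text \<open>Differences of the solutions \<open>z\<^sub>\<tau>\<^sub>,\<^sub>\<eta>\<close> satisfy the same backward integral equation as the solutions
  themselves, and the gap condition makes the right-hand side a contraction in the weighted norm.
  A linear combination of increments \<open>z\<^sub>\<tau>\<^sub>,\<^sub>\<eta>\<^sub>+\<^sub>h - z\<^sub>\<tau>\<^sub>,\<^sub>\<eta>\<close> whose coefficients annihilate the vectors \<open>h\<close> is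
  therefore controlled by the Taylor remainders of \<open>f\<close> alone, and these are \<open>o(\<parallel>h\<parallel>)\<close> by dominated
  convergence once the exponent \<open>\<sigma>\<close> is slightly increased. This single estimate gives existence,
  linearity and Frechet character of the derivative at once, without solving the linearised equation.
  The formula for the derivative of \<open>\<Sigma>\<close> then follows from dominated convergence in \<open>X\<close>.\<close>

subsection \<open>Integration of Banach space valued functions\<close>

text \<open>The obstacle is that nothing is assumed about how \<open>Df t u\<close> varies with
  \<open>t\<close> or \<open>u\<close>. Along a solution the linearised integrand need not be
  continuous in time, so the equation that the derivative ought to satisfy cannot simply be solved
  in a space of continuous functions. Hence the integral operator is applied only to increments of
  \<open>f\<close>, which are continuous; \<open>Df\<close> enters through pointwise bounds, where
  it inherits the constants of \<open>f\<close> from difference quotients. The second obstacle is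
  the lack of uniformity: at a fixed time the remainder is o(|h|), but over the half-line it is only
  bounded by a multiple of |h| exp(sigma (tau - s)). The weight sigma does not make this majorant
  integrable, a weight mu > sigma does. The contraction estimate therefore accepts two kinds of
  forcing at once: one measured in the weighted supremum and contracted, one measured in weighted L1
  and merely added. Three increments per combination suffice: two compare difference quotients or
  multiples, three compare a sum with its summands. Measuring with norms adapted to the splitting
  keeps \<open>M\<close> out of the contraction constant.\<close>

lemma norm_diff_triangle3:
  fixes x y x' y' :: "'a::real_normed_vector"
  shows "norm (x - y) \<le> norm (x - x') + norm (x' - y') + norm (y' - y)"
  using norm_triangle_ineq[of "x - x'" "x' - y"] norm_triangle_ineq[of "x' - y'" "y' - y"] by simp

text \<open>The integrals of \<open>G n\<close> form a Cauchy sequence with some limit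
  \<open>I\<close>. On a partition fine for both \<open>G n\<close> and \<open>h n\<close>, the
  Riemann sums of \<open>g\<close> and \<open>G n\<close> differ by at most the Riemann sum of
  \<open>h n\<close>, which is close to a small number; so the sums of \<open>g\<close> approach
  \<open>I\<close>. No measurability of \<open>g\<close> is involved.\<close>

lemma integrable_L1_limit_cbox:
  fixes g :: "'n::euclidean_space \<Rightarrow> 'a::banach"
  assumes G: "\<And>n. G n integrable_on cbox a b"
    and h: "\<And>n. h n integrable_on cbox a b"
    and le: "\<And>n x. x \<in> cbox a b \<Longrightarrow> norm (g x - G n x) \<le> h n x"
    and lim: "(\<lambda>n. integral (cbox a b) (h n)) \<longlonglongrightarrow> 0"
  shows "g integrable_on cbox a b"
proof -
  let ?B = "cbox a b"
  have tri: "norm (integral ?B (G n) - integral ?B (G m)) \<le> integral ?B (h n) + integral ?B (h m)" for n m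
  proof -
    have "norm (integral ?B (\<lambda>x. G n x - G m x)) \<le> integral ?B (\<lambda>x. h n x + h m x)"
    proof (rule integral_norm_bound_integral)
      fix x assume x: "x \<in> ?B"
      have "norm (G n x - G m x) \<le> norm (g x - G n x) + norm (g x - G m x)"
        by (metis norm_minus_commute norm_triangle_le dist_norm dist_triangle)
      then show "norm (G n x - G m x) \<le> h n x + h m x"
        using le[OF x, of n] le[OF x, of m] by linarith
    qed (intro integrable_diff integrable_add G h)+
    then show ?thesis by (simp add: integral_diff integral_add G h)
  qed
  have "Cauchy (\<lambda>n. integral ?B (G n))"
  proof (rule CauchyI)
    fix e :: real assume "0 < e"
    then have "eventually (\<lambda>n. integral ?B (h n) < e/2) sequentially"
      using order_tendstoD(2)[OF lim, of "e/2"] by simp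
    then obtain N where N: "\<And>n. n \<ge> N \<Longrightarrow> integral ?B (h n) < e/2"
      by (auto simp: eventually_sequentially)
    show "\<exists>N. \<forall>m\<ge>N. \<forall>n\<ge>N. norm (integral ?B (G m) - integral ?B (G n)) < e"
      using tri N by (smt (verit) field_sum_of_halves)
  qed
  then obtain I where I: "(\<lambda>n. integral ?B (G n)) \<longlonglongrightarrow> I"
    by (auto simp: Cauchy_convergent_iff convergent_def)
  have "(g has_integral I) ?B"
    unfolding has_integral
  proof (intro allI impI)
    fix e :: real assume e: "0 < e"
    have "eventually (\<lambda>n. integral ?B (h n) < e/4 \<and> norm (integral ?B (G n) - I) < e/4) sequentially"
      using order_tendstoD(2)[OF lim, of "e/4"] tendstoD[OF I, of "e/4"] e
      by (simp add: eventually_conj_iff dist_norm)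
    then obtain n where n: "integral ?B (h n) < e/4" "norm (integral ?B (G n) - I) < e/4"
      by (auto simp: eventually_sequentially)
    have e4: "0 < e/4" using e by simp
    obtain \<gamma>1 where \<gamma>1: "gauge \<gamma>1" "\<And>D. D tagged_division_of ?B \<Longrightarrow> \<gamma>1 fine D \<Longrightarrow>
        norm ((\<Sum>(x, k)\<in>D. measure lborel k *\<^sub>R G n x) - integral ?B (G n)) < e/4"
      using has_integral[THEN iffD1, rule_format, OF integrable_integral[OF G[of n]] e4] by metis
    obtain \<gamma>2 where \<gamma>2: "gauge \<gamma>2" "\<And>D. D tagged_division_of ?B \<Longrightarrow> \<gamma>2 fine D \<Longrightarrow>
        norm ((\<Sum>(x, k)\<in>D. measure lborel k *\<^sub>R h n x) - integral ?B (h n)) < e/4"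
      using has_integral[THEN iffD1, rule_format, OF integrable_integral[OF h[of n]] e4] by metis
    show "\<exists>\<gamma>. gauge \<gamma> \<and> (\<forall>D. D tagged_division_of ?B \<and> \<gamma> fine D \<longrightarrow>
        norm ((\<Sum>(x, k)\<in>D. measure lborel k *\<^sub>R g x) - I) < e)"
    proof (intro exI conjI allI impI)
      show "gauge (\<lambda>x. \<gamma>1 x \<inter> \<gamma>2 x)" using \<gamma>1 \<gamma>2 by (simp add: gauge_Int)
      fix D assume "D tagged_division_of ?B \<and> (\<lambda>x. \<gamma>1 x \<inter> \<gamma>2 x) fine D"
      then have D: "D tagged_division_of ?B" "\<gamma>1 fine D" "\<gamma>2 fine D" by (auto simp: fine_Int)
      have "norm ((\<Sum>(x, k)\<in>D. measure lborel k *\<^sub>R g x) - (\<Sum>(x, k)\<in>D. measure lborel k *\<^sub>R G n x))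
          = norm (\<Sum>(x, k)\<in>D. measure lborel k *\<^sub>R (g x - G n x))"
        by (simp add: sum_subtractf case_prod_unfold scaleR_diff_right)
      also have "\<dots> \<le> (\<Sum>(x, k)\<in>D. measure lborel k *\<^sub>R h n x)"
      proof (rule sum_norm_le, clarify)
        fix x k assume "(x, k) \<in> D"
        then have "x \<in> ?B" using D(1) by blast
        then show "norm (measure lborel k *\<^sub>R (g x - G n x)) \<le> measure lborel k *\<^sub>R h n x"
          using le[of x n] by (simp add: mult_left_mono)
      qed
      finally show "norm ((\<Sum>(x, k)\<in>D. measure lborel k *\<^sub>R g x) - I) < e"
        using \<gamma>1(2)[OF D(1,2)] \<gamma>2(2)[OF D(1,3)] n
          norm_diff_triangle3[of "\<Sum>(x, k)\<in>D. measure lborel k *\<^sub>R g x" I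
            "\<Sum>(x, k)\<in>D. measure lborel k *\<^sub>R G n x" "integral ?B (G n)"]
        unfolding real_norm_def by linarith
    qed
  qed
  then show ?thesis by blast
qed

text \<open>After extension by zero, the integrals of \<open>g\<close> and \<open>G n\<close> over
  any box differ by at most \<open>integral S (h n)\<close>. This bound does not depend on the box,
  so the Cauchy condition over large boxes passes from \<open>G n\<close> to
  \<open>g\<close>.\<close>

lemma integrable_L1_limit:
  fixes g :: "'n::euclidean_space \<Rightarrow> 'a::banach"
  assumes G: "\<And>n. G n integrable_on S"
    and h: "\<And>n. h n integrable_on S"
    and le: "\<And>n x. x \<in> S \<Longrightarrow> norm (g x - G n x) \<le> h n x"
    and lim: "(\<lambda>n. integral S (h n)) \<longlonglongrightarrow> 0"
  shows "g integrable_on S" and "(\<lambda>n. integral S (G n)) \<longlonglongrightarrow> integral S g"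
proof -
  let ?r = "\<lambda>f x. if x \<in> S then f x else 0"
  have h0: "0 \<le> h n x" if "x \<in> S" for n x using le[OF that, of n] norm_ge_zero order_trans by blast
  have rG: "?r (G n) integrable_on cbox a b" and rh: "?r (h n) integrable_on cbox a b" for n a b
    using integrable_altD(1) G h by blast+
  have hb: "integral (cbox a b) (?r (h n)) \<le> integral S (h n)" for n a b
  proof -
    have "integral (cbox a b) (?r (h n)) \<le> integral UNIV (?r (h n))"
      using h h0 by (intro integral_subset_le rh) (auto simp: integrable_restrict_UNIV)
    then show ?thesis by (simp add: integral_restrict_UNIV)
  qed
  have hb0: "0 \<le> integral (cbox a b) (?r (h n))" for n a b
    using rh h0 by (intro integral_nonneg) auto
  have rg: "?r g integrable_on cbox a b" for a b
  proof (rule integrable_L1_limit_cbox[OF rG rh])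
    show "(\<lambda>n. integral (cbox a b) (?r (h n))) \<longlonglongrightarrow> 0"
      by (rule real_tendsto_sandwich[OF _ _ tendsto_const lim]) (use hb hb0 in auto)
  qed (use le in auto)
  have bx: "norm (integral (cbox a b) (?r g) - integral (cbox a b) (?r (G n))) \<le> integral S (h n)" for n a b
  proof -
    have "norm (integral (cbox a b) (\<lambda>x. ?r g x - ?r (G n) x)) \<le> integral (cbox a b) (?r (h n))"
      by (rule integral_norm_bound_integral[OF integrable_diff[OF rg rG] rh]) (use le in auto)
  then show ?thesis using hb[of a b n] by (simp add: integral_diff[OF rg rG])
  qed
  show "g integrable_on S"
    unfolding integrable_alt[of g]
  proof (intro conjI allI impI rg)
    fix e :: real assume e: "0 < e"
    have "eventually (\<lambda>n. integral S (h n) < e/4) sequentially"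
      using order_tendstoD(2)[OF lim, of "e/4"] e by simp
    then obtain n where n: "integral S (h n) < e/4" by (auto simp: eventually_sequentially)
    have e4: "0 < e/4" using e by simp
    obtain B where B: "B > 0" "\<And>a b c d. ball 0 B \<subseteq> cbox a b \<Longrightarrow> ball 0 B \<subseteq> cbox c d \<Longrightarrow>
        norm (integral (cbox a b) (?r (G n)) - integral (cbox c d) (?r (G n))) < e/4"
      using integrable_altD(2)[OF G[of n] e4] by (elim exE conjE) (erule that, elim allE impE, rule conjI, assumption+)
    show "\<exists>B>0. \<forall>a b c d. ball 0 B \<subseteq> cbox a b \<and> ball 0 B \<subseteq> cbox c d \<longrightarrow>
        norm (integral (cbox a b) (?r g) - integral (cbox c d) (?r g)) < e"
    proof (intro exI conjI allI impI)
      fix a b c d :: 'n assume "ball 0 B \<subseteq> cbox a b \<and> ball 0 B \<subseteq> cbox c d"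
      then have 1: "norm (integral (cbox a b) (?r (G n)) - integral (cbox c d) (?r (G n))) < e/4"
        by (intro B(2)) simp_all
      have 2: "norm (integral (cbox c d) (?r (G n)) - integral (cbox c d) (?r g)) \<le> integral S (h n)"
        by (subst norm_minus_commute) (rule bx)
      show "norm (integral (cbox a b) (?r g) - integral (cbox c d) (?r g)) < e"
        using norm_diff_triangle3[of "integral (cbox a b) (?r g)" "integral (cbox c d) (?r g)"
          "integral (cbox a b) (?r (G n))" "integral (cbox c d) (?r (G n))"] 1 2 bx[of a b n] n e
        by linarith
    qed (rule B)
  qed
  then have "norm (integral S (G n) - integral S g) \<le> integral S (h n)" for n
    using integral_norm_bound_integral[OF integrable_diff[OF \<open>g integrable_on S\<close> G[of n]] h[of n]] le
      integral_diff[OF \<open>g integrable_on S\<close> G[of n]]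
    by (simp add: norm_minus_commute)
  then show "(\<lambda>n. integral S (G n)) \<longlonglongrightarrow> integral S g"
    by (intro LIM_zero_cancel[OF Lim_null_comparison[OF _ lim]]) auto
qed

text \<open>The truncations of \<open>g\<close> to \<open>{t - n..t}\<close> are integrable by
  continuity, and what they miss is dominated by the tail of \<open>h\<close>, whose integral tends
  to zero.\<close>

lemma continuous_dominated_integrable:
  fixes g :: "real \<Rightarrow> 'a::banach"
  assumes g: "continuous_on {..t} g" and h: "h integrable_on {..t}"
    and le: "\<And>s. s \<le> t \<Longrightarrow> norm (g s) \<le> h s"
  shows "g integrable_on {..t}"
proof (rule integrable_L1_limit(1))
  let ?A = "\<lambda>n::nat. {t - real n..t}"
  have h0: "0 \<le> h s" if "s \<le> t" for s using le[OF that] norm_ge_zero order_trans by blast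
  show "(\<lambda>s. if s \<in> ?A n then g s else 0) integrable_on {..t}" for n
  proof -
    have "g integrable_on ?A n"
      by (rule integrable_continuous_interval) (rule continuous_on_subset[OF g], auto)
    moreover have "?A n \<inter> {..t} = ?A n" by auto
    ultimately show ?thesis by (subst integrable_restrict_Int) auto
  qed
  have hn: "(\<lambda>s. if s \<in> ?A n then h s else 0) integrable_on {..t}" for n
  proof -
    have "h integrable_on ?A n"
      using integrable_on_subcbox[OF h, of "t - real n" t] by auto
    moreover have "?A n \<inter> {..t} = ?A n" by auto
    ultimately show ?thesis by (subst integrable_restrict_Int) auto
  qed
  show hd: "(\<lambda>s. h s - (if s \<in> ?A n then h s else 0)) integrable_on {..t}" for n
    by (intro integrable_diff h hn)
  show "norm (g s - (if s \<in> ?A n then g s else 0)) \<le> h s - (if s \<in> ?A n then h s else 0)"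
    if "s \<in> {..t}" for s n using le[of s] that by auto
  have "(\<lambda>n. integral {..t} (\<lambda>s. h s - (if s \<in> ?A n then h s else 0))) \<longlonglongrightarrow> integral {..t} (\<lambda>s. 0)"
  proof (rule dominated_convergence(2)[OF hd h])
    fix s assume s: "s \<in> {..t}"
    obtain N :: nat where "t - s \<le> real N" using real_arch_simple by blast
    then have "h s - (if s \<in> ?A n then h s else 0) = 0" if "n \<ge> N" for n using that s by auto
    then show "(\<lambda>n. h s - (if s \<in> ?A n then h s else 0)) \<longlonglongrightarrow> 0"
      by (intro tendsto_eventually eventually_sequentiallyI[of N])
  qed (use h0 in auto)
  then show "(\<lambda>n. integral {..t} (\<lambda>s. h s - (if s \<in> ?A n then h s else 0))) \<longlonglongrightarrow> 0" by simp
qed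

text \<open>Everything is reduced to real functions. The norms of \<open>G k - G n\<close> are
  continuous and dominated by \<open>2 * h\<close>; letting \<open>k\<close> grow makes the norm of
  \<open>g - G n\<close> integrable, and letting \<open>n\<close> grow sends its integral to zero.
  The L1 limit lemma then handles \<open>g\<close> itself, about whose regularity nothing is known
  beforehand.\<close>

lemma dominated_convergence_continuous_banach:
  fixes g :: "real \<Rightarrow> 'a::banach"
  assumes G: "\<And>n. continuous_on {..t} (G n)" and h: "h integrable_on {..t}"
    and le: "\<And>n s. s \<le> t \<Longrightarrow> norm (G n s) \<le> h s"
    and lim: "\<And>s. s \<le> t \<Longrightarrow> (\<lambda>n. G n s) \<longlonglongrightarrow> g s"
  shows "g integrable_on {..t}" and "(\<lambda>n. integral {..t} (G n)) \<longlonglongrightarrow> integral {..t} g"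
proof -
  have h2: "(\<lambda>s. 2 * h s) integrable_on {..t}"
    using integrable_on_cmult_left[OF h, of 2] by simp
  have gle: "norm (g s) \<le> h s" if "s \<le> t" for s
    by (rule LIMSEQ_le_const2[OF tendsto_norm[OF lim[OF that]]]) (use le that in auto)
  have nle: "norm (G k s - G n s) \<le> 2 * h s" if "s \<le> t" for k n s
    using norm_triangle_ineq4[of "G k s" "G n s"] le[OF that, of k] le[OF that, of n] by linarith
  have int: "(\<lambda>s. norm (G k s - G n s)) integrable_on {..t}" for k n
    by (rule continuous_dominated_integrable[OF _ h2]) (use nle in \<open>auto intro!: continuous_intros G\<close>)
  have d: "(\<lambda>s. norm (g s - G n s)) integrable_on {..t}" for n
    by (rule dominated_convergence(1)[where f = "\<lambda>k s. norm (G k s - G n s)", OF int h2])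
      (use nle in \<open>auto intro!: tendsto_intros lim\<close>)
  have "(\<lambda>n. integral {..t} (\<lambda>s. norm (g s - G n s))) \<longlonglongrightarrow> integral {..t} (\<lambda>s. 0)"
  proof (rule dominated_convergence(2)[OF d h2])
    show "norm (norm (g s - G n s)) \<le> 2 * h s" if "s \<in> {..t}" for s n
      using norm_triangle_ineq4[of "g s" "G n s"] le[of s n] gle[of s] that by simp
    show "(\<lambda>n. norm (g s - G n s)) \<longlonglongrightarrow> 0" if "s \<in> {..t}" for s
      using that tendsto_norm_zero[OF LIM_zero[OF lim[of s]]] by (simp add: norm_minus_commute)
  qed
  then have l0: "(\<lambda>n. integral {..t} (\<lambda>s. norm (g s - G n s))) \<longlonglongrightarrow> 0" by simp
  have Gi: "G n integrable_on {..t}" for n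
    by (rule continuous_dominated_integrable[OF G h le])
  show "g integrable_on {..t}" "(\<lambda>n. integral {..t} (G n)) \<longlonglongrightarrow> integral {..t} g"
    by (rule integrable_L1_limit[OF Gi d order_refl l0])+
qed

lemma has_integral_exp_atMost:
  fixes a t :: real
  assumes "a > 0"
  shows "((\<lambda>s. exp (a * (s - t))) has_integral 1 / a) {..t}"
proof -
  let ?f = "\<lambda>x. exp (- a * x)"
  have hf: "(?f has_integral exp (- a * (- t)) / a) {- t..}"
    by (rule has_integral_exp_minus_to_infinity[OF assms])
  then have "?f absolutely_integrable_on {- t..} \<and> integral {- t..} ?f = exp (a * t) / a"
    by (auto intro!: nonnegative_absolutely_integrable_1)
  then have "(\<lambda>x. ?f (- x)) absolutely_integrable_on {..t} \<and> integral {..t} (\<lambda>x. ?f (- x)) = exp (a * t) / a"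
    by (subst has_absolute_integral_reflect_real[where B = "{- t..}"]) auto
  then have "((\<lambda>x. ?f (- x)) has_integral exp (a * t) / a) {..t}"
    using set_lebesgue_integral_eq_integral(1) has_integral_iff by blast
  from has_integral_mult_right[OF this, of "exp (- (a * t))"]
  show ?thesis by (simp add: right_diff_distrib flip: exp_add)
qed

text \<open>A local form of the uniform limit theorem: the approximant may change with
  \<open>e\<close> and has to be continuous only at the one point \<open>t\<close>. This fits
  integrals that become a continuous orbit once a short piece is cut off.\<close>

lemma continuous_at_within_approximation:
  fixes y :: "real \<Rightarrow> 'a::real_normed_vector"
  assumes "\<And>e. e > 0 \<Longrightarrow> \<exists>\<phi>. continuous (at t within I) \<phi> \<and> norm (y t - \<phi> t) \<le> e \<and>
     eventually (\<lambda>s. norm (y s - \<phi> s) \<le> e) (at t within I)"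
  shows "continuous (at t within I) y"
  unfolding continuous_within
proof (rule tendstoI)
  fix e :: real assume e: "e > 0"
  then obtain \<phi> where p: "continuous (at t within I) \<phi>" "norm (y t - \<phi> t) \<le> e/4"
    "eventually (\<lambda>s. norm (y s - \<phi> s) \<le> e/4) (at t within I)"
    using assms[of "e/4"] by auto
  have "eventually (\<lambda>s. dist (\<phi> s) (\<phi> t) < e/4) (at t within I)"
    using p(1) e unfolding continuous_within by (intro tendstoD) auto
  with p(3) show "eventually (\<lambda>s. dist (y s) (y t) < e) (at t within I)"
  proof eventually_elim
    case (elim s)
    then show ?case
      using p(2) e norm_diff_triangle3[of "y s" "y t" "\<phi> s" "\<phi> t"]
      unfolding dist_norm by (simp add: norm_minus_commute[of "\<phi> t"])
  qed
qed

text \<open>Apply the improvement to the least bound, the supremum \<open>K\<close>: it yields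
  \<open>K \<le> \<kappa> * K + b\<close>. Boundedness beforehand is essential, since otherwise
  there is no finite \<open>K\<close> to start from. This is how the contraction is exploited once
  the functions to be estimated are at hand.\<close>

lemma bound_of_self_improvement:
  fixes \<phi> :: "'b \<Rightarrow> real"
  assumes "bdd_above (\<phi> ` S)" and nonneg: "\<And>t. t \<in> S \<Longrightarrow> 0 \<le> \<phi> t" and "\<kappa> < 1"
    and imp: "\<And>K t. 0 \<le> K \<Longrightarrow> (\<And>s. s \<in> S \<Longrightarrow> \<phi> s \<le> K) \<Longrightarrow> t \<in> S \<Longrightarrow> \<phi> t \<le> \<kappa> * K + b"
    and "t \<in> S"
  shows "\<phi> t \<le> b / (1 - \<kappa>)"
proof -
  define K where "K = (SUP s\<in>S. \<phi> s)"
  have K: "\<phi> s \<le> K" if "s \<in> S" for s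
    unfolding K_def using assms(1) that by (intro cSUP_upper)
  have "0 \<le> K" using K[OF \<open>t \<in> S\<close>] nonneg[OF \<open>t \<in> S\<close>] by linarith
  then have "K \<le> \<kappa> * K + b"
    using imp[OF _ K] \<open>t \<in> S\<close> unfolding K_def by (intro cSUP_least) auto
  then have "K \<le> b / (1 - \<kappa>)" using \<open>\<kappa> < 1\<close> by (simp add: field_simps)
  then show ?thesis using K[OF \<open>t \<in> S\<close>] by linarith
qed

subsection \<open>Elementary estimates and a differentiability criterion\<close>

lemma exp_shift_le_iff:
  fixes a b c r t :: real
  shows "exp (c * (r - t)) * a \<le> b \<longleftrightarrow> a \<le> b * exp (c * (t - r))"
    and "exp (c * (r - t)) * a \<le> b \<longleftrightarrow> a \<le> b * exp (- c * (r - t))"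
proof -
  have "exp u * a \<le> b \<longleftrightarrow> a \<le> b * exp (- u)" for u
    by (simp add: exp_minus divide_inverse[symmetric] pos_le_divide_eq mult.commute)
  from this[of "c * (r - t)"]
  show "exp (c * (r - t)) * a \<le> b \<longleftrightarrow> a \<le> b * exp (c * (t - r))"
    and "exp (c * (r - t)) * a \<le> b \<longleftrightarrow> a \<le> b * exp (- c * (r - t))"
    by (simp_all add: algebra_simps)
qed

lemma div_exp_le_iff:
  "a * exp (- \<mu> * (\<tau> - s)) \<le> K \<longleftrightarrow> a \<le> K * exp (\<mu> * (\<tau> - s))" for a K \<mu> \<tau> s :: real
  using exp_shift_le_iff(1)[of \<mu> s \<tau> a K] by (simp add: algebra_simps)

lemma eventually_ball_at_within:
  fixes t0 :: real
  assumes "0 < \<delta>" "\<And>t. \<bar>t - t0\<bar> < \<delta> \<Longrightarrow> t \<in> I \<Longrightarrow> P t"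
  shows "eventually P (at t0 within I)"
  unfolding eventually_at using assms by (auto simp: dist_real_def)

lemma small_multiple:
  fixes C e :: real
  assumes "0 \<le> C" "0 < e"
  obtains \<delta> where "0 < \<delta>" "\<delta> \<le> 1" "C * (2 * \<delta>) \<le> e"
proof -
  \<comment> \<open>The extra \<open>1\<close> in the denominator keeps the quotient meaningful for
    \<open>C = 0\<close>.\<close>
  define \<delta> where "\<delta> = min 1 (e / (2 * C + 1))"
  have "0 < \<delta>" "\<delta> \<le> 1" and "\<delta> \<le> e / (2 * C + 1)"
    using assms by (auto simp: \<delta>_def)
  moreover from this(3) have "\<delta> * (2 * C + 1) \<le> e"
    using assms by (simp add: pos_le_divide_eq)
  ultimately show thesis by (intro that[of \<delta>]) (auto simp: algebra_simps)
qed

text \<open>Presents a derivative as the limit of a sequence of expressions in \<open>F\<close>, so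
  that bounds and integrability known for \<open>F\<close> can be carried over to
  \<open>D\<close>.\<close>

lemma has_derivative_difference_quotient:
  fixes F :: "'a::real_normed_vector \<Rightarrow> 'b::real_normed_vector"
  assumes "(F has_derivative D) (at x)"
  shows "(\<lambda>n. real (Suc n) *\<^sub>R (F (x + inverse (real (Suc n)) *\<^sub>R \<xi>) - F x)) \<longlonglongrightarrow> D \<xi>"
proof (cases "\<xi> = 0")
  case True
  then show ?thesis using linear_0[OF has_derivative_linear[OF assms]] by simp
next
  case False
  let ?h = "\<lambda>n. inverse (real (Suc n)) *\<^sub>R \<xi>"
  let ?q = "\<lambda>n. real (Suc n) *\<^sub>R (F (x + ?h n) - F x)"
  have lim: "((\<lambda>h. norm (F (x + h) - F x - D h) / norm h) \<longlongrightarrow> 0) (at 0)"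
    using assms unfolding has_derivative_at by blast
  have "?h \<longlonglongrightarrow> 0 *\<^sub>R \<xi>" by (intro tendsto_intros LIMSEQ_inverse_real_of_nat)
  then have "filterlim ?h (at 0) sequentially" unfolding filterlim_at using False by simp
  from tendsto_mult_left_zero[OF filterlim_compose[OF lim this], of "norm \<xi>"]
  have "(\<lambda>n. norm (F (x + ?h n) - F x - D (?h n)) / norm (?h n) * norm \<xi>) \<longlonglongrightarrow> 0" .
  moreover have "norm (F (x + ?h n) - F x - D (?h n)) / norm (?h n) * norm \<xi> = norm (?q n - D \<xi>)" for n
  proof -
    have "?q n - D \<xi> = real (Suc n) *\<^sub>R (F (x + ?h n) - F x - D (?h n))"
      by (simp add: scaleR_diff_right linear_scale[OF has_derivative_linear[OF assms]])
    then have "norm (?q n - D \<xi>) = real (Suc n) * norm (F (x + ?h n) - F x - D (?h n))"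
      by (simp del: of_nat_Suc)
    then show ?thesis using False by (simp add: field_simps del: of_nat_Suc)
  qed
  ultimately have "(\<lambda>n. norm (?q n - D \<xi>)) \<longlonglongrightarrow> 0" by (simp only:)
  then show ?thesis by (rule LIM_zero_cancel[OF tendsto_norm_zero_cancel])
qed

text \<open>\<open>J\<close> measures how far the increments of \<open>F\<close> are from being
  linear. Comparing two step lengths in one direction makes the difference quotients Cauchy, so the
  candidate \<open>D\<close> exists by completeness; comparing different directions makes it linear,
  and the Lipschitz bound makes it bounded. Since \<open>J h\<close> is o(|h|) uniformly in the
  direction, \<open>D\<close> is a Frechet derivative.\<close>

lemma has_derivative_if_almost_linear:
  fixes F :: "'a::real_normed_vector \<Rightarrow> 'b::banach" and J :: "'a \<Rightarrow> real"
  assumes comb: "\<And>a b c u v w. a *\<^sub>R u + b *\<^sub>R v + c *\<^sub>R w = 0 \<Longrightarrow>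
      norm (a *\<^sub>R (F (x + u) - F x) + b *\<^sub>R (F (x + v) - F x) + c *\<^sub>R (F (x + w) - F x))
        \<le> \<bar>a\<bar> * J u + \<bar>b\<bar> * J v + \<bar>c\<bar> * J w"
    and J: "((\<lambda>h. J h / norm h) \<longlongrightarrow> 0) (at 0)" and J0: "J 0 = 0"
    and lip: "\<And>h. norm (F (x + h) - F x) \<le> C * norm h"
  obtains D where "(F has_derivative D) (at x)"
proof -
  define G where "G h = F (x + h) - F x" for h
  let ?s = "\<lambda>n \<xi>. inverse (real (Suc n)) *\<^sub>R \<xi>"
  define q where "q \<xi> n = real (Suc n) *\<^sub>R G (?s n \<xi>)" for \<xi> n
  define j where "j \<xi> n = real (Suc n) * J (?s n \<xi>)" for \<xi> n
  define D where "D \<xi> = lim (q \<xi>)" for \<xi>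
  have comb': "norm (a *\<^sub>R G u + b *\<^sub>R G v + c *\<^sub>R G w) \<le> \<bar>a\<bar> * J u + \<bar>b\<bar> * J v + \<bar>c\<bar> * J w"
    if "a *\<^sub>R u + b *\<^sub>R v + c *\<^sub>R w = 0" for a b c u v w
    using comb[OF that] by (simp add: G_def)
  have j: "j \<xi> \<longlonglongrightarrow> 0" for \<xi>
  proof (cases "\<xi> = 0")
    case False
    have "(\<lambda>n. inverse (real (Suc n)) *\<^sub>R \<xi>) \<longlonglongrightarrow> 0 *\<^sub>R \<xi>"
      by (intro tendsto_intros LIMSEQ_inverse_real_of_nat)
    then have "filterlim (\<lambda>n. ?s n \<xi>) (at 0) sequentially"
      unfolding filterlim_at using False by simp
    from tendsto_mult_right_zero[OF filterlim_compose[OF J this], of "norm \<xi>"]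
    have "(\<lambda>n. norm \<xi> * (J (?s n \<xi>) / norm (?s n \<xi>))) \<longlonglongrightarrow> 0" .
    moreover have "norm \<xi> * (J (?s n \<xi>) / norm (?s n \<xi>)) = j \<xi> n" for n
      using False by (simp add: j_def divide_inverse mult_ac del: of_nat_Suc)
    ultimately show ?thesis by (simp only:)
  qed (simp add: j_def[abs_def] J0)
  \<comment> \<open>The coefficients \<open>m + 1\<close> and \<open>-(n + 1)\<close> undo the step
    lengths, so the vectors cancel; the third slot of the combination is filled with zero.\<close>
  have step: "norm (q \<xi> m - q \<xi> n) \<le> j \<xi> m + j \<xi> n" for \<xi> m n
    using comb'[of "real (Suc m)" "?s m \<xi>" "- real (Suc n)" "?s n \<xi>" 0 0] by (simp add: q_def j_def del: of_nat_Suc)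
  have "Cauchy (q \<xi>)" for \<xi>
  proof (rule CauchyI)
    fix e :: real assume e: "0 < e"
    obtain N where N: "\<And>n. n \<ge> N \<Longrightarrow> j \<xi> n < e / 2"
      using order_tendstoD(2)[OF j[of \<xi>], of "e / 2"] e by (auto simp: eventually_sequentially)
    show "\<exists>N. \<forall>m\<ge>N. \<forall>n\<ge>N. norm (q \<xi> m - q \<xi> n) < e"
    proof (intro exI[of _ N] allI impI)
      fix m n assume "N \<le> m" "N \<le> n"
      with N[of m] N[of n] step[of \<xi> m n] show "norm (q \<xi> m - q \<xi> n) < e" by linarith
    qed
  qed
  then have qD: "q \<xi> \<longlonglongrightarrow> D \<xi>" for \<xi>
    unfolding D_def by (simp add: Cauchy_convergent_iff convergent_LIMSEQ_iff)
  have add: "D (\<xi> + \<zeta>) = D \<xi> + D \<zeta>" for \<xi> \<zeta>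
  proof -
    have "(\<lambda>n. j (\<xi> + \<zeta>) n + j \<xi> n + j \<zeta> n) \<longlonglongrightarrow> 0 + 0 + 0" by (intro tendsto_intros j)
    then have lim0: "(\<lambda>n. j (\<xi> + \<zeta>) n + j \<xi> n + j \<zeta> n) \<longlonglongrightarrow> 0" by simp
    have "(\<lambda>n. q (\<xi> + \<zeta>) n - q \<xi> n - q \<zeta> n) \<longlonglongrightarrow> 0"
    proof (rule Lim_null_comparison[OF _ lim0], rule always_eventually, rule allI)
      fix n
      show "norm (q (\<xi> + \<zeta>) n - q \<xi> n - q \<zeta> n) \<le> j (\<xi> + \<zeta>) n + j \<xi> n + j \<zeta> n"
        using comb'[of "real (Suc n)" "?s n (\<xi> + \<zeta>)" "- real (Suc n)" "?s n \<xi>" "- real (Suc n)" "?s n \<zeta>"]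
        by (simp add: q_def j_def del: of_nat_Suc)
    qed
    moreover have "(\<lambda>n. q (\<xi> + \<zeta>) n - q \<xi> n - q \<zeta> n) \<longlonglongrightarrow> D (\<xi> + \<zeta>) - D \<xi> - D \<zeta>"
      by (intro tendsto_intros qD)
    ultimately have "D (\<xi> + \<zeta>) - D \<xi> - D \<zeta> = 0" using LIMSEQ_unique by blast
    then show ?thesis by (simp add: algebra_simps)
  qed
  have scale: "D (r *\<^sub>R \<xi>) = r *\<^sub>R D \<xi>" for r \<xi>
  proof -
    have "(\<lambda>n. j (r *\<^sub>R \<xi>) n + \<bar>r\<bar> * j \<xi> n) \<longlonglongrightarrow> 0 + \<bar>r\<bar> * 0" by (intro tendsto_intros j)
    then have lim0: "(\<lambda>n. j (r *\<^sub>R \<xi>) n + \<bar>r\<bar> * j \<xi> n) \<longlonglongrightarrow> 0" by simp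
    have "(\<lambda>n. q (r *\<^sub>R \<xi>) n - r *\<^sub>R q \<xi> n) \<longlonglongrightarrow> 0"
    proof (rule Lim_null_comparison[OF _ lim0], rule always_eventually, rule allI)
      fix n
      show "norm (q (r *\<^sub>R \<xi>) n - r *\<^sub>R q \<xi> n) \<le> j (r *\<^sub>R \<xi>) n + \<bar>r\<bar> * j \<xi> n"
        using comb'[of "real (Suc n)" "?s n (r *\<^sub>R \<xi>)" "- r * real (Suc n)" "?s n \<xi>" 0 0]
        by (simp add: q_def j_def abs_mult mult.assoc del: of_nat_Suc)
    qed
    moreover have "(\<lambda>n. q (r *\<^sub>R \<xi>) n - r *\<^sub>R q \<xi> n) \<longlonglongrightarrow> D (r *\<^sub>R \<xi>) - r *\<^sub>R D \<xi>"
      by (intro tendsto_intros qD)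
    ultimately have "D (r *\<^sub>R \<xi>) - r *\<^sub>R D \<xi> = 0" using LIMSEQ_unique by blast
    then show ?thesis by simp
  qed
  have bound: "norm (D \<xi>) \<le> norm \<xi> * C" for \<xi>
  proof (rule LIMSEQ_le_const2[OF tendsto_norm[OF qD]], intro exI allI impI)
    fix n
    have "norm (q \<xi> n) \<le> real (Suc n) * (C * norm (?s n \<xi>))"
      using mult_left_mono[OF lip[of "?s n \<xi>"], of "real (Suc n)"]
      by (simp add: q_def G_def del: of_nat_Suc)
    also have "\<dots> = norm \<xi> * C" by simp
    finally show "norm (q \<xi> n) \<le> norm \<xi> * C" .
  qed
  have blD: "bounded_linear D"
    using add scale bound by (intro bounded_linear_intro)
  have close: "norm (G h - D h) \<le> J h" for h
  proof -
    \<comment> \<open>The full step \<open>h\<close> is compared with the step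
      \<open>h / (n + 1)\<close>; for large \<open>n\<close> only the cost \<open>J h\<close> of the
      full step remains.\<close>
    have "norm (G h - q h n) \<le> J h + j h n" for n
      using comb'[of 1 h "- real (Suc n)" "?s n h" 0 0] by (simp add: q_def j_def del: of_nat_Suc)
    moreover have "(\<lambda>n. norm (G h - q h n)) \<longlonglongrightarrow> norm (G h - D h)" by (intro tendsto_intros qD)
    moreover have "(\<lambda>n. J h + j h n) \<longlonglongrightarrow> J h + 0" by (intro tendsto_intros j)
    ultimately show ?thesis using LIMSEQ_le[of "\<lambda>n. norm (G h - q h n)" _ "\<lambda>n. J h + j h n"] by auto
  qed
  have "(F has_derivative D) (at x)"
    unfolding has_derivative_at
  proof
    show "((\<lambda>h. norm (F (x + h) - F x - D h) / norm h) \<longlongrightarrow> 0) (at 0)"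
      by (rule Lim_null_comparison[OF _ J], rule always_eventually)
        (use close in \<open>auto simp: G_def intro: divide_right_mono\<close>)
  qed (rule blD)
  then show thesis by (rule that)
qed

subsection \<open>Exponential splittings\<close>

locale exponential_split =
  fixes L :: "real \<Rightarrow> real \<Rightarrow> 'a::banach \<Rightarrow>\<^sub>L 'a"
    and Q :: "real \<Rightarrow> 'a \<Rightarrow>\<^sub>L 'a"
    and M \<gamma> \<rho> :: real
  assumes process: "linear_evolution_process L"
    and splitting: "exponential_splitting L Q M \<gamma> \<rho>"
begin

section \<open>Algebra and bounds of the two parts of the evolution\<close>

lemma L_comp: "s \<le> r \<Longrightarrow> r \<le> t \<Longrightarrow> L t r (L r s x) = L t s x"
  using process unfolding linear_evolution_process_def by (metis blinfun_apply_blinfun_compose)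

lemma L_refl [simp]: "L t t x = x"
  using process unfolding linear_evolution_process_def by (metis blinfun_apply_id_blinfun id_apply)

lemma L_cont: "continuous_on {(t, \<tau>). \<tau> \<le> t} (\<lambda>(t, \<tau>). L t \<tau> x)"
  using process unfolding linear_evolution_process_def by blast

lemma M_ge_1: "1 \<le> M"
  using splitting unfolding exponential_splitting_def by auto

lemma Q_Q [simp]: "Q t (Q t x) = Q t x"
  using splitting unfolding exponential_splitting_def by (metis blinfun_apply_blinfun_compose)

lemma Q_L: "s \<le> t \<Longrightarrow> Q t (L t s x) = L t s (Q s x)"
  using splitting unfolding exponential_splitting_def by (metis blinfun_apply_blinfun_compose)

text \<open>\<open>U t s\<close> and \<open>V t s\<close> are the two parts of the dichotomy: the backward evolution on the
  ranges of the projections (used for \<open>t \<le> s\<close>) and the forward evolution on their kernels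
  (used for \<open>s \<le> t\<close>).\<close>

definition U :: "real \<Rightarrow> real \<Rightarrow> 'a \<Rightarrow> 'a" where
  "U t s x = ext_process L Q t s (Q s x)"

definition V :: "real \<Rightarrow> real \<Rightarrow> 'a \<Rightarrow> 'a" where
  "V t s x = L t s ((id_blinfun - Q s) x)"

lemma U_refl [simp]: "U t t x = Q t x"
  by (simp add: U_def ext_process_def)

lemma V_alt: "V t s x = L t s (x - Q s x)"
  by (simp add: V_def blinfun.diff_left)

lemma L_homeomorphism:
  assumes "s \<le> t"
  obtains g where "homeomorphism (range (Q s)) (range (Q t)) (L t s) g"
proof -
  have "\<forall>t s. s \<le> t \<longrightarrow> (\<exists>g. homeomorphism (range (Q s)) (range (Q t)) (L t s) g)"
    using splitting unfolding exponential_splitting_def by (elim conjE) assumption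
  with assms that show thesis by metis
qed

lemma L_inj:
  assumes "s \<le> t" shows "inj_on (L t s) (range (Q s))"
proof -
  obtain g where "homeomorphism (range (Q s)) (range (Q t)) (L t s) g"
    using L_homeomorphism[OF assms] .
  then show ?thesis by (auto simp: homeomorphism_def intro: inj_on_inverseI)
qed

lemma
  assumes "t \<le> s"
  shows U_in_range: "U t s x \<in> range (Q t)" and L_U_inverse: "L s t (U t s x) = Q s x"
proof -
  have "U t s x \<in> range (Q t) \<and> L s t (U t s x) = Q s x"
  proof (cases "t = s")
    case False
    obtain g where "homeomorphism (range (Q t)) (range (Q s)) (L s t) g"
      using L_homeomorphism[OF \<open>t \<le> s\<close>] .
    then have "Q s x \<in> L s t ` range (Q t)"
      by (auto simp: homeomorphism_def)
    with False \<open>t \<le> s\<close> show ?thesis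
      by (simp add: U_def ext_process_def inv_into_into f_inv_into_f)
  qed simp
  then show "U t s x \<in> range (Q t)" "L s t (U t s x) = Q s x" by auto
qed

lemma Q_U [simp]: "t \<le> s \<Longrightarrow> Q t (U t s x) = U t s x"
  using U_in_range[of t s x] by auto

text \<open>Injectivity of \<open>L s t\<close> on the range of \<open>Q t\<close> turns these
  equations into a characterisation of \<open>U t s x\<close>. The identities below are verified
  through it instead of by manipulating the inverse.\<close>

lemma U_eqI:
  assumes "t \<le> s" "Q t y = y" "L s t y = Q s x"
  shows "U t s x = y"
proof -
  have "y \<in> range (Q t)" using assms(2) by (metis rangeI)
  then show ?thesis
    using inj_onD[OF L_inj[OF assms(1)], of "U t s x" y] U_in_range[OF assms(1), of x]
      L_U_inverse[OF assms(1), of x] assms(3) by simp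
qed

lemma U_comp: "r \<le> t \<Longrightarrow> t \<le> s \<Longrightarrow> U r t (U t s x) = U r s x"
proof (rule U_eqI[symmetric])
  assume "r \<le> t" "t \<le> s"
  then show "L s r (U r t (U t s x)) = Q s x"
    by (simp add: L_U_inverse flip: L_comp[of r t s])
qed auto

lemma U_L: "t \<le> r \<Longrightarrow> r \<le> s \<Longrightarrow> U t s (L s r x) = U t r x"
  by (rule U_eqI) (simp_all add: L_U_inverse Q_L flip: L_comp[of t r s])

lemma L_U: "a \<le> t \<Longrightarrow> t \<le> s \<Longrightarrow> L t a (U a s x) = U t s x"
  by (rule U_eqI[symmetric]) (simp_all add: L_U_inverse Q_L L_comp)

lemma V_Q: "s \<le> t \<Longrightarrow> Q t (V t s x) = 0"
  by (simp add: V_alt Q_L blinfun.diff_right)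

lemma V_comp: "s \<le> r \<Longrightarrow> r \<le> t \<Longrightarrow> V t r (V r s x) = V t s x"
  by (simp add: V_alt[of t r] V_Q) (simp add: V_def L_comp)

lemma V_L: "s \<le> r \<Longrightarrow> r \<le> t \<Longrightarrow> V t r (L r s x) = V t s x"
  by (simp add: V_alt Q_L blinfun.diff_right L_comp)

lemma V_U: "r \<le> s \<Longrightarrow> r \<le> t \<Longrightarrow> V t r (U r s x) = 0"
  by (simp add: V_alt)

lemma U_zero_right [simp]: "t \<le> s \<Longrightarrow> U t s 0 = 0"
  by (rule U_eqI) auto

lemma U_V: "t \<le> r \<Longrightarrow> s \<le> r \<Longrightarrow> U t r (V r s x) = 0"
  by (rule U_eqI) (auto simp: V_Q)

lemma linear_U: assumes "t \<le> s" shows "linear (U t s)"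
  by (rule linearI; rule U_eqI)
    (use assms in \<open>simp_all add: L_U_inverse blinfun.add_right blinfun.scaleR_right\<close>)

text \<open>The \<open>onorm\<close> estimate of the splitting says something about individual
  vectors only for an operator already known to be bounded. Boundedness comes from the continuous
  inverse \<open>g\<close>: a radius \<open>d\<close> at the origin on which values stay below 1
  gives the constant \<open>2 / d\<close> by scaling.\<close>

lemma bounded_linear_U: assumes "t \<le> s" shows "bounded_linear (U t s)"
proof -
  obtain g where g: "homeomorphism (range (Q t)) (range (Q s)) (L s t) g"
    using L_homeomorphism[OF \<open>t \<le> s\<close>] .
  have "U t s x = g (Q s x)" for x
  proof (rule U_eqI[OF assms])
    have "g (Q s x) \<in> range (Q t)" using g by (auto simp: homeomorphism_def)
    then show "Q t (g (Q s x)) = g (Q s x)" by auto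
  qed (use g in \<open>auto simp: homeomorphism_def\<close>)
  moreover have "continuous_on UNIV (\<lambda>x. g (Q s x))"
    by (rule continuous_on_compose2[of "range (Q s)" g])
      (use g in \<open>auto simp: homeomorphism_def intro!: linear_continuous_on blinfun.bounded_linear_right\<close>)
  ultimately have "continuous_on UNIV (U t s)"
    by (simp cong: continuous_on_cong)
  then have "isCont (U t s) 0"
    by (simp add: continuous_on_eq_continuous_at)
  then have "\<exists>d>0. \<forall>x. dist x 0 < d \<longrightarrow> dist (U t s x) (U t s 0) < 1"
    unfolding continuous_at_eps_delta by (elim allE[of _ 1]) simp
  then obtain d where d: "d > 0" "\<And>x. norm x < d \<Longrightarrow> norm (U t s x) < 1"
    using assms by auto
  have "norm (U t s x) \<le> norm x * (2 / d)" for x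
  proof (cases "x = 0")
    case False
    have "norm (U t s ((d / (2 * norm x)) *\<^sub>R x)) < 1"
      using False d(1) by (intro d(2)) simp
    then show ?thesis
      using False d(1) by (simp add: linear_scale[OF linear_U[OF assms]] field_simps)
  qed (simp add: assms)
  then show ?thesis
    using linear_U[OF assms] unfolding bounded_linear_def bounded_linear_axioms_def by blast
qed

lemma bounded_linear_V: "bounded_linear (V t s)"
  unfolding V_def by (intro bounded_linear_compose[OF blinfun.bounded_linear_right] blinfun.bounded_linear_right)

lemma U_bound: assumes "t \<le> s" shows "norm (U t s x) \<le> M * exp (\<rho> * (s - t)) * norm x"
proof -
  have "\<forall>t s. t \<le> s \<longrightarrow> exp (\<rho> * (t - s)) * onorm (U t s) \<le> M"
    using splitting unfolding exponential_splitting_def U_def[abs_def] by (elim conjE) assumption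
  with assms have "exp (\<rho> * (t - s)) * onorm (U t s) \<le> M" by simp
  then have "onorm (U t s) \<le> M * exp (\<rho> * (s - t))"
    by (simp only: exp_shift_le_iff(1))
  then show ?thesis
    using onorm[OF bounded_linear_U[OF assms], of x] by (meson mult_right_mono norm_ge_zero order_trans)
qed

lemma V_bound: assumes "s \<le> t" shows "norm (V t s x) \<le> M * exp (- \<gamma> * (t - s)) * norm x"
proof -
  have "\<forall>t s. s \<le> t \<longrightarrow> exp (\<gamma> * (t - s)) * norm (L t s o\<^sub>L (id_blinfun - Q s)) \<le> M"
    using splitting unfolding exponential_splitting_def by (elim conjE) assumption
  with assms have "exp (\<gamma> * (t - s)) * norm (L t s o\<^sub>L (id_blinfun - Q s)) \<le> M" by simp
  then have "norm (L t s o\<^sub>L (id_blinfun - Q s)) \<le> M * exp (- \<gamma> * (t - s))"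
    by (simp only: exp_shift_le_iff(2))
  then show ?thesis
    using norm_blinfun[of "L t s o\<^sub>L (id_blinfun - Q s)" x]
    by (simp add: V_def) (meson mult_right_mono norm_ge_zero order_trans)
qed

text \<open>\<open>max\<close> and \<open>min\<close> order the two times, so that the pair stays in
  the region where \<open>L\<close> is continuous whichever side \<open>s0\<close> is approached
  from.\<close>

lemma L_tendsto_at_diagonal:
  "((\<lambda>s. L (max s s0) (min s s0) x) \<longlongrightarrow> x) (at s0 within I)"
proof -
  have "continuous_on UNIV (\<lambda>s. L (max s s0) (min s s0) x)"
    by (rule continuous_on_compose2[OF L_cont, of UNIV "\<lambda>s. (max s s0, min s s0)", unfolded case_prod_conv])
      (auto intro!: continuous_intros)
  then have "((\<lambda>s. L (max s s0) (min s s0) x) \<longlongrightarrow> L (max s0 s0) (min s0 s0) x) (at s0)"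
    unfolding continuous_on_def by blast
  then show ?thesis by (auto intro: tendsto_within_subset)
qed

text \<open>The semigroup relation transports the strong continuity of \<open>L\<close> to \<open>W\<close>; in particular
  the projections need not be known to depend continuously on time.\<close>

lemma transported_family_continuous:
  fixes W :: "real \<Rightarrow> 'a \<Rightarrow> 'a" and B :: "real \<Rightarrow> real"
  assumes lin: "\<And>s. s \<in> I \<Longrightarrow> linear (W s)"
    and bound: "\<And>s x. s \<in> I \<Longrightarrow> norm (W s x) \<le> B s * norm x"
    and B: "continuous_on I B"
    and W_L: "\<And>r s x. r \<in> I \<Longrightarrow> s \<in> I \<Longrightarrow> r \<le> s \<Longrightarrow> W s (L s r x) = W r x"
    and g: "continuous_on I g"
  shows "continuous_on I (\<lambda>s. W s (g s))"
  unfolding continuous_on_def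
proof
  fix s0 assume s0: "s0 \<in> I"
  let ?x = "g s0"
  let ?d = "\<lambda>s. norm (L (max s s0) (min s s0) ?x - ?x)"
  have B0: "0 \<le> B s * norm x" if "s \<in> I" for s and x :: 'a
    using bound[OF that, of x] norm_ge_zero order_trans by blast
  have est: "norm (W s (g s) - W s0 ?x) \<le> B s * norm (g s - ?x) + (B s * ?d s + B s0 * ?d s)"
    if s: "s \<in> I" for s
  proof -
    \<comment> \<open>Of the two times, the operator at the earlier one is rewritten as the operator
      at the later one after \<open>L\<close>. The difference then falls on
      \<open>L ?x - ?x\<close>, which is small. The bound adds the outcomes of both cases so that it
      holds on either side of \<open>s0\<close>.\<close>
    have "norm (W s ?x - W s0 ?x) \<le> B s * ?d s + B s0 * ?d s"
    proof (cases "s \<le> s0")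
      case True
      then have "W s ?x - W s0 ?x = W s0 (L s0 s ?x - ?x)"
        using W_L[OF s s0 True] by (simp add: linear_diff[OF lin[OF s0]])
      then show ?thesis
        using bound[OF s0, of "L s0 s ?x - ?x"] B0[OF s, of "L s0 s ?x - ?x"] True by simp
    next
      case False
      then have "W s ?x - W s0 ?x = - W s (L s s0 ?x - ?x)"
        using W_L[OF s0 s] by (simp add: linear_diff[OF lin[OF s]])
      then show ?thesis
        using bound[OF s, of "L s s0 ?x - ?x"] B0[OF s0, of "L s s0 ?x - ?x"] False
        by (simp add: max_def min_def)
    qed
    moreover have "norm (W s (g s) - W s ?x) \<le> B s * norm (g s - ?x)"
      using bound[OF s, of "g s - ?x"] by (simp add: linear_diff[OF lin[OF s]])
    ultimately show ?thesis
      using norm_triangle_ineq[of "W s (g s) - W s ?x" "W s ?x - W s0 ?x"] by simp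
  qed
  have tB: "(B \<longlongrightarrow> B s0) (at s0 within I)" and tg: "(g \<longlongrightarrow> ?x) (at s0 within I)"
    using B g s0 by (auto simp: continuous_on_def)
  have td: "(?d \<longlongrightarrow> 0) (at s0 within I)"
    by (intro tendsto_norm_zero LIM_zero L_tendsto_at_diagonal)
  have "((\<lambda>s. B s * norm (g s - ?x) + (B s * ?d s + B s0 * ?d s)) \<longlongrightarrow> B s0 * 0 + (B s0 * 0 + B s0 * 0))
      (at s0 within I)"
    by (intro tendsto_intros tB td tendsto_norm_zero LIM_zero tg)
  then have lim0: "((\<lambda>s. B s * norm (g s - ?x) + (B s * ?d s + B s0 * ?d s)) \<longlongrightarrow> 0) (at s0 within I)"
    by simp
  have "eventually (\<lambda>s. norm (W s (g s) - W s0 ?x) \<le> B s * norm (g s - ?x) + (B s * ?d s + B s0 * ?d s))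
      (at s0 within I)"
    unfolding eventually_at_filter by (rule always_eventually) (blast intro: est)
  from Lim_null_comparison[OF this lim0]
  have "((\<lambda>s. W s (g s) - W s0 ?x) \<longlongrightarrow> 0) (at s0 within I)" .
  then show "((\<lambda>s. W s (g s)) \<longlongrightarrow> W s0 (g s0)) (at s0 within I)"
    by (rule LIM_zero_cancel)
qed

lemma U_continuous:
  assumes "continuous_on {t..b} g"
  shows "continuous_on {t..b} (\<lambda>s. U t s (g s))"
  by (rule transported_family_continuous[where W = "U t" and B = "\<lambda>s. M * exp (\<rho> * (s - t))"])
    (auto intro!: continuous_intros U_bound linear_U U_L assms)

lemma V_continuous:
  assumes "continuous_on {..t} g"
  shows "continuous_on {..t} (\<lambda>s. V t s (g s))"
  by (rule transported_family_continuous[where W = "V t" and B = "\<lambda>s. M * exp (- \<gamma> * (t - s))"])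
    (use V_bound in \<open>auto intro!: continuous_intros V_L assms bounded_linear.linear[OF bounded_linear_V]\<close>)

section \<open>Seminorms adapted to the two parts\<close>

definition nN :: "real \<Rightarrow> 'a \<Rightarrow> real" where
  "nN t x = norm_N L Q \<rho> t (Q t x)"

definition nS :: "real \<Rightarrow> 'a \<Rightarrow> real" where
  "nS t x = norm_S L \<gamma> t ((id_blinfun - Q t) x)"

lemma nN_eq: "nN t x = (SUP r\<in>{..t}. exp (\<rho> * (r - t)) * norm (U r t x))"
  by (simp add: nN_def norm_N_def U_def)

lemma nS_eq: "nS t x = (SUP r\<in>{t..}. exp (\<gamma> * (r - t)) * norm (V r t x))"
  by (simp add: nS_def norm_S_def V_def)

lemma nN_leI: "(\<And>r. r \<le> t \<Longrightarrow> norm (U r t x) \<le> B * exp (\<rho> * (t - r))) \<Longrightarrow> nN t x \<le> B"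
  unfolding nN_eq by (rule cSUP_least) (simp_all only: exp_shift_le_iff(1) atMost_iff, simp)

lemma nS_leI: "(\<And>r. t \<le> r \<Longrightarrow> norm (V r t x) \<le> B * exp (- \<gamma> * (r - t))) \<Longrightarrow> nS t x \<le> B"
  unfolding nS_eq by (rule cSUP_least) (simp_all only: exp_shift_le_iff(2) atLeast_iff, simp)

lemma U_le_nN: assumes "r \<le> t" shows "norm (U r t x) \<le> nN t x * exp (\<rho> * (t - r))"
proof -
  have "exp (\<rho> * (r - t)) * norm (U r t x) \<le> nN t x"
    unfolding nN_eq
  proof (rule cSUP_upper)
    show "bdd_above ((\<lambda>r. exp (\<rho> * (r - t)) * norm (U r t x)) ` {..t})"
      by (rule bdd_aboveI2[of _ _ "M * norm x"])
        (use U_bound[of _ t x] in \<open>simp only: exp_shift_le_iff(1) atMost_iff mult_ac\<close>)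
  qed (use assms in simp)
  then show ?thesis by (simp only: exp_shift_le_iff(1))
qed

lemma V_le_nS: assumes "t \<le> r" shows "norm (V r t x) \<le> nS t x * exp (- \<gamma> * (r - t))"
proof -
  have "exp (\<gamma> * (r - t)) * norm (V r t x) \<le> nS t x"
    unfolding nS_eq
  proof (rule cSUP_upper)
    show "bdd_above ((\<lambda>r. exp (\<gamma> * (r - t)) * norm (V r t x)) ` {t..})"
      by (rule bdd_aboveI2[of _ _ "M * norm x"])
        (use V_bound[of t _ x] in \<open>simp only: exp_shift_le_iff(2) atLeast_iff mult_ac\<close>)
  qed (use assms in simp)
  then show ?thesis by (simp only: exp_shift_le_iff(2))
qed

lemma nN_le_norm: "nN t x \<le> M * norm x"
  by (rule nN_leI) (use U_bound in \<open>simp only: mult_ac\<close>)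

lemma nS_le_norm: "nS t x \<le> M * norm x"
  by (rule nS_leI) (use V_bound in \<open>simp only: mult_ac\<close>)

lemma norm_Q_le_nN: "norm (Q t x) \<le> nN t x"
  using U_le_nN[of t t x] by simp

lemma norm_complement_le_nS: "norm (x - Q t x) \<le> nS t x"
  using V_le_nS[of t t x] by (simp add: V_alt)

lemma nN_nonneg [simp]: "0 \<le> nN t x" and nS_nonneg [simp]: "0 \<le> nS t x"
  using norm_Q_le_nN norm_complement_le_nS norm_ge_zero order_trans by blast+

lemma nN_add: "nN t (x + y) \<le> nN t x + nN t y"
proof (rule nN_leI)
  fix r assume r: "r \<le> t"
  show "norm (U r t (x + y)) \<le> (nN t x + nN t y) * exp (\<rho> * (t - r))"
    using U_le_nN[OF r, of x] U_le_nN[OF r, of y] norm_triangle_ineq[of "U r t x" "U r t y"]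
    by (simp add: linear_add[OF linear_U[OF r]] algebra_simps)
qed

lemma nS_add: "nS t (x + y) \<le> nS t x + nS t y"
proof (rule nS_leI)
  fix r assume r: "t \<le> r"
  show "norm (V r t (x + y)) \<le> (nS t x + nS t y) * exp (- \<gamma> * (r - t))"
    using V_le_nS[OF r, of x] V_le_nS[OF r, of y] norm_triangle_ineq[of "V r t x" "V r t y"]
    by (simp add: linear_add[OF bounded_linear.linear[OF bounded_linear_V]] algebra_simps)
qed

lemma nN_scale: "nN t (c *\<^sub>R x) \<le> \<bar>c\<bar> * nN t x"
proof (rule nN_leI)
  fix r assume r: "r \<le> t"
  show "norm (U r t (c *\<^sub>R x)) \<le> (\<bar>c\<bar> * nN t x) * exp (\<rho> * (t - r))"
    using mult_left_mono[OF U_le_nN[OF r, of x], of "\<bar>c\<bar>"]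
    by (simp add: linear_scale[OF linear_U[OF r]] algebra_simps)
qed

lemma nS_scale: "nS t (c *\<^sub>R x) \<le> \<bar>c\<bar> * nS t x"
proof (rule nS_leI)
  fix r assume r: "t \<le> r"
  show "norm (V r t (c *\<^sub>R x)) \<le> (\<bar>c\<bar> * nS t x) * exp (- \<gamma> * (r - t))"
    using mult_left_mono[OF V_le_nS[OF r, of x], of "\<bar>c\<bar>"]
    by (simp add: linear_scale[OF bounded_linear.linear[OF bounded_linear_V]] algebra_simps)
qed

subsection \<open>The Green operator of the splitting\<close>

text \<open>Membership in the weighted space of exponent \<open>\<mu>\<close>, expressed with the
  norm of \<open>X\<close> instead of the time-dependent norms. Both descriptions agree because the
  norms are equivalent uniformly in time.\<close>

definition tempered :: "real \<Rightarrow> real \<Rightarrow> (real \<Rightarrow> 'a) \<Rightarrow> bool" where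
  "tempered \<mu> \<tau> g \<longleftrightarrow> continuous_on {..\<tau>} g \<and> (\<exists>K. \<forall>s\<le>\<tau>. norm (g s) \<le> K * exp (\<mu> * (\<tau> - s)))"

text \<open>The Lyapunov-Perron operator without its homogeneous term: the unstable part is
  integrated back from the value zero at \<open>\<tau>\<close>, the stable part is accumulated from
  the infinite past.\<close>

definition green :: "real \<Rightarrow> (real \<Rightarrow> 'a) \<Rightarrow> real \<Rightarrow> 'a" where
  "green \<tau> g t = - integral {t..\<tau>} (\<lambda>s. U t s (g s)) + integral {..t} (\<lambda>s. V t s (g s))"

lemma temperedE:
  assumes "tempered \<mu> \<tau> g"
  obtains K where "K \<ge> 0" "continuous_on {..\<tau>} g" "\<And>s. s \<le> \<tau> \<Longrightarrow> norm (g s) \<le> K * exp (\<mu> * (\<tau> - s))"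
proof -
  obtain K where K: "continuous_on {..\<tau>} g" "\<And>s. s \<le> \<tau> \<Longrightarrow> norm (g s) \<le> K * exp (\<mu> * (\<tau> - s))"
    using assms unfolding tempered_def by blast
  have "0 \<le> K" using order_trans[OF norm_ge_zero K(2)[of \<tau>]] by simp
  with K that show thesis by blast
qed

lemma tempered_add: "tempered \<mu> \<tau> g \<Longrightarrow> tempered \<mu> \<tau> h \<Longrightarrow> tempered \<mu> \<tau> (\<lambda>s. g s + h s)"
proof (elim temperedE)
  fix K K' assume *: "continuous_on {..\<tau>} g" "\<And>s. s \<le> \<tau> \<Longrightarrow> norm (g s) \<le> K * exp (\<mu> * (\<tau> - s))"
    "continuous_on {..\<tau>} h" "\<And>s. s \<le> \<tau> \<Longrightarrow> norm (h s) \<le> K' * exp (\<mu> * (\<tau> - s))"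
  have "norm (g s + h s) \<le> (K + K') * exp (\<mu> * (\<tau> - s))" if "s \<le> \<tau>" for s
    using *(2)[OF that] *(4)[OF that] norm_triangle_ineq[of "g s" "h s"] by (simp add: algebra_simps)
  then show ?thesis
    unfolding tempered_def using * by (auto intro!: continuous_intros)
qed

lemma tempered_scale: "tempered \<mu> \<tau> g \<Longrightarrow> tempered \<mu> \<tau> (\<lambda>s. c *\<^sub>R g s)"
proof (elim temperedE)
  fix K assume *: "continuous_on {..\<tau>} g" "\<And>s. s \<le> \<tau> \<Longrightarrow> norm (g s) \<le> K * exp (\<mu> * (\<tau> - s))"
  have "norm (c *\<^sub>R g s) \<le> (\<bar>c\<bar> * K) * exp (\<mu> * (\<tau> - s))" if "s \<le> \<tau>" for s
    using mult_left_mono[OF *(2)[OF that], of "\<bar>c\<bar>"] by (simp add: mult.assoc)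
  then show ?thesis
    unfolding tempered_def using * by (auto intro!: continuous_intros)
qed

lemma tempered_diff: "tempered \<mu> \<tau> g \<Longrightarrow> tempered \<mu> \<tau> h \<Longrightarrow> tempered \<mu> \<tau> (\<lambda>s. g s - h s)"
  using tempered_add[of \<mu> \<tau> g "\<lambda>s. (-1) *\<^sub>R h s"] tempered_scale[of \<mu> \<tau> h "-1"] by simp

lemma tempered_mono: "tempered \<mu> \<tau> g \<Longrightarrow> \<mu> \<le> \<nu> \<Longrightarrow> tempered \<nu> \<tau> g"
proof (elim temperedE)
  fix K assume *: "0 \<le> K" "continuous_on {..\<tau>} g" "\<And>s. s \<le> \<tau> \<Longrightarrow> norm (g s) \<le> K * exp (\<mu> * (\<tau> - s))"
    and "\<mu> \<le> \<nu>"
  have "norm (g s) \<le> K * exp (\<nu> * (\<tau> - s))" if "s \<le> \<tau>" for s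
  proof -
    have "K * exp (\<mu> * (\<tau> - s)) \<le> K * exp (\<nu> * (\<tau> - s))"
      using \<open>\<mu> \<le> \<nu>\<close> that *(1) by (intro mult_left_mono) (auto intro: mult_right_mono)
    then show ?thesis using *(3)[OF that] by linarith
  qed
  then show ?thesis unfolding tempered_def using * by auto
qed

lemma U_integrable:
  assumes "continuous_on {..\<tau>} g"
  shows "(\<lambda>s. U t s (g s)) integrable_on {t..\<tau>}"
  by (intro integrable_continuous_interval U_continuous continuous_on_subset[OF assms]) auto

lemma V_tempered_bound:
  assumes "\<And>s. s \<le> \<tau> \<Longrightarrow> norm (g s) \<le> K * exp (\<mu> * (\<tau> - s))" "s \<le> t" "t \<le> \<tau>"
  shows "norm (V t s (g s)) \<le> M * K * exp (\<mu> * (\<tau> - t)) * exp ((\<gamma> - \<mu>) * (s - t))"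
proof -
  have "norm (V t s (g s)) \<le> M * exp (- \<gamma> * (t - s)) * (K * exp (\<mu> * (\<tau> - s)))"
    by (rule order_trans[OF V_bound[OF assms(2)]])
      (use assms M_ge_1 in \<open>intro mult_left_mono, auto\<close>)
  also have "\<dots> = M * K * (exp (- \<gamma> * (t - s)) * exp (\<mu> * (\<tau> - s)))" by simp
  also have "exp (- \<gamma> * (t - s)) * exp (\<mu> * (\<tau> - s)) = exp (\<mu> * (\<tau> - t)) * exp ((\<gamma> - \<mu>) * (s - t))"
    by (simp add: algebra_simps flip: exp_add)
  finally show ?thesis by (simp add: mult.assoc)
qed

text \<open>The half-line integral converges because the growth rate \<open>\<mu>\<close> of
  \<open>g\<close> into the past stays below the decay rate \<open>\<gamma>\<close>. A later time
  \<open>r\<close> is reached by applying the bounded operator \<open>V r t\<close> to the case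
  \<open>r = t\<close>.\<close>

lemma V_integrable:
  assumes "tempered \<mu> \<tau> g" "\<mu> < \<gamma>" "t \<le> \<tau>" "t \<le> r"
  shows "(\<lambda>s. V r s (g s)) integrable_on {..t}"
proof -
  obtain K where "0 \<le> K" and K: "continuous_on {..\<tau>} g"
      "\<And>s. s \<le> \<tau> \<Longrightarrow> norm (g s) \<le> K * exp (\<mu> * (\<tau> - s))"
    using assms(1) by (rule temperedE) (rule that; blast)
  have "((\<lambda>s. exp ((\<gamma> - \<mu>) * (s - t))) has_integral 1 / (\<gamma> - \<mu>)) {..t}"
    using assms by (intro has_integral_exp_atMost) simp
  from has_integral_mult_right[OF this, of "M * K * exp (\<mu> * (\<tau> - t))"]
  have h: "(\<lambda>s. M * K * exp (\<mu> * (\<tau> - t)) * exp ((\<gamma> - \<mu>) * (s - t))) integrable_on {..t}"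
    by (rule has_integral_integrable)
  have c: "continuous_on {..t} (\<lambda>s. V t s (g s))"
    using K(1) assms(3) by (intro V_continuous) (auto elim: continuous_on_subset)
  have int: "(\<lambda>s. V t s (g s)) integrable_on {..t}"
    by (rule continuous_dominated_integrable[OF c h V_tempered_bound[OF K(2) _ assms(3)]])
  have "(V r t \<circ> (\<lambda>s. V t s (g s))) integrable_on {..t}"
    by (rule integrable_linear[OF int bounded_linear_V])
  then show ?thesis
    by (rule integrable_eq) (use assms in \<open>auto simp: V_comp\<close>)
qed

text \<open>\<open>nN\<close> is a supremum over the images under \<open>U r t\<close>, so these
  images are needed. The operator passes under the integrals, merges with \<open>U t s\<close> and
  annihilates the stable integrand.\<close>

lemma U_green:
  assumes "tempered \<mu> \<tau> g" "\<mu> < \<gamma>" "t \<le> \<tau>" "r \<le> t"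
  shows "U r t (green \<tau> g t) = - integral {t..\<tau>} (\<lambda>s. U r s (g s))"
proof -
  have cont: "continuous_on {..\<tau>} g" using assms(1) by (simp add: tempered_def)
  have bl: "bounded_linear (U r t)" using assms by (intro bounded_linear_U)
  have "integral {t..\<tau>} (U r t \<circ> (\<lambda>s. U t s (g s))) = U r t (integral {t..\<tau>} (\<lambda>s. U t s (g s)))"
    by (rule integral_linear[OF U_integrable[OF cont] bl])
  moreover have "integral {t..\<tau>} (U r t \<circ> (\<lambda>s. U t s (g s))) = integral {t..\<tau>} (\<lambda>s. U r s (g s))"
    by (rule integral_cong) (use assms in \<open>simp add: U_comp\<close>)
  moreover have "integral {..t} (U r t \<circ> (\<lambda>s. V t s (g s))) = U r t (integral {..t} (\<lambda>s. V t s (g s)))"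
    by (rule integral_linear[OF V_integrable[OF assms(1-3)] bl]) simp
  moreover have "integral {..t} (U r t \<circ> (\<lambda>s. V t s (g s))) = integral {..t} (\<lambda>s. 0)"
    by (rule integral_cong) (use assms in \<open>simp add: U_V\<close>)
  ultimately show ?thesis
    using assms unfolding green_def linear_add[OF linear_U[OF assms(4)]] linear_neg[OF linear_U[OF assms(4)]]
    by simp
qed

lemma V_green:
  assumes "tempered \<mu> \<tau> g" "\<mu> < \<gamma>" "t \<le> \<tau>" "t \<le> r"
  shows "V r t (green \<tau> g t) = integral {..t} (\<lambda>s. V r s (g s))"
proof -
  have cont: "continuous_on {..\<tau>} g" using assms(1) by (simp add: tempered_def)
  note lin = bounded_linear.linear[OF bounded_linear_V]
  have "integral {t..\<tau>} (V r t \<circ> (\<lambda>s. U t s (g s))) = V r t (integral {t..\<tau>} (\<lambda>s. U t s (g s)))"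
    by (rule integral_linear[OF U_integrable[OF cont] bounded_linear_V])
  moreover have "integral {t..\<tau>} (V r t \<circ> (\<lambda>s. U t s (g s))) = integral {t..\<tau>} (\<lambda>s. 0)"
    by (rule integral_cong) (use assms in \<open>simp add: V_U\<close>)
  moreover have "integral {..t} (V r t \<circ> (\<lambda>s. V t s (g s))) = V r t (integral {..t} (\<lambda>s. V t s (g s)))"
    by (rule integral_linear[OF V_integrable[OF assms(1-3)] bounded_linear_V]) simp
  moreover have "integral {..t} (V r t \<circ> (\<lambda>s. V t s (g s))) = integral {..t} (\<lambda>s. V r s (g s))"
    by (rule integral_cong) (use assms in \<open>simp add: V_comp\<close>)
  ultimately show ?thesis
    unfolding green_def linear_add[OF lin] linear_neg[OF lin] by simp
qed

text \<open>The part of the forcing bounded by \<open>A\<close> is integrated against the kernel,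
  which gives \<open>1 / (\<mu> - \<rho>)\<close>; the part \<open>m\<close> is only compared with
  the weight, which gives \<open>J\<close>. Since forcing and result are both measured by
  \<open>nN\<close>, no factor \<open>M\<close> appears.\<close>

lemma nN_green_le:
  assumes g: "tempered \<mu> \<tau> g" and \<mu>: "\<rho> < \<mu>" "\<mu> < \<gamma>" and t: "t \<le> \<tau>" and A: "0 \<le> A"
    and m: "\<And>s. s \<le> \<tau> \<Longrightarrow> 0 \<le> m s"
    and J: "((\<lambda>s. m s * exp (- \<mu> * (\<tau> - s))) has_integral J) {..\<tau>}"
    and le: "\<And>s. s \<le> \<tau> \<Longrightarrow> nN s (g s) \<le> A * exp (\<mu> * (\<tau> - s)) + m s"
  shows "nN t (green \<tau> g t) \<le> (A / (\<mu> - \<rho>) + J) * exp (\<mu> * (\<tau> - t))"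
proof (rule nN_leI)
  fix r assume r: "r \<le> t"
  have cont: "continuous_on {..\<tau>} g" using g by (simp add: tempered_def)
  define e where "e s = exp (- (\<mu> - \<rho>) * (s - t))" for s
  \<comment> \<open>The weight to be factored out: growth from \<open>t\<close> back to
    \<open>r\<close> times growth from \<open>\<tau>\<close> back to \<open>t\<close>.\<close>
  define c where "c = exp (\<rho> * (t - r)) * exp (\<mu> * (\<tau> - t))"
  let ?m = "\<lambda>s. m s * exp (- \<mu> * (\<tau> - s))"
  let ?H = "\<lambda>s. c * (A * e s + ?m s)"
  have "((\<lambda>s. exp (- (\<mu> - \<rho>) * s)) has_integral exp (- (\<mu> - \<rho>) * t) / (\<mu> - \<rho>)) {t..}"
    using \<mu> by (intro has_integral_exp_minus_to_infinity) simp
  from has_integral_mult_right[OF this, of "exp ((\<mu> - \<rho>) * t)"]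
  have e: "(e has_integral 1 / (\<mu> - \<rho>)) {t..}"
    by (simp add: e_def[abs_def] algebra_simps flip: exp_add)
  have e_int: "e integrable_on {t..\<tau>}"
    unfolding e_def by (intro integrable_continuous_interval continuous_intros)
  have e_le: "integral {t..\<tau>} e \<le> 1 / (\<mu> - \<rho>)"
    using integral_subset_le[of "{t..\<tau>}" "{t..}" e] e e_int
    by (auto simp: e_def has_integral_iff)
  have m_int: "?m integrable_on {t..\<tau>}"
    using integrable_on_subcbox[of ?m "{..\<tau>}" t \<tau>] J by auto
  have m_le: "integral {t..\<tau>} ?m \<le> J"
    using integral_subset_le[of "{t..\<tau>}" "{..\<tau>}" ?m] J m_int m by (auto simp: has_integral_iff)
  have H_int: "?H integrable_on {t..\<tau>}"
    using integrable_add[OF integrable_on_mult_right[OF e_int, of A] m_int]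
    by (rule integrable_on_mult_right)
  have "norm (U r t (green \<tau> g t)) \<le> integral {t..\<tau>} ?H"
    unfolding U_green[OF g \<mu>(2) t r] norm_minus_cancel
  proof (rule integral_norm_bound_integral[OF _ H_int])
    have "(\<lambda>s. U r s (g s)) integrable_on cbox t \<tau>"
      by (rule integrable_on_subcbox[OF U_integrable[OF cont, of r]]) (use r in auto)
    then show "(\<lambda>s. U r s (g s)) integrable_on {t..\<tau>}" by simp
    fix s assume s: "s \<in> {t..\<tau>}"
    have 1: "exp (\<mu> * (\<tau> - s)) * exp (\<rho> * (s - r)) = c * e s"
      by (simp add: c_def e_def algebra_simps flip: exp_add)
    \<comment> \<open>For \<open>m\<close> the decaying factor of the kernel is simply estimated by
      1.\<close>
    have "0 \<le> (\<mu> - \<rho>) * (s - t)" using \<mu> s by simp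
    then have 2: "exp (\<rho> * (s - r)) \<le> c * exp (- \<mu> * (\<tau> - s))"
      by (simp add: c_def algebra_simps flip: exp_add)
    have "norm (U r s (g s)) \<le> nN s (g s) * exp (\<rho> * (s - r))"
      using U_le_nN[of r s] r s by simp
    also have "\<dots> \<le> (A * exp (\<mu> * (\<tau> - s)) + m s) * exp (\<rho> * (s - r))"
      using le[of s] s by (intro mult_right_mono) auto
    also have "\<dots> = A * (c * e s) + m s * exp (\<rho> * (s - r))"
      by (simp add: distrib_right 1[symmetric])
    also have "\<dots> \<le> A * (c * e s) + m s * (c * exp (- \<mu> * (\<tau> - s)))"
      using 2 m[of s] s by (intro add_left_mono mult_left_mono) auto
    finally show "norm (U r s (g s)) \<le> ?H s" by (simp add: algebra_simps)
  qed
  also have "integral {t..\<tau>} ?H = c * (A * integral {t..\<tau>} e + integral {t..\<tau>} ?m)"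
    by (simp only: integral_mult_right integral_add[OF integrable_on_mult_right[OF e_int] m_int])
  also have "\<dots> \<le> c * (A * (1 / (\<mu> - \<rho>)) + J)"
    using e_le m_le A by (intro mult_left_mono add_mono) (auto simp: c_def)
  finally show "norm (U r t (green \<tau> g t)) \<le> (A / (\<mu> - \<rho>) + J) * exp (\<mu> * (\<tau> - t)) * exp (\<rho> * (t - r))"
    by (simp add: c_def mult_ac)
qed

text \<open>The counterpart of \<open>nN_green_le\<close> for the forward kernel, whose mass over
  the infinite past is \<open>1 / (\<gamma> - \<mu>)\<close>.\<close>

lemma nS_green_le:
  assumes g: "tempered \<mu> \<tau> g" and \<mu>: "\<mu> < \<gamma>" and t: "t \<le> \<tau>" and A: "0 \<le> A"
    and m: "\<And>s. s \<le> \<tau> \<Longrightarrow> 0 \<le> m s"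
    and J: "((\<lambda>s. m s * exp (- \<mu> * (\<tau> - s))) has_integral J) {..\<tau>}"
    and le: "\<And>s. s \<le> \<tau> \<Longrightarrow> nS s (g s) \<le> A * exp (\<mu> * (\<tau> - s)) + m s"
  shows "nS t (green \<tau> g t) \<le> (A / (\<gamma> - \<mu>) + J) * exp (\<mu> * (\<tau> - t))"
proof (rule nS_leI)
  fix r assume r: "t \<le> r"
  define e where "e s = exp ((\<gamma> - \<mu>) * (s - t))" for s
  define c where "c = exp (- \<gamma> * (r - t)) * exp (\<mu> * (\<tau> - t))"
  let ?m = "\<lambda>s. m s * exp (- \<mu> * (\<tau> - s))"
  let ?H = "\<lambda>s. c * (A * e s + ?m s)"
  have e: "(e has_integral 1 / (\<gamma> - \<mu>)) {..t}"
    unfolding e_def using \<mu> by (intro has_integral_exp_atMost) simp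
  have m_int: "?m integrable_on {..t}"
  proof -
    \<comment> \<open>Nonnegativity upgrades integrability to absolute integrability, which passes
      to the shorter half-line.\<close>
    have "?m absolutely_integrable_on {..\<tau>}"
      using J m by (intro nonnegative_absolutely_integrable_1) auto
    then have "?m absolutely_integrable_on {..t}"
      by (rule set_integrable_subset) (use t in auto)
    then show ?thesis by (rule set_lebesgue_integral_eq_integral(1))
  qed
  have m_le: "integral {..t} ?m \<le> J"
    using integral_subset_le[of "{..t}" "{..\<tau>}" ?m] J m_int m t by (auto simp: has_integral_iff)
  have e_int: "e integrable_on {..t}" and e_le: "integral {..t} e \<le> 1 / (\<gamma> - \<mu>)"
    using e by (auto simp: has_integral_iff)
  have H_int: "?H integrable_on {..t}"
    using integrable_add[OF integrable_on_mult_right[OF e_int, of A] m_int]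
    by (rule integrable_on_mult_right)
  have "norm (V r t (green \<tau> g t)) \<le> integral {..t} ?H"
    unfolding V_green[OF g \<mu> t r]
  proof (rule integral_norm_bound_integral[OF V_integrable[OF g \<mu> t r] H_int])
    fix s assume s: "s \<in> {..t}"
    have 1: "exp (\<mu> * (\<tau> - s)) * exp (- \<gamma> * (r - s)) = c * e s"
      by (simp add: c_def e_def algebra_simps flip: exp_add)
    have "0 \<le> (\<gamma> - \<mu>) * (t - s)" using \<mu> s by simp
    then have 2: "exp (- \<gamma> * (r - s)) \<le> c * exp (- \<mu> * (\<tau> - s))"
      by (simp add: c_def algebra_simps flip: exp_add)
    have "norm (V r s (g s)) \<le> nS s (g s) * exp (- \<gamma> * (r - s))"
      using V_le_nS[of s r] r s by simp
    also have "\<dots> \<le> (A * exp (\<mu> * (\<tau> - s)) + m s) * exp (- \<gamma> * (r - s))"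
      using le[of s] s t by (intro mult_right_mono) auto
    also have "\<dots> = A * (c * e s) + m s * exp (- \<gamma> * (r - s))"
      by (simp only: distrib_right 1[symmetric] mult.assoc)
    also have "\<dots> \<le> A * (c * e s) + m s * (c * exp (- \<mu> * (\<tau> - s)))"
      using 2 m[of s] s t by (intro add_left_mono mult_left_mono) auto
    finally show "norm (V r s (g s)) \<le> ?H s" by (simp add: algebra_simps)
  qed
  also have "integral {..t} ?H = c * (A * integral {..t} e + integral {..t} ?m)"
    by (simp only: integral_mult_right integral_add[OF integrable_on_mult_right[OF e_int] m_int])
  also have "\<dots> \<le> c * (A * (1 / (\<gamma> - \<mu>)) + J)"
    using e_le m_le A by (intro mult_left_mono add_mono) (auto simp: c_def)
  finally show "norm (V r t (green \<tau> g t)) \<le> (A / (\<gamma> - \<mu>) + J) * exp (\<mu> * (\<tau> - t)) * exp (- \<gamma> * (r - t))"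
    by (simp add: c_def mult_ac)
qed

lemma norm_le_nN_nS: "norm x \<le> nN t x + nS t x"
  using norm_Q_le_nN[of t x] norm_complement_le_nS[of x t] norm_triangle_ineq[of "Q t x" "x - Q t x"] by simp

section \<open>Continuity in time of the Green operator\<close>

lemma L_forward_continuous: "continuous (at t within I) (\<lambda>t. L (max t a) a x)"
proof -
  have "continuous_on UNIV (\<lambda>t. L (max t a) a x)"
    by (rule continuous_on_compose2[OF L_cont, of UNIV "\<lambda>t. (max t a, a)", unfolded case_prod_conv])
      (auto intro!: continuous_intros)
  then show ?thesis
    by (simp add: continuous_on_eq_continuous_at continuous_at_imp_continuous_at_within)
qed

text \<open>The time \<open>t\<close> occurs both in the operator and as an end of the interval. Cut
  the integral at a fixed \<open>b\<close> to the right of \<open>t0\<close>, or at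
  \<open>\<tau>\<close> if that comes first. The part beyond \<open>b\<close> is the backward image
  of a fixed vector, hence the forward orbit of its image at the earlier time \<open>a\<close>,
  which is continuous. The part before \<open>b\<close> is short.\<close>

lemma unstable_part_continuous:
  assumes "tempered \<mu> \<tau> g"
  shows "continuous_on {..\<tau>} (\<lambda>t. integral {t..\<tau>} (\<lambda>s. U t s (g s)))"
  unfolding continuous_on_eq_continuous_within
proof
  let ?u = "\<lambda>t. integral {t..\<tau>} (\<lambda>s. U t s (g s))"
  obtain K where K: "0 \<le> K" "continuous_on {..\<tau>} g" "\<And>s. s \<le> \<tau> \<Longrightarrow> norm (g s) \<le> K * exp (\<mu> * (\<tau> - s))"
    using assms by (rule temperedE) (rule that; blast)
  fix t0 assume "t0 \<in> {..\<tau>}"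
  then have t0: "t0 \<le> \<tau>" by simp
  show "continuous (at t0 within {..\<tau>}) ?u"
  proof (rule continuous_at_within_approximation)
    fix e :: real assume e: "0 < e"
    \<comment> \<open>Bounds the integrand on the short piece, where \<open>s - t\<close> is at most
      2 and \<open>\<tau> - s\<close> at most \<open>\<tau> - t0 + 1\<close>.\<close>
    define C where "C = M * exp (\<bar>\<rho>\<bar> * 2) * (K * exp (\<bar>\<mu>\<bar> * (\<tau> - t0 + 1)))"
    have C: "0 \<le> C" using K(1) M_ge_1 by (simp add: C_def)
    obtain \<delta> where \<delta>: "0 < \<delta>" "\<delta> \<le> 1" "C * (2 * \<delta>) \<le> e"
      using C e by (rule small_multiple)
    define b where "b = min \<tau> (t0 + \<delta>)"
    define a where "a = t0 - 1"
    \<comment> \<open>The \<open>max\<close> only serves to define the orbit for all times; it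
      equals \<open>t\<close> near \<open>t0\<close>.\<close>
    let ?\<phi> = "\<lambda>t. L (max t a) a (U a b (?u b))"
    have est: "norm (?u t - ?\<phi> t) \<le> e" if t: "\<bar>t - t0\<bar> < \<delta>" "t \<le> \<tau>" for t
    proof -
      have ord: "a \<le> t" "t \<le> b" "b \<le> \<tau>" "b - t \<le> 2 * \<delta>" "t0 - 1 \<le> t"
        using t \<delta> by (auto simp: a_def b_def)
      have "?u t = integral {t..b} (\<lambda>s. U t s (g s)) + integral {b..\<tau>} (\<lambda>s. U t s (g s))"
        by (rule Henstock_Kurzweil_Integration.integral_combine[symmetric, OF ord(2,3) U_integrable[OF K(2)]])
      moreover have "integral {b..\<tau>} (\<lambda>s. U t s (g s)) = integral {b..\<tau>} (U t b \<circ> (\<lambda>s. U b s (g s)))"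
        by (rule integral_cong) (use ord in \<open>simp add: U_comp\<close>)
      moreover have "\<dots> = U t b (?u b)"
        by (rule integral_linear[OF U_integrable[OF K(2)] bounded_linear_U[OF ord(2)]])
      moreover have "?\<phi> t = U t b (?u b)"
        using ord by (simp add: L_U)
      ultimately have eq: "?u t - ?\<phi> t = integral {t..b} (\<lambda>s. U t s (g s))" by simp
      have "norm (integral {t..b} (\<lambda>s. U t s (g s))) \<le> C * (b - t)"
      proof (rule integral_bound[OF ord(2)])
        show "continuous_on {t..b} (\<lambda>s. U t s (g s))"
          using ord by (intro U_continuous continuous_on_subset[OF K(2)]) auto
        fix s assume s: "s \<in> {t..b}"
        have "\<rho> * (s - t) \<le> \<bar>\<rho>\<bar> * 2"
          using s ord \<delta> by (intro mult_mono) auto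
        moreover have "\<mu> * (\<tau> - s) \<le> \<bar>\<mu>\<bar> * (\<tau> - t0 + 1)"
          using s ord by (intro mult_mono) auto
        moreover have "norm (U t s (g s)) \<le> M * exp (\<rho> * (s - t)) * (K * exp (\<mu> * (\<tau> - s)))"
          by (rule order_trans[OF U_bound])
            (use s ord M_ge_1 K(3) in \<open>auto intro!: mult_left_mono\<close>)
        ultimately show "norm (U t s (g s)) \<le> C"
          unfolding C_def using M_ge_1 K(1)
          by (elim order_trans) (intro mult_mono, auto)
      qed
      also have "\<dots> \<le> C * (2 * \<delta>)" using ord C by (intro mult_left_mono) auto
      finally show ?thesis using eq \<delta>(3) by simp
    qed
    show "\<exists>\<phi>. continuous (at t0 within {..\<tau>}) \<phi> \<and> norm (?u t0 - \<phi> t0) \<le> e \<and>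
        eventually (\<lambda>s. norm (?u s - \<phi> s) \<le> e) (at t0 within {..\<tau>})"
    proof (intro exI[of _ ?\<phi>] conjI)
      show "continuous (at t0 within {..\<tau>}) ?\<phi>" by (rule L_forward_continuous)
      show "norm (?u t0 - ?\<phi> t0) \<le> e" by (rule est) (use \<delta> t0 in auto)
      show "eventually (\<lambda>s. norm (?u s - ?\<phi> s) \<le> e) (at t0 within {..\<tau>})"
        by (rule eventually_ball_at_within[OF \<delta>(1)]) (rule est, auto)
    qed
  qed
qed

text \<open>Here the cut lies at a fixed \<open>a\<close> to the left of \<open>t0\<close>: the
  integral over the past of \<open>a\<close> is transported forward by \<open>L t a\<close> and
  depends continuously on \<open>t\<close>, and the piece between \<open>a\<close> and
  \<open>t\<close> is short.\<close>

lemma stable_part_continuous: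
  assumes "tempered \<mu> \<tau> g" "\<mu> < \<gamma>"
  shows "continuous_on {..\<tau>} (\<lambda>t. integral {..t} (\<lambda>s. V t s (g s)))"
  unfolding continuous_on_eq_continuous_within
proof
  let ?y = "\<lambda>t. integral {..t} (\<lambda>s. V t s (g s))"
  obtain K where K: "0 \<le> K" "continuous_on {..\<tau>} g" "\<And>s. s \<le> \<tau> \<Longrightarrow> norm (g s) \<le> K * exp (\<mu> * (\<tau> - s))"
    using assms(1) by (rule temperedE) (rule that; blast)
  fix t0 assume "t0 \<in> {..\<tau>}"
  then have t0: "t0 \<le> \<tau>" by simp
  show "continuous (at t0 within {..\<tau>}) ?y"
  proof (rule continuous_at_within_approximation)
    fix e :: real assume e: "0 < e"
    define C where "C = M * exp (\<bar>\<gamma>\<bar> * 2) * (K * exp (\<bar>\<mu>\<bar> * (\<tau> - t0 + 1)))"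
    have C: "0 \<le> C" using K(1) M_ge_1 by (simp add: C_def)
    obtain \<delta> where \<delta>: "0 < \<delta>" "\<delta> \<le> 1" "C * (2 * \<delta>) \<le> e"
      using C e by (rule small_multiple)
    define a where "a = t0 - \<delta>"
    let ?\<phi> = "\<lambda>t. L (max t a) a (?y a)"
    have est: "norm (?y t - ?\<phi> t) \<le> e" if t: "\<bar>t - t0\<bar> < \<delta>" "t \<le> \<tau>" for t
    proof -
      have ord: "a \<le> t" "t \<le> \<tau>" "a \<le> \<tau>" "t - a \<le> 2 * \<delta>" "t0 - 1 \<le> a"
        using t \<delta> t0 by (auto simp: a_def)
      have i1: "(\<lambda>s. V t s (g s)) integrable_on {..a}"
        by (rule V_integrable[OF assms ord(3,1)])
      have c2: "continuous_on {a..t} (\<lambda>s. V t s (g s))"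
        by (rule continuous_on_subset[OF V_continuous])
          (use ord in \<open>auto intro: continuous_on_subset[OF K(2)]\<close>)
      have un: "{..a} \<union> {a..t} = {..t}" "{..a} \<inter> {a..t} = {a}" using ord by auto
      have "((\<lambda>s. V t s (g s)) has_integral
          integral {..a} (\<lambda>s. V t s (g s)) + integral {a..t} (\<lambda>s. V t s (g s))) ({..a} \<union> {a..t})"
        by (rule has_integral_Un)
          (use i1 c2 un in \<open>auto intro: integrable_continuous_interval\<close>)
      then have "?y t = integral {..a} (\<lambda>s. V t s (g s)) + integral {a..t} (\<lambda>s. V t s (g s))"
        unfolding un by (rule integral_unique)
      moreover have "integral {..a} (\<lambda>s. V t s (g s)) = integral {..a} (L t a \<circ> (\<lambda>s. V a s (g s)))"
        by (rule integral_cong) (use ord in \<open>simp add: V_alt L_comp\<close>)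
      moreover have "\<dots> = L t a (?y a)"
        by (rule integral_linear[OF V_integrable[OF assms ord(3)] blinfun.bounded_linear_right]) simp
      ultimately have eq: "?y t - ?\<phi> t = integral {a..t} (\<lambda>s. V t s (g s))"
        using ord by simp
      have "norm (integral {a..t} (\<lambda>s. V t s (g s))) \<le> C * (t - a)"
      proof (rule integral_bound[OF ord(1) c2])
        fix s assume s: "s \<in> {a..t}"
        have "- \<gamma> * (t - s) \<le> \<bar>\<gamma>\<bar> * 2"
          using s ord \<delta> by (intro mult_mono) auto
        moreover have "\<mu> * (\<tau> - s) \<le> \<bar>\<mu>\<bar> * (\<tau> - t0 + 1)"
          using s ord by (intro mult_mono) auto
        moreover have "norm (V t s (g s)) \<le> M * exp (- \<gamma> * (t - s)) * (K * exp (\<mu> * (\<tau> - s)))"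
          by (rule order_trans[OF V_bound])
            (use s ord M_ge_1 K(3) in \<open>auto intro!: mult_left_mono\<close>)
        ultimately show "norm (V t s (g s)) \<le> C"
          unfolding C_def using M_ge_1 K(1)
          by (elim order_trans) (intro mult_mono, auto)
      qed
      also have "\<dots> \<le> C * (2 * \<delta>)" using ord C by (intro mult_left_mono) auto
      finally show ?thesis using eq \<delta>(3) by simp
    qed
    show "\<exists>\<phi>. continuous (at t0 within {..\<tau>}) \<phi> \<and> norm (?y t0 - \<phi> t0) \<le> e \<and>
        eventually (\<lambda>s. norm (?y s - \<phi> s) \<le> e) (at t0 within {..\<tau>})"
    proof (intro exI[of _ ?\<phi>] conjI)
      show "continuous (at t0 within {..\<tau>}) ?\<phi>" by (rule L_forward_continuous)
      show "norm (?y t0 - ?\<phi> t0) \<le> e" by (rule est) (use \<delta> t0 in auto)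
      show "eventually (\<lambda>s. norm (?y s - ?\<phi> s) \<le> e) (at t0 within {..\<tau>})"
        by (rule eventually_ball_at_within[OF \<delta>(1)]) (rule est, auto)
    qed
  qed
qed

lemma green_continuous:
  assumes "tempered \<mu> \<tau> g" "\<mu> < \<gamma>"
  shows "continuous_on {..\<tau>} (green \<tau> g)"
  unfolding green_def[abs_def]
  by (intro continuous_intros unstable_part_continuous[OF assms(1)] stable_part_continuous[OF assms])

section \<open>Linearity of the Green operator in the forcing\<close>

lemma green_add:
  assumes "tempered \<mu> \<tau> g" "tempered \<mu> \<tau> h" "\<mu> < \<gamma>" "t \<le> \<tau>"
  shows "green \<tau> (\<lambda>s. g s + h s) t = green \<tau> g t + green \<tau> h t"
proof -
  have c: "continuous_on {..\<tau>} g" "continuous_on {..\<tau>} h" using assms by (auto simp: tempered_def)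
  have "integral {t..\<tau>} (\<lambda>s. U t s (g s + h s)) = integral {t..\<tau>} (\<lambda>s. U t s (g s) + U t s (h s))"
    by (rule integral_cong) (auto simp: linear_add[OF linear_U])
  also have "\<dots> = integral {t..\<tau>} (\<lambda>s. U t s (g s)) + integral {t..\<tau>} (\<lambda>s. U t s (h s))"
    by (intro integral_add U_integrable c)
  finally have 1: "integral {t..\<tau>} (\<lambda>s. U t s (g s + h s)) = \<dots>" .
  have "integral {..t} (\<lambda>s. V t s (g s) + V t s (h s))
      = integral {..t} (\<lambda>s. V t s (g s)) + integral {..t} (\<lambda>s. V t s (h s))"
    by (intro integral_add V_integrable[OF assms(1,3,4)] V_integrable[OF assms(2,3,4)]) simp_all
  with 1 show ?thesis
    by (simp add: green_def linear_add[OF bounded_linear.linear[OF bounded_linear_V]])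
qed

lemma green_scale:
  assumes "t \<le> \<tau>"
  shows "green \<tau> (\<lambda>s. c *\<^sub>R g s) t = c *\<^sub>R green \<tau> g t"
proof -
  have "integral {t..\<tau>} (\<lambda>s. U t s (c *\<^sub>R g s)) = integral {t..\<tau>} (\<lambda>s. c *\<^sub>R U t s (g s))"
    by (rule integral_cong) (auto simp: linear_scale[OF linear_U])
  then show ?thesis
    by (simp add: green_def linear_scale[OF bounded_linear.linear[OF bounded_linear_V]]
        scaleR_diff_right)
qed

lemma green_diff:
  assumes "tempered \<mu> \<tau> g" "tempered \<mu> \<tau> h" "\<mu> < \<gamma>" "t \<le> \<tau>"
  shows "green \<tau> (\<lambda>s. g s - h s) t = green \<tau> g t - green \<tau> h t"
  using green_add[OF assms(1) tempered_scale[OF assms(2), of "-1"] assms(3,4)]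
    green_scale[OF assms(4), of "-1" h] by simp

lemma green_cong:
  assumes "\<And>s. s \<le> \<tau> \<Longrightarrow> g s = h s" "t \<le> \<tau>"
  shows "green \<tau> g t = green \<tau> h t"
proof -
  have "integral {t..\<tau>} (\<lambda>s. U t s (g s)) = integral {t..\<tau>} (\<lambda>s. U t s (h s))"
    "integral {..t} (\<lambda>s. V t s (g s)) = integral {..t} (\<lambda>s. V t s (h s))"
    using assms by (auto intro!: integral_cong)
  then show ?thesis by (simp add: green_def)
qed

lemma green_zero [simp]: "green \<tau> (\<lambda>s. 0) t = 0"
proof -
  have "integral {t..\<tau>} (\<lambda>s. U t s 0) = integral {t..\<tau>} (\<lambda>s. 0)"
    by (rule integral_cong) simp
  then show ?thesis
    by (simp add: green_def linear_0[OF bounded_linear.linear[OF bounded_linear_V]])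
qed

lemma tempered_cong:
  assumes "\<And>s. s \<le> \<tau> \<Longrightarrow> g s = h s"
  shows "tempered \<mu> \<tau> g \<longleftrightarrow> tempered \<mu> \<tau> h"
proof -
  have "continuous_on {..\<tau>} g \<longleftrightarrow> continuous_on {..\<tau>} h"
    by (rule continuous_on_cong) (simp_all add: assms)
  then show ?thesis using assms by (simp add: tempered_def)
qed

text \<open>Backward evolution is continuous in time because near \<open>t0\<close> it coincides
  with the forward orbit issued at time \<open>t0 - 1\<close>.\<close>

lemma U_tempered:
  assumes "\<rho> \<le> \<mu>"
  shows "tempered \<mu> \<tau> (\<lambda>t. U t \<tau> \<eta>)"
  unfolding tempered_def
proof
  show "continuous_on {..\<tau>} (\<lambda>t. U t \<tau> \<eta>)"
    unfolding continuous_on_eq_continuous_within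
  proof
    fix t0 assume t0: "t0 \<in> {..\<tau>}"
    let ?\<phi> = "\<lambda>t. L (max t (t0 - 1)) (t0 - 1) (U (t0 - 1) \<tau> \<eta>)"
    have eq: "U t \<tau> \<eta> = ?\<phi> t" if "\<bar>t - t0\<bar> < 1" "t \<in> {..\<tau>}" for t
    proof -
      have "max t (t0 - 1) = t" "t0 - 1 \<le> t" "t \<le> \<tau>" using that by auto
      then show ?thesis by (simp add: L_U)
    qed
    show "continuous (at t0 within {..\<tau>}) (\<lambda>t. U t \<tau> \<eta>)"
    proof (rule continuous_at_within_approximation, intro exI[of _ ?\<phi>] conjI)
      fix e :: real assume e: "0 < e"
      show "norm (U t0 \<tau> \<eta> - ?\<phi> t0) \<le> e" using eq[of t0] t0 e by simp
      show "eventually (\<lambda>s. norm (U s \<tau> \<eta> - ?\<phi> s) \<le> e) (at t0 within {..\<tau>})"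
        by (rule eventually_ball_at_within[of 1]) (use eq e in simp_all)
    qed (rule L_forward_continuous)
  qed
  show "\<exists>K. \<forall>s\<le>\<tau>. norm (U s \<tau> \<eta>) \<le> K * exp (\<mu> * (\<tau> - s))"
  proof (intro exI[of _ "M * norm \<eta>"] allI impI)
    fix s assume s: "s \<le> \<tau>"
    have "M * exp (\<rho> * (\<tau> - s)) * norm \<eta> \<le> M * exp (\<mu> * (\<tau> - s)) * norm \<eta>"
      using s assms M_ge_1 by (intro mult_right_mono mult_left_mono) (auto intro: mult_right_mono)
    then show "norm (U s \<tau> \<eta>) \<le> M * norm \<eta> * exp (\<mu> * (\<tau> - s))"
      using U_bound[OF s, of \<eta>] by (simp add: mult_ac)
  qed
qed

lemma norm_U_le_exp:
  assumes "\<rho> \<le> \<mu>" "t \<le> \<tau>"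
  shows "norm (U t \<tau> \<eta>) \<le> M * norm \<eta> * exp (\<mu> * (\<tau> - t))"
proof -
  have "M * exp (\<rho> * (\<tau> - t)) * norm \<eta> \<le> M * exp (\<mu> * (\<tau> - t)) * norm \<eta>"
    using assms M_ge_1 by (intro mult_right_mono mult_left_mono) (auto intro: mult_right_mono)
  then show ?thesis
    using U_bound[OF assms(2), of \<eta>] by (simp add: mult_ac)
qed

end

subsection \<open>Backward solutions\<close>

locale splitting_system = exponential_split L Q M \<gamma> \<rho>
  for L :: "real \<Rightarrow> real \<Rightarrow> 'a::banach \<Rightarrow>\<^sub>L 'a" and Q M \<gamma> \<rho> +
  fixes \<Gamma> :: "real \<times> real \<Rightarrow> real" and f :: "real \<Rightarrow> 'a \<Rightarrow> 'a" and L\<^sub>1 L\<^sub>2 \<sigma> :: real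
  assumes admissible: "admissible_norm \<Gamma>"
    and f_cont: "continuous_on UNIV (\<lambda>(t, u). f t u)"
    and f_zero [simp]: "f t 0 = 0"
    and L1_pos: "0 < L\<^sub>1" and L2_pos: "0 < L\<^sub>2"
    and lipschitz: "splitting_lipschitz L Q \<gamma> \<rho> \<Gamma> f L\<^sub>1 L\<^sub>2"
    and sigma: "\<rho> < \<sigma>" "\<sigma> < \<gamma>"
    and gap: "\<Gamma> (L\<^sub>1 / (\<sigma> - \<rho>), L\<^sub>2 / (\<gamma> - \<sigma>)) < 1"
begin

lemmas Gamma_rules = admissible[unfolded admissible_norm_def]

lemmas Gamma_nonneg [simp] = Gamma_rules[THEN conjunct1, rule_format]
lemmas Gamma_eq_0 = Gamma_rules[THEN conjunct2, THEN conjunct1, rule_format]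
lemmas Gamma_scale = Gamma_rules[THEN conjunct2, THEN conjunct2, THEN conjunct1, rule_format]
lemmas Gamma_add = Gamma_rules[THEN conjunct2, THEN conjunct2, THEN conjunct2, THEN conjunct1, rule_format]
lemmas Gamma_mono_axes = Gamma_rules[THEN conjunct2, THEN conjunct2, THEN conjunct2, THEN conjunct2]

section \<open>Equivalence of the adapted norms with the norm of the space\<close>

lemma Gamma_mono:
  assumes "0 \<le> a" "a \<le> a'" "0 \<le> b" "b \<le> b'"
  shows "\<Gamma> (a, b) \<le> \<Gamma> (a', b')"
proof -
  have "\<Gamma> (a, b) \<le> \<Gamma> (a, b')"
    using mono_onD[OF Gamma_mono_axes[THEN conjunct1, rule_format, OF assms(1)], of b b'] assms by simp
  also have "\<dots> \<le> \<Gamma> (a', b')"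
    using mono_onD[OF Gamma_mono_axes[THEN conjunct2, rule_format, of b'], of a a'] assms by simp
  finally show ?thesis .
qed

lemma Gamma_scale_pair: "0 \<le> c \<Longrightarrow> \<Gamma> (c * a, c * b) = c * \<Gamma> (a, b)"
  using Gamma_scale[of c "(a, b)"] by simp

lemma Gamma_axis_pos: "0 < \<Gamma> (1, 0)" "0 < \<Gamma> (0, 1)"
  using Gamma_eq_0[of "(1, 0)"] Gamma_eq_0[of "(0, 1)"] Gamma_nonneg[of "(1, 0)"] Gamma_nonneg[of "(0, 1)"]
  by (auto simp: less_le prod_eq_iff)

definition sn :: "real \<Rightarrow> 'a \<Rightarrow> real" where
  "sn t x = \<Gamma> (nN t x, nS t x)"

lemma split_norm_eq: "split_norm L Q \<gamma> \<rho> \<Gamma> t x = sn t x"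
  by (simp add: split_norm_def sn_def nN_def nS_def)

lemma sn_nonneg [simp]: "0 \<le> sn t x"
  by (simp add: sn_def)

lemma sn_add: "sn t (x + y) \<le> sn t x + sn t y"
proof -
  have "sn t (x + y) \<le> \<Gamma> (nN t x + nN t y, nS t x + nS t y)"
    unfolding sn_def by (intro Gamma_mono nN_add nS_add) auto
  also have "\<dots> \<le> sn t x + sn t y"
    using Gamma_add[of "(nN t x, nS t x)" "(nN t y, nS t y)"] by (simp add: sn_def)
  finally show ?thesis .
qed

lemma sn_scale: "sn t (c *\<^sub>R x) \<le> \<bar>c\<bar> * sn t x"
proof -
  have "sn t (c *\<^sub>R x) \<le> \<Gamma> (\<bar>c\<bar> * nN t x, \<bar>c\<bar> * nS t x)"
    unfolding sn_def by (intro Gamma_mono nN_scale nS_scale) auto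
  then show ?thesis by (simp add: Gamma_scale_pair sn_def)
qed

text \<open>The constants of the equivalence of \<open>sn t\<close> with the norm of
  \<open>X\<close>: \<open>c\<^sub>1\<close> comes from comparing \<open>\<Gamma>\<close> with its
  values on the axes, \<open>c\<^sub>2\<close> from the bound \<open>M\<close> on both seminorms.
  Neither depends on \<open>t\<close>.\<close>

definition c\<^sub>1 :: real where "c\<^sub>1 = 1 / \<Gamma> (1, 0) + 1 / \<Gamma> (0, 1)"
definition c\<^sub>2 :: real where "c\<^sub>2 = M * \<Gamma> (1, 1)"

lemma c1_nonneg: "0 \<le> c\<^sub>1" and c2_nonneg: "0 \<le> c\<^sub>2"
  using Gamma_axis_pos M_ge_1 by (auto simp: c\<^sub>1_def c\<^sub>2_def)

lemma norm_le_sn: "norm x \<le> c\<^sub>1 * sn t x"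
proof -
  have "nN t x * \<Gamma> (1, 0) = \<Gamma> (nN t x, 0)" using Gamma_scale_pair[of "nN t x" 1 0] by simp
  also have "\<dots> \<le> sn t x" unfolding sn_def by (intro Gamma_mono) auto
  finally have 1: "nN t x \<le> sn t x / \<Gamma> (1, 0)" using Gamma_axis_pos by (simp add: pos_le_divide_eq)
  have "nS t x * \<Gamma> (0, 1) = \<Gamma> (0, nS t x)" using Gamma_scale_pair[of "nS t x" 0 1] by simp
  also have "\<dots> \<le> sn t x" unfolding sn_def by (intro Gamma_mono) auto
  finally have 2: "nS t x \<le> sn t x / \<Gamma> (0, 1)" using Gamma_axis_pos by (simp add: pos_le_divide_eq)
  have "norm x \<le> sn t x / \<Gamma> (1, 0) + sn t x / \<Gamma> (0, 1)"
    using 1 2 norm_le_nN_nS[of x t] by linarith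
  then show ?thesis by (simp add: c\<^sub>1_def algebra_simps)
qed

lemma sn_le_norm: "sn t x \<le> c\<^sub>2 * norm x"
proof -
  have "sn t x \<le> \<Gamma> ((M * norm x) * 1, (M * norm x) * 1)"
    unfolding sn_def using nN_le_norm[of t x] nS_le_norm[of t x] by (intro Gamma_mono) auto
  also have "\<dots> = (M * norm x) * \<Gamma> (1, 1)"
    using M_ge_1 by (intro Gamma_scale_pair) auto
  finally show ?thesis by (simp add: c\<^sub>2_def mult_ac)
qed

section \<open>Lipschitz and growth bounds for the nonlinearity\<close>

lemma nN_lipschitz: "nN t (f t u - f t v) \<le> L\<^sub>1 * sn t (u - v)"
  and nS_lipschitz: "nS t (f t u - f t v) \<le> L\<^sub>2 * sn t (u - v)"
  using lipschitz unfolding splitting_lipschitz_def split_norm_eq nN_def nS_def by auto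

lemma f_lipschitz: "norm (f t u - f t v) \<le> (L\<^sub>1 + L\<^sub>2) * c\<^sub>2 * norm (u - v)"
proof -
  have "norm (f t u - f t v) \<le> (L\<^sub>1 + L\<^sub>2) * sn t (u - v)"
    using norm_le_nN_nS[of "f t u - f t v" t] nN_lipschitz[of t u v] nS_lipschitz[of t u v]
    by (simp add: algebra_simps)
  also have "\<dots> \<le> (L\<^sub>1 + L\<^sub>2) * (c\<^sub>2 * norm (u - v))"
    using L1_pos L2_pos by (intro mult_left_mono sn_le_norm) auto
  finally show ?thesis by (simp add: mult_ac)
qed

lemma f_comp_continuous: "continuous_on S z \<Longrightarrow> continuous_on S (\<lambda>s. f s (z s))"
  by (rule continuous_on_compose2[OF f_cont, of S "\<lambda>s. (s, z s)", unfolded case_prod_conv])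
    (auto intro!: continuous_intros)

lemma f_tempered: "tempered \<mu> \<tau> z \<Longrightarrow> tempered \<mu> \<tau> (\<lambda>s. f s (z s))"
proof (elim temperedE)
  fix K assume K: "continuous_on {..\<tau>} z" "\<And>s. s \<le> \<tau> \<Longrightarrow> norm (z s) \<le> K * exp (\<mu> * (\<tau> - s))"
  have "norm (f s (z s)) \<le> ((L\<^sub>1 + L\<^sub>2) * c\<^sub>2 * K) * exp (\<mu> * (\<tau> - s))" if "s \<le> \<tau>" for s
  proof -
    have "norm (f s (z s)) \<le> (L\<^sub>1 + L\<^sub>2) * c\<^sub>2 * norm (z s)"
      using f_lipschitz[of s "z s" 0] by simp
    also have "\<dots> \<le> (L\<^sub>1 + L\<^sub>2) * c\<^sub>2 * (K * exp (\<mu> * (\<tau> - s)))"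
      using L1_pos L2_pos c2_nonneg K(2)[OF that] by (intro mult_left_mono) auto
    finally show ?thesis by (simp add: mult_ac)
  qed
  then show ?thesis
    unfolding tempered_def using f_comp_continuous[OF K(1)] by blast
qed

lemma tempered_if_sn_le:
  assumes "continuous_on {..\<tau>} z" "\<And>s. s \<le> \<tau> \<Longrightarrow> sn s (z s) \<le> K * exp (\<mu> * (\<tau> - s))"
  shows "tempered \<mu> \<tau> z"
proof -
  have "norm (z s) \<le> (c\<^sub>1 * K) * exp (\<mu> * (\<tau> - s))" if "s \<le> \<tau>" for s
    using norm_le_sn[of "z s" s] mult_left_mono[OF assms(2)[OF that] c1_nonneg] by (simp add: mult_ac)
  then show ?thesis unfolding tempered_def using assms(1) by blast
qed

text \<open>The left-hand side of the gap condition with a variable exponent: the Lipschitz constant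
  obtained for the integral operator in the weight \<open>\<mu>\<close>.\<close>

definition contraction :: "real \<Rightarrow> real" where
  "contraction \<mu> = \<Gamma> (L\<^sub>1 / (\<mu> - \<rho>), L\<^sub>2 / (\<gamma> - \<mu>))"

text \<open>Homogeneity of \<open>\<Gamma>\<close> extracts the weight and \<open>K\<close>,
  subadditivity separates the contracted part from the forcing \<open>m\<close>. With
  \<open>m = 0\<close> this is the contraction estimate for solutions; with \<open>m\<close> made of
  Taylor remainders it is the estimate behind differentiability.\<close>

lemma sn_green_le:
  assumes g: "tempered \<mu> \<tau> g" and \<mu>: "\<rho> < \<mu>" "\<mu> < \<gamma>" and t: "t \<le> \<tau>" and K: "0 \<le> K"
    and m: "\<And>s. s \<le> \<tau> \<Longrightarrow> 0 \<le> m s"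
    and J: "((\<lambda>s. m s * exp (- \<mu> * (\<tau> - s))) has_integral J) {..\<tau>}"
    and N: "\<And>s. s \<le> \<tau> \<Longrightarrow> nN s (g s) \<le> L\<^sub>1 * (K * exp (\<mu> * (\<tau> - s))) + m s"
    and S: "\<And>s. s \<le> \<tau> \<Longrightarrow> nS s (g s) \<le> L\<^sub>2 * (K * exp (\<mu> * (\<tau> - s))) + m s"
  shows "sn t (green \<tau> g t) \<le> (contraction \<mu> * K + \<Gamma> (1, 1) * J) * exp (\<mu> * (\<tau> - t))"
proof -
  let ?e = "exp (\<mu> * (\<tau> - t))"
  have J0: "0 \<le> J" using J by (rule has_integral_nonneg) (use m in auto)
  have "nN t (green \<tau> g t) \<le> (L\<^sub>1 * K / (\<mu> - \<rho>) + J) * ?e"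
    by (rule nN_green_le[OF g \<mu> t _ m J]) (use N L1_pos K in \<open>auto simp: mult.assoc\<close>)
  moreover have "nS t (green \<tau> g t) \<le> (L\<^sub>2 * K / (\<gamma> - \<mu>) + J) * ?e"
    by (rule nS_green_le[OF g \<mu>(2) t _ m J]) (use S L2_pos K in \<open>auto simp: mult.assoc\<close>)
  ultimately have "sn t (green \<tau> g t) \<le> \<Gamma> (?e * (L\<^sub>1 * K / (\<mu> - \<rho>) + J), ?e * (L\<^sub>2 * K / (\<gamma> - \<mu>) + J))"
    unfolding sn_def by (intro Gamma_mono) (auto simp: mult.commute)
  also have "\<dots> = ?e * \<Gamma> (L\<^sub>1 * K / (\<mu> - \<rho>) + J, L\<^sub>2 * K / (\<gamma> - \<mu>) + J)"
    by (intro Gamma_scale_pair) simp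
  also have "\<Gamma> (L\<^sub>1 * K / (\<mu> - \<rho>) + J, L\<^sub>2 * K / (\<gamma> - \<mu>) + J)
      \<le> \<Gamma> (L\<^sub>1 * K / (\<mu> - \<rho>), L\<^sub>2 * K / (\<gamma> - \<mu>)) + \<Gamma> (J, J)"
    using Gamma_add[of "(L\<^sub>1 * K / (\<mu> - \<rho>), L\<^sub>2 * K / (\<gamma> - \<mu>))" "(J, J)"] by simp
  also have "\<Gamma> (L\<^sub>1 * K / (\<mu> - \<rho>), L\<^sub>2 * K / (\<gamma> - \<mu>)) = K * contraction \<mu>"
    unfolding contraction_def using Gamma_scale_pair[OF K, of "L\<^sub>1 / (\<mu> - \<rho>)" "L\<^sub>2 / (\<gamma> - \<mu>)"]
    by (simp add: mult.commute)
  also have "\<Gamma> (J, J) = J * \<Gamma> (1, 1)"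
    using Gamma_scale_pair[OF J0, of 1 1] by simp
  finally show ?thesis by (simp add: algebra_simps)
qed

lemma sn_green_f_diff_le:
  assumes z: "tempered \<sigma> \<tau> z" "tempered \<sigma> \<tau> y" and t: "t \<le> \<tau>" and K: "0 \<le> K"
    and le: "\<And>s. s \<le> \<tau> \<Longrightarrow> sn s (z s - y s) \<le> K * exp (\<sigma> * (\<tau> - s))"
  shows "sn t (green \<tau> (\<lambda>s. f s (z s)) t - green \<tau> (\<lambda>s. f s (y s)) t)
    \<le> contraction \<sigma> * K * exp (\<sigma> * (\<tau> - t))"
proof -
  have "nN s (f s (z s) - f s (y s)) \<le> L\<^sub>1 * (K * exp (\<sigma> * (\<tau> - s))) + 0"
    "nS s (f s (z s) - f s (y s)) \<le> L\<^sub>2 * (K * exp (\<sigma> * (\<tau> - s))) + 0" if "s \<le> \<tau>" for s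
    using nN_lipschitz[of s "z s" "y s"] nS_lipschitz[of s "z s" "y s"]
      mult_left_mono[OF le[OF that] less_imp_le[OF L1_pos]]
      mult_left_mono[OF le[OF that] less_imp_le[OF L2_pos]] by linarith+
  then have "sn t (green \<tau> (\<lambda>s. f s (z s) - f s (y s)) t) \<le> (contraction \<sigma> * K + \<Gamma> (1, 1) * 0) * exp (\<sigma> * (\<tau> - t))"
    by (intro sn_green_le[where m = "\<lambda>_. 0"])
      (use sigma K t in \<open>auto intro!: tempered_diff f_tempered z\<close>)
  then show ?thesis
    using green_diff[OF f_tempered[OF z(1)] f_tempered[OF z(2)] sigma(2) t] by simp
qed

text \<open>The integral equation without the convention on values to the right of
  \<open>\<tau>\<close>; accordingly uniqueness is meant on the half-line only.\<close>

definition solves :: "real \<Rightarrow> 'a \<Rightarrow> (real \<Rightarrow> 'a) \<Rightarrow> bool" where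
  "solves \<tau> \<eta> z \<longleftrightarrow> tempered \<sigma> \<tau> z \<and> (\<forall>t\<le>\<tau>. z t = U t \<tau> \<eta> + green \<tau> (\<lambda>s. f s (z s)) t)"

lemma bdd_above_weighted_sn:
  assumes "tempered \<mu> \<tau> z"
  shows "bdd_above ((\<lambda>t. sn t (z t) * exp (- \<mu> * (\<tau> - t))) ` {..\<tau>})"
proof -
  obtain K where "0 \<le> K" "continuous_on {..\<tau>} z"
    and K: "\<And>s. s \<le> \<tau> \<Longrightarrow> norm (z s) \<le> K * exp (\<mu> * (\<tau> - s))"
    using assms by (rule temperedE) (rule that; blast)
  show ?thesis
  proof (rule bdd_aboveI2)
    fix t assume "t \<in> {..\<tau>}"
    then have "sn t (z t) \<le> c\<^sub>2 * (K * exp (\<mu> * (\<tau> - t)))"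
      using sn_le_norm[of t "z t"] mult_left_mono[OF K c2_nonneg, of t] by simp
    then show "sn t (z t) * exp (- \<mu> * (\<tau> - t)) \<le> c\<^sub>2 * K"
      by (simp only: div_exp_le_iff mult.assoc)
  qed
qed

definition C\<^sub>z :: real where "C\<^sub>z = c\<^sub>2 * M / (1 - contraction \<sigma>)"

lemma contraction_sigma: "contraction \<sigma> < 1"
  using gap by (simp add: contraction_def)

lemma contraction_nonneg [simp]: "0 \<le> contraction \<mu>"
  by (simp add: contraction_def)

text \<open>The homogeneous parts differ by the backward evolution of
  \<open>\<eta> - \<zeta>\<close> and the Green parts are contracted, so any bound on the difference
  improves itself. For \<open>\<eta> = \<zeta>\<close> this is uniqueness.\<close>

lemma solves_lipschitz:
  assumes z: "solves \<tau> \<eta> z" and y: "solves \<tau> \<zeta> y" and t: "t \<le> \<tau>"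
  shows "sn t (z t - y t) \<le> C\<^sub>z * norm (\<eta> - \<zeta>) * exp (\<sigma> * (\<tau> - t))"
proof -
  let ?\<phi> = "\<lambda>t. sn t (z t - y t) * exp (- \<sigma> * (\<tau> - t))"
  have tz: "tempered \<sigma> \<tau> z" and ty: "tempered \<sigma> \<tau> y" using z y by (auto simp: solves_def)
  have "?\<phi> t \<le> (c\<^sub>2 * M * norm (\<eta> - \<zeta>)) / (1 - contraction \<sigma>)"
  proof (rule bound_of_self_improvement[where S = "{..\<tau>}" and \<phi> = ?\<phi>])
    show "bdd_above (?\<phi> ` {..\<tau>})" by (intro bdd_above_weighted_sn tempered_diff tz ty)
    show "contraction \<sigma> < 1" by (rule contraction_sigma)
    show "t \<in> {..\<tau>}" using t by simp
    show "0 \<le> ?\<phi> s" for s by simp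
    fix K s assume K: "0 \<le> K" and le: "\<And>s. s \<in> {..\<tau>} \<Longrightarrow> ?\<phi> s \<le> K" and s: "s \<in> {..\<tau>}"
    have eq: "z s - y s = U s \<tau> (\<eta> - \<zeta>) + (green \<tau> (\<lambda>s. f s (z s)) s - green \<tau> (\<lambda>s. f s (y s)) s)"
      using z y s by (simp add: solves_def linear_diff[OF linear_U])
    have "sn s (green \<tau> (\<lambda>s. f s (z s)) s - green \<tau> (\<lambda>s. f s (y s)) s) \<le> contraction \<sigma> * K * exp (\<sigma> * (\<tau> - s))"
      by (rule sn_green_f_diff_le[OF tz ty]) (use s K le in \<open>auto simp only: div_exp_le_iff atMost_iff\<close>)
    moreover have "sn s (U s \<tau> (\<eta> - \<zeta>)) \<le> c\<^sub>2 * (M * norm (\<eta> - \<zeta>) * exp (\<sigma> * (\<tau> - s)))"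
      by (rule order_trans[OF sn_le_norm]) (use s sigma c2_nonneg in \<open>auto intro!: mult_left_mono norm_U_le_exp\<close>)
    moreover have "sn s (z s - y s) \<le> sn s (U s \<tau> (\<eta> - \<zeta>))
        + sn s (green \<tau> (\<lambda>s. f s (z s)) s - green \<tau> (\<lambda>s. f s (y s)) s)"
      unfolding eq by (rule sn_add)
    ultimately have "sn s (z s - y s) \<le> c\<^sub>2 * (M * norm (\<eta> - \<zeta>) * exp (\<sigma> * (\<tau> - s)))
        + contraction \<sigma> * K * exp (\<sigma> * (\<tau> - s))"
      by linarith
    also have "\<dots> = (contraction \<sigma> * K + c\<^sub>2 * M * norm (\<eta> - \<zeta>)) * exp (\<sigma> * (\<tau> - s))"
      by (simp add: distrib_right)
    finally have "sn s (z s - y s) \<le> (contraction \<sigma> * K + c\<^sub>2 * M * norm (\<eta> - \<zeta>)) * exp (\<sigma> * (\<tau> - s))" .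
    then show "?\<phi> s \<le> contraction \<sigma> * K + c\<^sub>2 * M * norm (\<eta> - \<zeta>)" by (simp only: div_exp_le_iff)
  qed
  then have "sn t (z t - y t) \<le> (c\<^sub>2 * M * norm (\<eta> - \<zeta>)) / (1 - contraction \<sigma>) * exp (\<sigma> * (\<tau> - t))"
    by (simp only: div_exp_le_iff)
  then show ?thesis by (simp add: C\<^sub>z_def mult_ac)
qed

section \<open>Existence by successive approximation\<close>

primrec picard :: "real \<Rightarrow> 'a \<Rightarrow> nat \<Rightarrow> real \<Rightarrow> 'a" where
  "picard \<tau> \<eta> 0 = (\<lambda>t. 0)"
| "picard \<tau> \<eta> (Suc n) = (\<lambda>t. U t \<tau> \<eta> + green \<tau> (\<lambda>s. f s (picard \<tau> \<eta> n s)) t)"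

text \<open>Compare with the zero function: since \<open>f\<close> vanishes at zero, so does the
  corresponding Green term, and the contraction estimate becomes a growth bound.\<close>

lemma green_f_tempered:
  assumes "tempered \<sigma> \<tau> z"
  shows "tempered \<sigma> \<tau> (green \<tau> (\<lambda>s. f s (z s)))"
proof -
  have z0: "tempered \<sigma> \<tau> (\<lambda>s. 0)"
    unfolding tempered_def by (auto intro!: exI[of _ 0])
  have "bdd_above ((\<lambda>t. sn t (z t) * exp (- \<sigma> * (\<tau> - t))) ` {..\<tau>})"
    by (rule bdd_above_weighted_sn[OF assms])
  then obtain K where K: "\<And>s. s \<le> \<tau> \<Longrightarrow> sn s (z s) * exp (- \<sigma> * (\<tau> - s)) \<le> K"
    unfolding bdd_above_def by auto
  have K0: "0 \<le> K"
    using order_trans[OF _ K[of \<tau>], of 0] by simp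
  show ?thesis
  proof (rule tempered_if_sn_le)
    show "continuous_on {..\<tau>} (green \<tau> (\<lambda>s. f s (z s)))"
      by (rule green_continuous[OF f_tempered[OF assms] sigma(2)])
    show "sn s (green \<tau> (\<lambda>s. f s (z s)) s) \<le> contraction \<sigma> * K * exp (\<sigma> * (\<tau> - s))" if "s \<le> \<tau>" for s
      using sn_green_f_diff_le[OF assms z0 that K0] K by (simp add: div_exp_le_iff[simplified])
  qed
qed

lemma picard_tempered: "tempered \<sigma> \<tau> (picard \<tau> \<eta> n)"
proof (induction n)
  case 0
  show ?case unfolding tempered_def by (auto intro!: exI[of _ 0])
next
  case (Suc n)
  then show ?case
    using sigma by (auto intro!: tempered_add U_tempered green_f_tempered)
qed

lemma picard_step:
  "t \<le> \<tau> \<Longrightarrow> sn t (picard \<tau> \<eta> (Suc n) t - picard \<tau> \<eta> n t)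
    \<le> contraction \<sigma> ^ n * (c\<^sub>2 * M * norm \<eta>) * exp (\<sigma> * (\<tau> - t))"
proof (induction n arbitrary: t)
  case 0
  have "sn t (U t \<tau> \<eta>) \<le> c\<^sub>2 * (M * norm \<eta> * exp (\<sigma> * (\<tau> - t)))"
    by (rule order_trans[OF sn_le_norm]) (use 0 sigma c2_nonneg in \<open>auto intro!: mult_left_mono norm_U_le_exp\<close>)
  then show ?case by (simp add: mult_ac)
next
  case (Suc n)
  have "sn t (green \<tau> (\<lambda>s. f s (picard \<tau> \<eta> (Suc n) s)) t - green \<tau> (\<lambda>s. f s (picard \<tau> \<eta> n s)) t)
     \<le> contraction \<sigma> * (contraction \<sigma> ^ n * (c\<^sub>2 * M * norm \<eta>)) * exp (\<sigma> * (\<tau> - t))"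
    by (rule sn_green_f_diff_le[OF picard_tempered picard_tempered Suc.prems])
      (use c2_nonneg M_ge_1 Suc.IH in auto)
  then show ?case by (simp add: mult_ac)
qed

lemma solution_exists: "\<exists>z. solves \<tau> \<eta> z"
proof -
  let ?p = "picard \<tau> \<eta>"
  let ?w = "\<lambda>t. exp (- \<sigma> * (\<tau> - t))"
  \<comment> \<open>Multiplying by the weight turns geometric decay in the weighted norm into
    uniform convergence on the whole half-line; \<open>z\<close> is recovered by removing the weight
    from the limit.\<close>
  let ?d = "\<lambda>n t. ?w t *\<^sub>R (?p (Suc n) t - ?p n t)"
  define D where "D = c\<^sub>1 * (c\<^sub>2 * M * norm \<eta>)"
  define S where "S t = (\<Sum>n. ?d n t)" for t
  define z where "z t = exp (\<sigma> * (\<tau> - t)) *\<^sub>R S t" for t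
  have bound: "norm (?d n t) \<le> D * contraction \<sigma> ^ n" if "t \<in> {..\<tau>}" for n t
  proof -
    have "norm (?p (Suc n) t - ?p n t) \<le> c\<^sub>1 * (contraction \<sigma> ^ n * (c\<^sub>2 * M * norm \<eta>) * exp (\<sigma> * (\<tau> - t)))"
      using norm_le_sn picard_step[of t \<tau> \<eta> n] that c1_nonneg
      by (meson atMost_iff mult_left_mono order_trans)
    then have "norm (?p (Suc n) t - ?p n t) \<le> (D * contraction \<sigma> ^ n) * exp (\<sigma> * (\<tau> - t))"
      by (simp add: D_def mult_ac)
    then have "norm (?p (Suc n) t - ?p n t) * ?w t \<le> D * contraction \<sigma> ^ n"
      by (simp only: div_exp_le_iff)
    then show ?thesis by (simp add: mult.commute)
  qed
  \<comment> \<open>The iteration starts at zero, so the partial sums are the weighted iterates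
    themselves.\<close>
  have tele: "(\<Sum>i<n. ?d i t) = ?w t *\<^sub>R ?p n t" for n t
    unfolding scaleR_right.sum[symmetric] by (subst sum_lessThan_telescope) simp
  have "uniform_limit {..\<tau>} (\<lambda>n t. \<Sum>i<n. ?d i t) S sequentially"
    unfolding S_def
    by (rule Weierstrass_m_test[OF bound]) (auto intro!: summable_mult summable_geometric simp: contraction_sigma)
  then have unif: "uniform_limit {..\<tau>} (\<lambda>n t. ?w t *\<^sub>R ?p n t) S sequentially"
    unfolding tele .
  have p_cont: "continuous_on {..\<tau>} (?p n)" for n
    using picard_tempered[of \<tau> \<eta> n] by (simp add: tempered_def)
  have "continuous_on {..\<tau>} S"
    by (rule uniform_limit_theorem[OF _ unif]) (auto intro!: always_eventually continuous_intros p_cont)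
  then have z_cont: "continuous_on {..\<tau>} z"
    unfolding z_def by (intro continuous_intros)
  have close: "\<exists>N. \<forall>n\<ge>N. \<forall>t\<le>\<tau>. sn t (z t - ?p n t) \<le> e * exp (\<sigma> * (\<tau> - t))" if e: "e > 0" for e
  proof -
    \<comment> \<open>Only \<open>c\<^sub>2 \<ge> 0\<close> is at hand, so the division is by
      \<open>c\<^sub>2 + 1\<close>; the surplus is absorbed by
      \<open>c\<^sub>2 / (c\<^sub>2 + 1) \<le> 1\<close>.\<close>
    have "0 < e / (c\<^sub>2 + 1)" using e c2_nonneg by simp
    from uniform_limitD[OF unif this]
    obtain N where N: "\<And>n t. n \<ge> N \<Longrightarrow> t \<le> \<tau> \<Longrightarrow> norm (?w t *\<^sub>R ?p n t - S t) < e / (c\<^sub>2 + 1)"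
      by (auto simp: eventually_sequentially dist_norm)
    have "sn t (z t - ?p n t) \<le> e * exp (\<sigma> * (\<tau> - t))" if n: "n \<ge> N" and t: "t \<le> \<tau>" for n t
    proof -
      have inv: "exp (\<sigma> * (\<tau> - t)) * ?w t = 1" by (simp flip: exp_add)
      have "z t - ?p n t = exp (\<sigma> * (\<tau> - t)) *\<^sub>R (S t - ?w t *\<^sub>R ?p n t)"
        by (simp only: z_def scaleR_diff_right scaleR_scaleR inv scaleR_one)
      then have "norm (z t - ?p n t) = exp (\<sigma> * (\<tau> - t)) * norm (?w t *\<^sub>R ?p n t - S t)"
        by (simp add: norm_minus_commute)
      also have "\<dots> \<le> exp (\<sigma> * (\<tau> - t)) * (e / (c\<^sub>2 + 1))"
        using N[OF n t] by (intro mult_left_mono) auto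
      finally have "sn t (z t - ?p n t) \<le> c\<^sub>2 * (exp (\<sigma> * (\<tau> - t)) * (e / (c\<^sub>2 + 1)))"
        using sn_le_norm[of t "z t - ?p n t"] mult_left_mono[OF _ c2_nonneg] order_trans by blast
      also have "\<dots> = (c\<^sub>2 / (c\<^sub>2 + 1)) * (e * exp (\<sigma> * (\<tau> - t)))" by simp
      also have "\<dots> \<le> 1 * (e * exp (\<sigma> * (\<tau> - t)))"
        using c2_nonneg e by (intro mult_right_mono) auto
      finally show ?thesis by simp
    qed
    then show ?thesis by blast
  qed
  have z_temp: "tempered \<sigma> \<tau> z"
  proof -
    obtain N where N: "\<And>t. t \<le> \<tau> \<Longrightarrow> sn t (z t - ?p N t) \<le> 1 * exp (\<sigma> * (\<tau> - t))"
      using close[of 1] by auto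
    have "tempered \<sigma> \<tau> (\<lambda>t. z t - ?p N t)"
      by (rule tempered_if_sn_le[OF _ N]) (auto intro!: continuous_intros z_cont p_cont)
    from tempered_add[OF this picard_tempered[of \<tau> \<eta> N]] show ?thesis by simp
  qed
  have "z t = U t \<tau> \<eta> + green \<tau> (\<lambda>s. f s (z s)) t" if t: "t \<le> \<tau>" for t
  proof -
    let ?x = "z t - (U t \<tau> \<eta> + green \<tau> (\<lambda>s. f s (z s)) t)"
    let ?E = "exp (\<sigma> * (\<tau> - t))"
    have "sn t ?x \<le> 0 + e" if e: "e > 0" for e
    proof -
      define e' where "e' = e / (2 * ?E)"
      have e': "e' > 0" using e by (simp add: e'_def)
      obtain n where n: "\<And>s. s \<le> \<tau> \<Longrightarrow> sn s (z s - ?p n s) \<le> e' * exp (\<sigma> * (\<tau> - s))"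
          "sn t (z t - ?p (Suc n) t) \<le> e' * ?E"
        using close[OF e'] t by (metis le_SucI order_refl)
      have "sn t (green \<tau> (\<lambda>s. f s (?p n s)) t - green \<tau> (\<lambda>s. f s (z s)) t) \<le> contraction \<sigma> * e' * ?E"
      proof (rule sn_green_f_diff_le[OF picard_tempered z_temp t])
        show "sn s (?p n s - z s) \<le> e' * exp (\<sigma> * (\<tau> - s))" if "s \<le> \<tau>" for s
          using n(1)[OF that] sn_scale[of s "-1" "z s - ?p n s"] by simp
      qed (use e' in simp)
      also have "\<dots> \<le> 1 * e' * ?E"
        using contraction_sigma e' by (intro mult_right_mono) auto
      \<comment> \<open>The homogeneous term cancels: the defect of \<open>z\<close> is its distance
        to iterate \<open>n + 1\<close> plus the difference of the Green terms of iterate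
        \<open>n\<close> and of \<open>z\<close>. Each contributes at most half of
        \<open>e\<close>.\<close>
      finally have "sn t ?x \<le> e' * ?E + 1 * e' * ?E"
        using n(2) sn_add[of t "z t - ?p (Suc n) t" "green \<tau> (\<lambda>s. f s (?p n s)) t - green \<tau> (\<lambda>s. f s (z s)) t"]
        by (simp add: algebra_simps)
      then show ?thesis by (simp add: e'_def)
    qed
    then have "sn t ?x \<le> 0" by (rule field_le_epsilon)
    then have "norm ?x \<le> 0"
      using norm_le_sn[of ?x t] c1_nonneg by (metis mult_nonneg_nonpos order_trans)
    then show ?thesis by simp
  qed
  with z_temp show ?thesis unfolding solves_def by blast
qed

text \<open>Shows that the definite description denotes. Its conditions amount to
  \<open>solves\<close> together with extensionality, and extensionality turns uniqueness on the
  half-line into equality of functions.\<close>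

lemma solves_backward_solution:
  "solves \<tau> \<eta> (backward_solution L Q \<gamma> \<rho> \<Gamma> f \<sigma> \<tau> \<eta>)"
proof -
  let ?P = "\<lambda>z. z \<in> backward_space L Q \<gamma> \<rho> \<Gamma> \<sigma> \<tau> \<and>
        (\<forall>t\<le>\<tau>. z t = ext_process L Q t \<tau> (Q \<tau> \<eta>)
           - integral {t..\<tau>} (\<lambda>s. ext_process L Q t s (Q s (f s (z s))))
           + integral {..t} (\<lambda>s. L t s ((id_blinfun - Q s) (f s (z s)))))"
  have P_iff: "?P z \<longleftrightarrow> z \<in> extensional {..\<tau>} \<and> solves \<tau> \<eta> z" for z
  proof -
    have bdd: "bdd_above ((\<lambda>t. exp (\<sigma> * (t - \<tau>)) * sn t (z t)) ` {..\<tau>}) \<longleftrightarrow> tempered \<sigma> \<tau> z"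
      if c: "continuous_on {..\<tau>} z"
    proof -
      have eq: "(\<lambda>t. exp (\<sigma> * (t - \<tau>)) * sn t (z t)) = (\<lambda>t. sn t (z t) * exp (- \<sigma> * (\<tau> - t)))"
        by (auto simp: algebra_simps)
      show ?thesis
        unfolding eq
      proof
        assume "bdd_above ((\<lambda>t. sn t (z t) * exp (- \<sigma> * (\<tau> - t))) ` {..\<tau>})"
        then obtain K where "\<And>s. s \<le> \<tau> \<Longrightarrow> sn s (z s) * exp (- \<sigma> * (\<tau> - s)) \<le> K"
          unfolding bdd_above_def by auto
        then show "tempered \<sigma> \<tau> z"
          by (intro tempered_if_sn_le[OF c]) (simp only: div_exp_le_iff)
      qed (rule bdd_above_weighted_sn)
    qed
    have "continuous_on {..\<tau>} z" if "tempered \<sigma> \<tau> z" using that by (simp add: tempered_def)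
    then show ?thesis
      unfolding backward_space_def solves_def green_def U_def[symmetric] V_def[symmetric] split_norm_eq
      using bdd by (auto simp: algebra_simps)
  qed
  obtain z where z: "solves \<tau> \<eta> z" using solution_exists by blast
  \<comment> \<open>Both integrals see only times up to \<open>\<tau>\<close>, so the restriction is
    still a solution.\<close>
  let ?z = "restrict z {..\<tau>}"
  have "solves \<tau> \<eta> ?z"
    using z green_cong[of \<tau> "\<lambda>s. f s (?z s)" "\<lambda>s. f s (z s)"] tempered_cong[of \<tau> ?z z]
    by (simp add: solves_def)
  then have ex: "?P ?z" unfolding P_iff by simp
  have uniq: "y = ?z" if "?P y" for y
  proof (rule extensionalityI)
    show "y \<in> extensional {..\<tau>}" "?z \<in> extensional {..\<tau>}" using that by (auto simp: P_iff)
    fix t assume "t \<in> {..\<tau>}"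
    then have "sn t (y t - ?z t) \<le> 0"
      using solves_lipschitz[of \<tau> \<eta> y \<eta> ?z t] that ex unfolding P_iff by simp
    then have "norm (y t - ?z t) \<le> 0"
      using norm_le_sn[of "y t - ?z t" t] c1_nonneg by (metis mult_nonneg_nonpos order_trans)
    then show "y t = ?z t" by simp
  qed
  have "?P (THE z. ?P z)" by (rule theI[of ?P, OF ex uniq])
  then show ?thesis unfolding P_iff backward_solution_def by blast
qed

end

subsection \<open>Differentiability\<close>

locale smooth_splitting_system = splitting_system L Q M \<gamma> \<rho> \<Gamma> f L\<^sub>1 L\<^sub>2 \<sigma>
  for L :: "real \<Rightarrow> real \<Rightarrow> 'a::banach \<Rightarrow>\<^sub>L 'a" and Q M \<gamma> \<rho> \<Gamma> f L\<^sub>1 L\<^sub>2 \<sigma> +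
  fixes Df :: "real \<Rightarrow> 'a \<Rightarrow> 'a \<Rightarrow>\<^sub>L 'a"
  assumes f_deriv: "(f t has_derivative Df t u) (at u)"
begin

text \<open>Each seminorm is at most \<open>M\<close> times the norm, hence continuous, so its
  Lipschitz bound survives the passage from difference quotients to \<open>Df\<close>. Keeping
  exactly \<open>L\<^sub>1\<close> and \<open>L\<^sub>2\<close> lets the linearised part be
  contracted by the same constant as the nonlinear one.\<close>

lemma nN_Df: "nN t (Df t u h) \<le> L\<^sub>1 * sn t h"
  and nS_Df: "nS t (Df t u h) \<le> L\<^sub>2 * sn t h"
proof -
  let ?q = "\<lambda>n. real (Suc n) *\<^sub>R (f t (u + inverse (real (Suc n)) *\<^sub>R h) - f t u)"
  let ?x = "Df t u h"
  have q: "?q \<longlonglongrightarrow> ?x" by (rule has_derivative_difference_quotient[OF f_deriv])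
  have cl: "p ?x \<le> l * sn t h"
    if add: "\<And>x y. p (x + y) \<le> p x + p y" and scale: "\<And>c x. p (c *\<^sub>R x) \<le> \<bar>c\<bar> * p x"
      and M: "\<And>x. p x \<le> M * norm x" and l: "0 < l" and lip: "\<And>v w. p (f t v - f t w) \<le> l * sn t (v - w)"
    for p :: "'a \<Rightarrow> real" and l
  proof -
    have "p (?q n) \<le> l * sn t h" for n
    proof -
      have "p (?q n) \<le> real (Suc n) * p (f t (u + inverse (real (Suc n)) *\<^sub>R h) - f t u)"
        using scale[of "real (Suc n)"] by simp
      also have "\<dots> \<le> real (Suc n) * (l * sn t (inverse (real (Suc n)) *\<^sub>R h))"
        using lip[of "u + inverse (real (Suc n)) *\<^sub>R h" u] by (intro mult_left_mono) auto
      also have "\<dots> \<le> real (Suc n) * (l * (inverse (real (Suc n)) * sn t h))"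
        using sn_scale[of t "inverse (real (Suc n))" h] l by (intro mult_left_mono) auto
      also have "\<dots> = l * sn t h" by (simp del: of_nat_Suc)
      finally show ?thesis .
    qed
    then have "p ?x \<le> l * sn t h + M * norm (?x - ?q n)" for n
      using add[of "?q n" "?x - ?q n"] M[of "?x - ?q n"] by (smt (verit) add_diff_cancel_left' diff_add_cancel add.commute)
    moreover have "(\<lambda>n. l * sn t h + M * norm (?x - ?q n)) \<longlonglongrightarrow> l * sn t h + M * norm (?x - ?x)"
      by (intro tendsto_intros q)
    ultimately show ?thesis
      using LIMSEQ_le_const[of "\<lambda>n. l * sn t h + M * norm (?x - ?q n)" _ "p ?x"] by simp
  qed
  show "nN t ?x \<le> L\<^sub>1 * sn t h"
    by (rule cl[OF nN_add nN_scale nN_le_norm L1_pos nN_lipschitz])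
  show "nS t ?x \<le> L\<^sub>2 * sn t h"
    by (rule cl[OF nS_add nS_scale nS_le_norm L2_pos nS_lipschitz])
qed

text \<open>The gap condition is open, so it survives a slight increase of the exponent. The room
  between \<open>\<sigma>\<close> and \<open>\<mu>\<close> makes the remainders below integrable, so that dominated convergence
  replaces the missing uniformity in time of the differentiability of \<open>f\<close>.\<close>

lemma larger_exponent: obtains \<mu> where "\<sigma> < \<mu>" "\<mu> < \<gamma>" "contraction \<mu> < 1"
proof -
  \<comment> \<open>Raising the exponent shrinks the first argument of \<open>\<Gamma>\<close> and
    enlarges only the second. \<open>?d\<close> bounds \<open>contraction\<close> through the growth
    of the second argument alone and is continuous by inspection.\<close>
  let ?d = "\<lambda>\<mu>. contraction \<sigma> + (L\<^sub>2 / (\<gamma> - \<mu>) - L\<^sub>2 / (\<gamma> - \<sigma>)) * \<Gamma> (0, 1)"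
  have "(?d \<longlongrightarrow> contraction \<sigma> + (L\<^sub>2 / (\<gamma> - \<sigma>) - L\<^sub>2 / (\<gamma> - \<sigma>)) * \<Gamma> (0, 1)) (at_right \<sigma>)"
    using sigma by (intro tendsto_intros) auto
  then have "eventually (\<lambda>\<mu>. ?d \<mu> < 1) (at_right \<sigma>)"
    by (rule order_tendstoD(2)) (simp add: contraction_sigma)
  moreover have "eventually (\<lambda>\<mu>. \<mu> \<in> {\<sigma><..<\<gamma>}) (at_right \<sigma>)"
    using eventually_at_right_real[OF sigma(2)] .
  ultimately have "eventually (\<lambda>\<mu>. ?d \<mu> < 1 \<and> \<mu> \<in> {\<sigma><..<\<gamma>}) (at_right \<sigma>)"
    by (rule eventually_conj)
  then obtain \<mu> where \<mu>: "?d \<mu> < 1" "\<sigma> < \<mu>" "\<mu> < \<gamma>"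
    using eventually_happens'[OF trivial_limit_at_right_real] by fastforce
  let ?b = "L\<^sub>2 / (\<gamma> - \<mu>) - L\<^sub>2 / (\<gamma> - \<sigma>)"
  have b: "0 \<le> ?b" using \<mu> sigma L2_pos by (simp add: frac_le)
  have "contraction \<mu> \<le> \<Gamma> (L\<^sub>1 / (\<sigma> - \<rho>), L\<^sub>2 / (\<gamma> - \<sigma>) + ?b)"
    unfolding contraction_def using \<mu> sigma L1_pos L2_pos
    by (intro Gamma_mono) (auto intro!: divide_left_mono)
  also have "\<dots> \<le> contraction \<sigma> + \<Gamma> (0, ?b)"
    using Gamma_add[of "(L\<^sub>1 / (\<sigma> - \<rho>), L\<^sub>2 / (\<gamma> - \<sigma>))" "(0, ?b)"] by (simp add: contraction_def)
  also have "\<Gamma> (0, ?b) = ?b * \<Gamma> (0, 1)"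
    using Gamma_scale_pair[OF b, of 0 1] by simp
  finally show thesis using \<mu> by (intro that[of \<mu>]) auto
qed

section \<open>Increments of the solution and their Taylor remainders\<close>

definition sol :: "real \<Rightarrow> 'a \<Rightarrow> real \<Rightarrow> 'a" where
  "sol = backward_solution L Q \<gamma> \<rho> \<Gamma> f \<sigma>"

lemma solves_sol: "solves \<tau> \<eta> (sol \<tau> \<eta>)"
  unfolding sol_def by (rule solves_backward_solution)

lemma sol_tempered: "tempered \<sigma> \<tau> (sol \<tau> \<eta>)"
  using solves_sol by (simp add: solves_def)

lemma sol_continuous: "continuous_on {..\<tau>} (sol \<tau> \<eta>)"
  using sol_tempered by (simp add: tempered_def)

lemma sol_eq: "t \<le> \<tau> \<Longrightarrow> sol \<tau> \<eta> t = U t \<tau> \<eta> + green \<tau> (\<lambda>s. f s (sol \<tau> \<eta> s)) t"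
  using solves_sol unfolding solves_def by blast

definition incr :: "real \<Rightarrow> 'a \<Rightarrow> 'a \<Rightarrow> real \<Rightarrow> 'a" where
  "incr \<tau> \<eta> h s = sol \<tau> (\<eta> + h) s - sol \<tau> \<eta> s"

definition f_incr :: "real \<Rightarrow> 'a \<Rightarrow> 'a \<Rightarrow> real \<Rightarrow> 'a" where
  "f_incr \<tau> \<eta> h s = f s (sol \<tau> (\<eta> + h) s) - f s (sol \<tau> \<eta> s)"

definition remainder :: "real \<Rightarrow> 'a \<Rightarrow> 'a \<Rightarrow> real \<Rightarrow> 'a" where
  "remainder \<tau> \<eta> h s = f_incr \<tau> \<eta> h s - Df s (sol \<tau> \<eta> s) (incr \<tau> \<eta> h s)"

lemma incr_zero [simp]: "incr \<tau> \<eta> 0 s = 0"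
  by (simp add: incr_def)

lemma incr_tempered: "tempered \<sigma> \<tau> (incr \<tau> \<eta> h)"
  unfolding incr_def[abs_def] by (intro tempered_diff sol_tempered)

lemma f_incr_tempered: "tempered \<sigma> \<tau> (f_incr \<tau> \<eta> h)"
  unfolding f_incr_def[abs_def] by (intro tempered_diff f_tempered sol_tempered)

lemma incr_eq: "t \<le> \<tau> \<Longrightarrow> incr \<tau> \<eta> h t = U t \<tau> h + green \<tau> (f_incr \<tau> \<eta> h) t"
  unfolding f_incr_def[abs_def]
  by (simp add: incr_def sol_eq[of t \<tau>] linear_add[OF linear_U]
      green_diff[OF f_tempered[OF sol_tempered] f_tempered[OF sol_tempered] sigma(2)])

definition C\<^sub>i :: real where "C\<^sub>i = c\<^sub>1 * C\<^sub>z"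
definition C\<^sub>f :: real where "C\<^sub>f = (L\<^sub>1 + L\<^sub>2) * c\<^sub>2"

lemma Ci_nonneg: "0 \<le> C\<^sub>i" and Cf_nonneg: "0 \<le> C\<^sub>f"
  using c1_nonneg c2_nonneg M_ge_1 contraction_sigma L1_pos L2_pos
  by (auto simp: C\<^sub>i_def C\<^sub>f_def C\<^sub>z_def)

lemma norm_incr_le: "s \<le> \<tau> \<Longrightarrow> norm (incr \<tau> \<eta> h s) \<le> C\<^sub>i * norm h * exp (\<sigma> * (\<tau> - s))"
  using solves_lipschitz[OF solves_sol solves_sol, of s \<tau> "\<eta> + h" \<eta>]
    norm_le_sn[of "incr \<tau> \<eta> h s" s] mult_left_mono[OF _ c1_nonneg, of "sn s (incr \<tau> \<eta> h s)"]
  by (fastforce simp: incr_def C\<^sub>i_def mult_ac)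

lemma norm_f_incr_le: "norm (f_incr \<tau> \<eta> h s) \<le> C\<^sub>f * norm (incr \<tau> \<eta> h s)"
  using f_lipschitz by (simp add: f_incr_def incr_def C\<^sub>f_def)

definition weighted_remainder :: "real \<Rightarrow> real \<Rightarrow> 'a \<Rightarrow> 'a \<Rightarrow> real \<Rightarrow> real" where
  "weighted_remainder \<mu> \<tau> \<eta> h s = norm (remainder \<tau> \<eta> h s) * exp (- \<mu> * (\<tau> - s))"

text \<open>The weighted L1 size of the remainder along the whole past. It is the forcing constant
  in \<open>sn_green_le\<close> and, up to a factor, the nonlinearity measure in
  \<open>has_derivative_if_almost_linear\<close>.\<close>

definition total_remainder :: "real \<Rightarrow> real \<Rightarrow> 'a \<Rightarrow> 'a \<Rightarrow> real" where
  "total_remainder \<mu> \<tau> \<eta> h = integral {..\<tau>} (weighted_remainder \<mu> \<tau> \<eta> h)"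

lemma exp_weight_integrable:
  assumes "\<sigma> < \<mu>"
  shows "(\<lambda>s. K * (exp (\<sigma> * (\<tau> - s)) * exp (- \<mu> * (\<tau> - s)))) integrable_on {..\<tau>}"
proof -
  have "((\<lambda>s. exp ((\<mu> - \<sigma>) * (s - \<tau>))) has_integral 1 / (\<mu> - \<sigma>)) {..\<tau>}"
    using assms by (intro has_integral_exp_atMost) simp
  then have "(\<lambda>s. exp ((\<mu> - \<sigma>) * (s - \<tau>))) integrable_on {..\<tau>}" by blast
  moreover have "exp ((\<mu> - \<sigma>) * (s - \<tau>)) = exp (\<sigma> * (\<tau> - s)) * exp (- \<mu> * (\<tau> - s))" for s
    by (simp add: algebra_simps flip: exp_add)
  ultimately have "(\<lambda>s. exp (\<sigma> * (\<tau> - s)) * exp (- \<mu> * (\<tau> - s))) integrable_on {..\<tau>}" by simp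
  then show ?thesis by (rule integrable_on_mult_right)
qed

text \<open>The term with \<open>Df\<close> may depend badly on time. Replacing it by difference
  quotients of \<open>f\<close> gives continuous functions \<open>?R n\<close> with a common
  integrable majorant, so dominated convergence for real functions applies. The factor 2 counts
  \<open>f_incr\<close> and the quotient, each bounded by \<open>C\<^sub>f\<close> times the
  increment.\<close>

lemma weighted_remainder_props:
  assumes \<mu>: "\<sigma> < \<mu>"
  shows weighted_remainder_le: "s \<le> \<tau> \<Longrightarrow> weighted_remainder \<mu> \<tau> \<eta> h s
      \<le> (2 * C\<^sub>f * C\<^sub>i * norm h) * (exp (\<sigma> * (\<tau> - s)) * exp (- \<mu> * (\<tau> - s)))"
    and weighted_remainder_integrable: "weighted_remainder \<mu> \<tau> \<eta> h integrable_on {..\<tau>}"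
proof -
  let ?z = "sol \<tau> \<eta>" and ?\<delta> = "incr \<tau> \<eta> h"
  let ?w = "\<lambda>s. exp (- \<mu> * (\<tau> - s))"
  let ?H = "\<lambda>s. (2 * C\<^sub>f * C\<^sub>i * norm h) * (exp (\<sigma> * (\<tau> - s)) * ?w s)"
  let ?q = "\<lambda>n s. real (Suc n) *\<^sub>R (f s (?z s + inverse (real (Suc n)) *\<^sub>R ?\<delta> s) - f s (?z s))"
  let ?R = "\<lambda>n s. norm (f_incr \<tau> \<eta> h s - ?q n s) * ?w s"
  have \<delta>_cont: "continuous_on {..\<tau>} ?\<delta>" and fi_cont: "continuous_on {..\<tau>} (f_incr \<tau> \<eta> h)"
    using incr_tempered f_incr_tempered by (auto simp: tempered_def)
  have R_cont: "continuous_on {..\<tau>} (?R n)" for n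
    by (intro continuous_intros fi_cont f_comp_continuous \<delta>_cont sol_continuous)
  have R_le: "?R n s \<le> ?H s" if s: "s \<le> \<tau>" for n s
  proof -
    have "norm (?q n s) \<le> real (Suc n) * (C\<^sub>f * norm (inverse (real (Suc n)) *\<^sub>R ?\<delta> s))"
      unfolding norm_scaleR abs_of_nat C\<^sub>f_def
      using f_lipschitz[of s "?z s + inverse (real (Suc n)) *\<^sub>R ?\<delta> s" "?z s"]
      by (intro mult_left_mono) auto
    also have "\<dots> = C\<^sub>f * norm (?\<delta> s)" by simp
    finally have "norm (f_incr \<tau> \<eta> h s - ?q n s) \<le> 2 * C\<^sub>f * norm (?\<delta> s)"
      using norm_triangle_ineq4[of "f_incr \<tau> \<eta> h s" "?q n s"] norm_f_incr_le[of \<tau> \<eta> h s] by linarith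
    also have "\<dots> \<le> 2 * C\<^sub>f * (C\<^sub>i * norm h * exp (\<sigma> * (\<tau> - s)))"
      using Cf_nonneg norm_incr_le[OF s] by (intro mult_left_mono) auto
    finally have "?R n s \<le> 2 * C\<^sub>f * (C\<^sub>i * norm h * exp (\<sigma> * (\<tau> - s))) * ?w s"
      by (intro mult_right_mono) auto
    then show ?thesis by (simp only: mult_ac)
  qed
  have R_abs: "norm (?R n s) = ?R n s" for n s by (simp del: of_nat_Suc)
  have R_int: "?R n integrable_on {..\<tau>}" for n
    by (rule continuous_dominated_integrable[OF R_cont
          exp_weight_integrable[OF \<mu>, of "2 * C\<^sub>f * C\<^sub>i * norm h" \<tau>]])
      (simp only: R_abs R_le)
  have R_lim: "(\<lambda>n. ?R n s) \<longlonglongrightarrow> weighted_remainder \<mu> \<tau> \<eta> h s" for s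
    unfolding weighted_remainder_def remainder_def
    by (intro tendsto_intros has_derivative_difference_quotient[OF f_deriv])
  show "weighted_remainder \<mu> \<tau> \<eta> h integrable_on {..\<tau>}"
    by (rule dominated_convergence(1)[OF R_int
          exp_weight_integrable[OF \<mu>, of "2 * C\<^sub>f * C\<^sub>i * norm h" \<tau>] _ R_lim])
      (simp only: R_abs R_le atMost_iff)
  show "weighted_remainder \<mu> \<tau> \<eta> h s \<le> ?H s" if "s \<le> \<tau>" for s
    by (rule LIMSEQ_le_const2[OF R_lim]) (use R_le[OF that] in blast)
qed

lemma weighted_remainder_nonneg: "0 \<le> weighted_remainder \<mu> \<tau> \<eta> h s"
  by (simp add: weighted_remainder_def)

text \<open>At a fixed time the remainder is small relative to the increment of the solution, which
  is O(|h|). The quotient is taken by the norm of \<open>h n\<close> because the increment itself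
  may vanish.\<close>

lemma remainder_small:
  assumes s: "s \<le> \<tau>" and h: "h \<longlonglongrightarrow> 0" "\<And>n. h n \<noteq> 0"
  shows "(\<lambda>n. norm (remainder \<tau> \<eta> (h n) s) / norm (h n)) \<longlonglongrightarrow> 0"
proof (rule LIMSEQ_I)
  fix e :: real assume e: "0 < e"
  \<comment> \<open>The added \<open>1\<close> makes \<open>B\<close> positive, so that it can be
    divided by.\<close>
  define B where "B = C\<^sub>i * exp (\<sigma> * (\<tau> - s)) + 1"
  have B: "0 < B" using Ci_nonneg by (simp add: B_def add_nonneg_pos)
  have le_B: "norm (incr \<tau> \<eta> (h n) s) \<le> B * norm (h n)" for n
  proof -
    have "norm (incr \<tau> \<eta> (h n) s) \<le> C\<^sub>i * exp (\<sigma> * (\<tau> - s)) * norm (h n)"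
      using norm_incr_le[OF s, of \<eta> "h n"] by (simp only: mult_ac)
    also have "\<dots> \<le> B * norm (h n)" by (rule mult_right_mono) (simp_all add: B_def)
    finally show ?thesis .
  qed
  have "0 < e / (2 * B)" using e B by simp
  then obtain d where d: "d > 0" "\<And>y. norm (y - sol \<tau> \<eta> s) < d \<Longrightarrow>
      norm (f s y - f s (sol \<tau> \<eta> s) - Df s (sol \<tau> \<eta> s) (y - sol \<tau> \<eta> s)) \<le> e / (2 * B) * norm (y - sol \<tau> \<eta> s)"
    using f_deriv[of s "sol \<tau> \<eta> s"] unfolding has_derivative_at_alt by blast
  have "eventually (\<lambda>n. norm (h n) < d / B) sequentially"
    using order_tendstoD(2)[OF tendsto_norm_zero[OF h(1)], of "d / B"] d(1) B by simp
  then obtain N where N: "\<And>n. n \<ge> N \<Longrightarrow> norm (h n) < d / B"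
    by (auto simp: eventually_sequentially)
  have "norm (norm (remainder \<tau> \<eta> (h n) s) / norm (h n) - 0) < e" if n: "n \<ge> N" for n
  proof -
    have "norm (incr \<tau> \<eta> (h n) s) < d"
      using le_B[of n] N[OF n] B by (simp add: pos_less_divide_eq mult.commute)
    then have "norm (remainder \<tau> \<eta> (h n) s) \<le> e / (2 * B) * norm (incr \<tau> \<eta> (h n) s)"
      using d(2)[of "sol \<tau> (\<eta> + h n) s"] by (simp add: remainder_def f_incr_def incr_def)
    also have "\<dots> \<le> e / (2 * B) * (B * norm (h n))"
      using e B le_B by (intro mult_left_mono) auto
    also have "\<dots> = e / 2 * norm (h n)" using B by simp
    finally have "norm (remainder \<tau> \<eta> (h n) s) / norm (h n) \<le> e / 2"
      using h(2) by (simp add: pos_divide_le_eq)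
    also have "\<dots> < e" using e by simp
    finally show ?thesis by simp
  qed
  then show "\<exists>N. \<forall>n\<ge>N. norm (norm (remainder \<tau> \<eta> (h n) s) / norm (h n) - 0) < e" by blast
qed

text \<open>Division by the norm of \<open>h\<close> leaves a majorant independent of
  \<open>h\<close>, integrable because \<open>\<sigma> < \<mu>\<close>. The sequences tending to
  zero are arbitrary, so the smallness is uniform over directions.\<close>

lemma total_remainder_small:
  assumes \<mu>: "\<sigma> < \<mu>"
  shows "((\<lambda>h. total_remainder \<mu> \<tau> \<eta> h / norm h) \<longlongrightarrow> 0) (at 0)"
  unfolding tendsto_at_iff_sequentially
proof (intro allI impI)
  fix h :: "nat \<Rightarrow> 'a" assume "\<forall>i. h i \<in> UNIV - {0}" and h: "h \<longlonglongrightarrow> 0"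
  then have h0: "h i \<noteq> 0" for i by simp
  let ?k = "2 * C\<^sub>f * C\<^sub>i"
  let ?R = "\<lambda>i s. weighted_remainder \<mu> \<tau> \<eta> (h i) s / norm (h i)"
  have "(\<lambda>i. integral {..\<tau>} (?R i)) \<longlonglongrightarrow> integral {..\<tau>} (\<lambda>s. 0)"
  proof (rule dominated_convergence(2)[OF _ exp_weight_integrable[OF \<mu>, of ?k]])
    show "?R i integrable_on {..\<tau>}" for i
      unfolding divide_inverse by (intro integrable_on_mult_left weighted_remainder_integrable \<mu>)
    fix s assume s: "s \<in> {..\<tau>}"
    show "norm (?R i s) \<le> ?k * (exp (\<sigma> * (\<tau> - s)) * exp (- \<mu> * (\<tau> - s)))" for i
    proof -
      have "weighted_remainder \<mu> \<tau> \<eta> (h i) s \<le> ?k * (exp (\<sigma> * (\<tau> - s)) * exp (- \<mu> * (\<tau> - s))) * norm (h i)"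
        using weighted_remainder_le[OF \<mu>, of s \<tau> \<eta> "h i"] s by (simp only: mult_ac atMost_iff)
      then show ?thesis
        using h0[of i] weighted_remainder_nonneg[of \<mu> \<tau> \<eta> "h i" s] by (simp add: pos_divide_le_eq)
    qed
    have "(\<lambda>i. norm (remainder \<tau> \<eta> (h i) s) / norm (h i) * exp (- \<mu> * (\<tau> - s))) \<longlonglongrightarrow> 0"
      by (rule tendsto_mult_left_zero[OF remainder_small[OF _ h h0]]) (use s in simp)
    then show "(\<lambda>i. ?R i s) \<longlonglongrightarrow> 0" by (simp add: weighted_remainder_def)
  qed
  then show "((\<lambda>h. total_remainder \<mu> \<tau> \<eta> h / norm h) \<circ> h) \<longlonglongrightarrow> 0"
    by (simp add: total_remainder_def comp_def)
qed

text \<open>The combination \<open>?y\<close> of increments is the Green image of the same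
  combination \<open>?g\<close> of increments of \<open>f\<close>. Up to remainders
  \<open>?g\<close> is \<open>Df\<close> applied to \<open>?y\<close>, so the contraction bounds
  \<open>?y\<close> by the remainders alone. The factor \<open>M\<close> in the result comes from
  measuring remainders in the norm of \<open>X\<close> before they enter \<open>nN\<close> and
  \<open>nS\<close>.\<close>

lemma incr_combination_le:
  assumes \<mu>: "\<sigma> < \<mu>" "\<mu> < \<gamma>" "contraction \<mu> < 1" and t: "t \<le> \<tau>"
    and zero: "a *\<^sub>R u + b *\<^sub>R v + c *\<^sub>R w = 0"
  shows "sn t (a *\<^sub>R incr \<tau> \<eta> u t + b *\<^sub>R incr \<tau> \<eta> v t + c *\<^sub>R incr \<tau> \<eta> w t)
    \<le> \<Gamma> (1, 1) * (M * (\<bar>a\<bar> * total_remainder \<mu> \<tau> \<eta> u + \<bar>b\<bar> * total_remainder \<mu> \<tau> \<eta> v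
          + \<bar>c\<bar> * total_remainder \<mu> \<tau> \<eta> w)) / (1 - contraction \<mu>) * exp (\<mu> * (\<tau> - t))"
proof -
  let ?y = "\<lambda>s. a *\<^sub>R incr \<tau> \<eta> u s + b *\<^sub>R incr \<tau> \<eta> v s + c *\<^sub>R incr \<tau> \<eta> w s"
  let ?g = "\<lambda>s. a *\<^sub>R f_incr \<tau> \<eta> u s + b *\<^sub>R f_incr \<tau> \<eta> v s + c *\<^sub>R f_incr \<tau> \<eta> w s"
  let ?r = "\<lambda>s. a *\<^sub>R remainder \<tau> \<eta> u s + b *\<^sub>R remainder \<tau> \<eta> v s + c *\<^sub>R remainder \<tau> \<eta> w s"
  let ?m = "\<lambda>s. M * (\<bar>a\<bar> * norm (remainder \<tau> \<eta> u s) + \<bar>b\<bar> * norm (remainder \<tau> \<eta> v s)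
    + \<bar>c\<bar> * norm (remainder \<tau> \<eta> w s))"
  let ?J = "M * (\<bar>a\<bar> * total_remainder \<mu> \<tau> \<eta> u + \<bar>b\<bar> * total_remainder \<mu> \<tau> \<eta> v
    + \<bar>c\<bar> * total_remainder \<mu> \<tau> \<eta> w)"
  let ?\<phi> = "\<lambda>s. sn s (?y s) * exp (- \<mu> * (\<tau> - s))"
  note sc = tempered_scale[OF f_incr_tempered[of \<tau> \<eta>]]
  have g_temp: "tempered \<mu> \<tau> ?g"
    by (rule tempered_mono[of \<sigma>]) (use \<mu>(1) in \<open>auto intro!: tempered_add sc\<close>)
  have y_temp: "tempered \<mu> \<tau> ?y"
    by (rule tempered_mono[of \<sigma>])
      (use \<mu>(1) in \<open>auto intro!: tempered_add tempered_scale incr_tempered\<close>)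
  have y_eq: "?y s = green \<tau> ?g s" if s: "s \<le> \<tau>" for s
  proof -
    have "green \<tau> ?g s = a *\<^sub>R green \<tau> (f_incr \<tau> \<eta> u) s + b *\<^sub>R green \<tau> (f_incr \<tau> \<eta> v) s
        + c *\<^sub>R green \<tau> (f_incr \<tau> \<eta> w) s"
      using green_add[OF tempered_add[OF sc sc] sc sigma(2) s] green_add[OF sc sc sigma(2) s]
      by (simp add: green_scale[OF s])
    moreover have "a *\<^sub>R U s \<tau> u + b *\<^sub>R U s \<tau> v + c *\<^sub>R U s \<tau> w = U s \<tau> (a *\<^sub>R u + b *\<^sub>R v + c *\<^sub>R w)"
      by (simp add: linear_add[OF linear_U[OF s]] linear_scale[OF linear_U[OF s]])
    \<comment> \<open>This is where the linear relation between the vectors acts: it removes the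
      homogeneous term.\<close>
    moreover have "U s \<tau> (a *\<^sub>R u + b *\<^sub>R v + c *\<^sub>R w) = 0" using zero s by simp
    ultimately show ?thesis
      by (simp add: incr_eq[OF s] scaleR_add_right algebra_simps)
  qed
  \<comment> \<open>All three increments are expanded at the same base solution, so a single linear
    map \<open>Df s (sol \<tau> \<eta> s)\<close> acts on the whole combination.\<close>
  have g_eq: "?g s = Df s (sol \<tau> \<eta> s) (?y s) + ?r s" for s
    by (simp add: remainder_def blinfun.add_right blinfun.scaleR_right algebra_simps)
  have r_le: "M * norm (?r s) \<le> ?m s" for s
    using M_ge_1 by (intro mult_left_mono norm_triangle_le norm_triangle_mono add_mono) auto
  have mJ: "((\<lambda>s. ?m s * exp (- \<mu> * (\<tau> - s))) has_integral ?J) {..\<tau>}"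
  proof -
    have i: "(weighted_remainder \<mu> \<tau> \<eta> h has_integral total_remainder \<mu> \<tau> \<eta> h) {..\<tau>}" for h
      unfolding total_remainder_def by (intro integrable_integral weighted_remainder_integrable \<mu>)
    have "((\<lambda>s. M * (\<bar>a\<bar> * weighted_remainder \<mu> \<tau> \<eta> u s + \<bar>b\<bar> * weighted_remainder \<mu> \<tau> \<eta> v s
        + \<bar>c\<bar> * weighted_remainder \<mu> \<tau> \<eta> w s)) has_integral ?J) {..\<tau>}"
      by (intro has_integral_mult_right has_integral_add i)
    then show ?thesis
      by (rule has_integral_eq[rotated]) (simp add: weighted_remainder_def algebra_simps)
  qed
  have "?\<phi> t \<le> (\<Gamma> (1, 1) * ?J) / (1 - contraction \<mu>)"
  proof (rule bound_of_self_improvement[where S = "{..\<tau>}" and \<phi> = ?\<phi>])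
    show "bdd_above (?\<phi> ` {..\<tau>})" by (rule bdd_above_weighted_sn[OF y_temp])
    show "contraction \<mu> < 1" by (rule \<mu>)
    show "t \<in> {..\<tau>}" using t by simp
    show "0 \<le> ?\<phi> s" for s by simp
    fix K s assume K: "0 \<le> K" and le: "\<And>s. s \<in> {..\<tau>} \<Longrightarrow> ?\<phi> s \<le> K" and s: "s \<in> {..\<tau>}"
    then have le': "sn s (?y s) \<le> K * exp (\<mu> * (\<tau> - s))" if "s \<le> \<tau>" for s
      using that by (simp only: div_exp_le_iff atMost_iff)
    have "sn s (green \<tau> ?g s) \<le> (contraction \<mu> * K + \<Gamma> (1, 1) * ?J) * exp (\<mu> * (\<tau> - s))"
    proof (rule sn_green_le[OF g_temp _ \<mu>(2) _ K _ mJ])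
      show "\<rho> < \<mu>" using sigma \<mu> by simp
      show "s \<le> \<tau>" using s by simp
      show "0 \<le> ?m s" for s using M_ge_1 by simp
      fix s assume s: "s \<le> \<tau>"
      have "nN s (?g s) \<le> L\<^sub>1 * sn s (?y s) + M * norm (?r s)"
        unfolding g_eq by (rule order_trans[OF nN_add add_mono[OF nN_Df nN_le_norm]])
      then show "nN s (?g s) \<le> L\<^sub>1 * (K * exp (\<mu> * (\<tau> - s))) + ?m s"
        using mult_left_mono[OF le'[OF s] less_imp_le[OF L1_pos]] r_le[of s] by linarith
      have "nS s (?g s) \<le> L\<^sub>2 * sn s (?y s) + M * norm (?r s)"
        unfolding g_eq by (rule order_trans[OF nS_add add_mono[OF nS_Df nS_le_norm]])
      then show "nS s (?g s) \<le> L\<^sub>2 * (K * exp (\<mu> * (\<tau> - s))) + ?m s"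
        using mult_left_mono[OF le'[OF s] less_imp_le[OF L2_pos]] r_le[of s] by linarith
    qed
    then show "?\<phi> s \<le> contraction \<mu> * K + \<Gamma> (1, 1) * ?J"
      using y_eq[of s] s by (simp only: div_exp_le_iff atMost_iff)
  qed
  then show ?thesis by (simp only: div_exp_le_iff)
qed

lemma sol_differentiable:
  assumes t: "t \<le> \<tau>"
  shows "(\<lambda>\<zeta>. sol \<tau> \<zeta> t) differentiable (at \<eta>)"
proof -
  obtain \<mu> where \<mu>: "\<sigma> < \<mu>" "\<mu> < \<gamma>" "contraction \<mu> < 1" by (rule larger_exponent)
  \<comment> \<open>Collects the factors of \<open>incr_combination_le\<close> and
    \<open>c\<^sub>1\<close> for the return to the norm of \<open>X\<close>. At a fixed
    \<open>t\<close> the weight is just a constant, so the change of exponent leaves no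
    trace.\<close>
  define k where "k = c\<^sub>1 * (\<Gamma> (1, 1) * M / (1 - contraction \<mu>) * exp (\<mu> * (\<tau> - t)))"
  let ?J = "\<lambda>h. k * total_remainder \<mu> \<tau> \<eta> h"
  obtain D where "((\<lambda>\<zeta>. sol \<tau> \<zeta> t) has_derivative D) (at \<eta>)"
  proof (rule has_derivative_if_almost_linear[where J = ?J and F = "\<lambda>\<zeta>. sol \<tau> \<zeta> t" and x = \<eta>])
    show "((\<lambda>h. ?J h / norm h) \<longlongrightarrow> 0) (at 0)"
      using tendsto_mult_right_zero[OF total_remainder_small[OF \<mu>(1)], of k] by simp
    have "weighted_remainder \<mu> \<tau> \<eta> 0 = (\<lambda>s. 0)"
      by (simp add: weighted_remainder_def[abs_def] remainder_def f_incr_def)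
    then show "?J 0 = 0" by (simp add: total_remainder_def)
    show "norm (sol \<tau> (\<eta> + h) t - sol \<tau> \<eta> t) \<le> (C\<^sub>i * exp (\<sigma> * (\<tau> - t))) * norm h" for h
      using norm_incr_le[OF t, of \<eta> h] by (simp add: incr_def mult_ac)
    fix a b c :: real and u v w :: 'a assume "a *\<^sub>R u + b *\<^sub>R v + c *\<^sub>R w = 0"
    from mult_left_mono[OF incr_combination_le[OF \<mu> t this, of \<eta>] c1_nonneg]
    have "norm (a *\<^sub>R incr \<tau> \<eta> u t + b *\<^sub>R incr \<tau> \<eta> v t + c *\<^sub>R incr \<tau> \<eta> w t)
      \<le> c\<^sub>1 * (\<Gamma> (1, 1) * (M * (\<bar>a\<bar> * total_remainder \<mu> \<tau> \<eta> u + \<bar>b\<bar> * total_remainder \<mu> \<tau> \<eta> v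
          + \<bar>c\<bar> * total_remainder \<mu> \<tau> \<eta> w)) / (1 - contraction \<mu>) * exp (\<mu> * (\<tau> - t)))"
      by (rule order_trans[OF norm_le_sn])
    also have "\<dots> = \<bar>a\<bar> * ?J u + \<bar>b\<bar> * ?J v + \<bar>c\<bar> * ?J w"
      by (simp add: k_def divide_inverse algebra_simps)
    finally show "norm (a *\<^sub>R (sol \<tau> (\<eta> + u) t - sol \<tau> \<eta> t) + b *\<^sub>R (sol \<tau> (\<eta> + v) t - sol \<tau> \<eta> t)
        + c *\<^sub>R (sol \<tau> (\<eta> + w) t - sol \<tau> \<eta> t)) \<le> \<bar>a\<bar> * ?J u + \<bar>b\<bar> * ?J v + \<bar>c\<bar> * ?J w"
      by (simp add: incr_def)
  qed
  then show ?thesis by (rule differentiableI)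
qed

section \<open>The derivative of the manifold map\<close>

lemma complement_sol: "(id_blinfun - Q \<tau>) (sol \<tau> \<eta> \<tau>) = integral {..\<tau>} (\<lambda>s. V \<tau> s (f s (sol \<tau> \<eta> s)))"
proof -
  have "(id_blinfun - Q \<tau>) (sol \<tau> \<eta> \<tau>) = V \<tau> \<tau> (sol \<tau> \<eta> \<tau>)" by (simp add: V_def)
  also have "\<dots> = V \<tau> \<tau> (green \<tau> (\<lambda>s. f s (sol \<tau> \<eta> s)) \<tau>)"
    using V_U[of \<tau> \<tau> \<tau> \<eta>] by (subst sol_eq) (simp_all add: linear_add[OF bounded_linear.linear[OF bounded_linear_V]])
  also have "\<dots> = integral {..\<tau>} (\<lambda>s. V \<tau> s (f s (sol \<tau> \<eta> s)))"
    by (rule V_green[OF f_tempered[OF sol_tempered] sigma(2)]) simp_all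
  finally show ?thesis .
qed

text \<open>Differentiability is inherited from the solution at time \<open>\<tau>\<close> through
  the bounded projection. For the formula, difference quotients of the integral representation
  converge both to the derivative and, by dominated convergence, to the integral of the limit. This
  also yields integrability of that limit, which need not be continuous in time.\<close>

lemma complement_sol_derivative:
  defines "S \<equiv> \<lambda>\<tau> \<zeta>. (id_blinfun - Q \<tau>) (sol \<tau> \<zeta> \<tau>)"
  shows "S \<tau> differentiable (at \<eta>)"
    and "((\<lambda>s. V \<tau> s (Df s (sol \<tau> \<eta> s) (frechet_derivative (\<lambda>\<zeta>. sol \<tau> \<zeta> s) (at \<eta>) \<xi>)))
      has_integral frechet_derivative (S \<tau>) (at \<eta>) \<xi>) {..\<tau>}"
proof -
  let ?D = "\<lambda>s. frechet_derivative (\<lambda>\<zeta>. sol \<tau> \<zeta> s) (at \<eta>)"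
  have D: "((\<lambda>\<zeta>. sol \<tau> \<zeta> s) has_derivative ?D s) (at \<eta>)" if "s \<le> \<tau>" for s
    using sol_differentiable[OF that] unfolding frechet_derivative_works .
  have "(S \<tau> has_derivative (\<lambda>\<xi>. (id_blinfun - Q \<tau>) (?D \<tau> \<xi>))) (at \<eta>)"
    unfolding S_def by (rule bounded_linear.has_derivative[OF blinfun.bounded_linear_right D]) simp
  then show diff: "S \<tau> differentiable (at \<eta>)" by (rule differentiableI)
  let ?h = "\<lambda>n. inverse (real (Suc n)) *\<^sub>R \<xi>"
  let ?q = "\<lambda>n s. real (Suc n) *\<^sub>R f_incr \<tau> \<eta> (?h n) s"
  let ?g = "\<lambda>s. V \<tau> s (Df s (sol \<tau> \<eta> s) (?D s \<xi>))"
  have q_temp: "tempered \<sigma> \<tau> (?q n)" for n by (intro tempered_scale f_incr_tempered)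
  have q_le: "norm (?q n s) \<le> C\<^sub>f * C\<^sub>i * norm \<xi> * exp (\<sigma> * (\<tau> - s))" if s: "s \<le> \<tau>" for n s
  proof -
    have "norm (f_incr \<tau> \<eta> (?h n) s) \<le> C\<^sub>f * (C\<^sub>i * norm (?h n) * exp (\<sigma> * (\<tau> - s)))"
      by (rule order_trans[OF norm_f_incr_le mult_left_mono[OF norm_incr_le[OF s] Cf_nonneg]])
    then have "norm (?q n s) \<le> real (Suc n) * (C\<^sub>f * (C\<^sub>i * norm (?h n) * exp (\<sigma> * (\<tau> - s))))"
      unfolding norm_scaleR abs_of_nat by (intro mult_left_mono) auto
    also have "\<dots> = C\<^sub>f * C\<^sub>i * norm \<xi> * exp (\<sigma> * (\<tau> - s))" by (simp del: of_nat_Suc)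
    finally show ?thesis .
  qed
  have cont: "continuous_on {..\<tau>} (\<lambda>s. V \<tau> s (?q n s))" for n
    by (rule V_continuous) (use q_temp in \<open>simp add: tempered_def\<close>)
  have dom: "norm (V \<tau> s (?q n s)) \<le> M * (C\<^sub>f * C\<^sub>i * norm \<xi>) * (exp (\<sigma> * (\<tau> - s)) * exp (- \<gamma> * (\<tau> - s)))"
    if s: "s \<le> \<tau>" for n s
  proof -
    have "norm (V \<tau> s (?q n s)) \<le> M * exp (- \<gamma> * (\<tau> - s)) * (C\<^sub>f * C\<^sub>i * norm \<xi> * exp (\<sigma> * (\<tau> - s)))"
      by (rule order_trans[OF V_bound[OF s] mult_left_mono[OF q_le[OF s]]]) (use M_ge_1 in simp)
    then show ?thesis by (simp only: mult_ac)
  qed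
  have lim: "(\<lambda>n. V \<tau> s (?q n s)) \<longlonglongrightarrow> ?g s" if s: "s \<le> \<tau>" for s
  proof (rule bounded_linear.tendsto[OF bounded_linear_V])
    have "((\<lambda>\<zeta>. f s (sol \<tau> \<zeta> s)) has_derivative (\<lambda>\<xi>. Df s (sol \<tau> \<eta> s) (?D s \<xi>))) (at \<eta>)"
      by (rule has_derivative_compose[OF D[OF s] f_deriv])
    from has_derivative_difference_quotient[OF this, of \<xi>]
    show "(\<lambda>n. ?q n s) \<longlonglongrightarrow> Df s (sol \<tau> \<eta> s) (?D s \<xi>)" by (simp add: f_incr_def)
  qed
  \<comment> \<open>Here the decay rate \<open>\<gamma>\<close> of \<open>V\<close> takes the place
    of the larger exponent, so \<open>\<sigma> < \<gamma>\<close> already makes the majorant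
    integrable.\<close>
  note dct = dominated_convergence_continuous_banach[where G = "\<lambda>n s. V \<tau> s (?q n s)" and g = ?g,
      OF cont exp_weight_integrable[OF sigma(2)] dom lim]
  have "integral {..\<tau>} (\<lambda>s. V \<tau> s (?q n s)) = real (Suc n) *\<^sub>R (S \<tau> (\<eta> + ?h n) - S \<tau> \<eta>)" for n
  proof -
    note lin = bounded_linear.linear[OF bounded_linear_V]
    note int = V_integrable[OF f_tempered[OF sol_tempered] sigma(2) order_refl order_refl]
    have "integral {..\<tau>} (\<lambda>s. V \<tau> s (?q n s)) = integral {..\<tau>} (\<lambda>s. real (Suc n) *\<^sub>R
        (V \<tau> s (f s (sol \<tau> (\<eta> + ?h n) s)) - V \<tau> s (f s (sol \<tau> \<eta> s))))"
      by (simp only: f_incr_def linear_scale[OF lin] linear_diff[OF lin])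
    also have "\<dots> = real (Suc n) *\<^sub>R (S \<tau> (\<eta> + ?h n) - S \<tau> \<eta>)"
      unfolding S_def complement_sol by (simp only: integral_cmul integral_diff[OF int int])
    finally show ?thesis .
  qed
  with dct(2) have "(\<lambda>n. real (Suc n) *\<^sub>R (S \<tau> (\<eta> + ?h n) - S \<tau> \<eta>)) \<longlonglongrightarrow> integral {..\<tau>} ?g" by simp
  moreover have "(\<lambda>n. real (Suc n) *\<^sub>R (S \<tau> (\<eta> + ?h n) - S \<tau> \<eta>)) \<longlonglongrightarrow> frechet_derivative (S \<tau>) (at \<eta>) \<xi>"
    by (rule has_derivative_difference_quotient) (use diff in \<open>simp add: frechet_derivative_works\<close>)
  ultimately have "integral {..\<tau>} ?g = frechet_derivative (S \<tau>) (at \<eta>) \<xi>" by (rule LIMSEQ_unique)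
  with integrable_integral[OF dct(1)]
  show "(?g has_integral frechet_derivative (S \<tau>) (at \<eta>) \<xi>) {..\<tau>}" by simp
qed

end

theorem theorem5p1:
  fixes L :: "real \<Rightarrow> real \<Rightarrow> 'a::banach \<Rightarrow>\<^sub>L 'a"
    and Q :: "real \<Rightarrow> 'a \<Rightarrow>\<^sub>L 'a"
    and M \<gamma> \<rho> \<sigma> L\<^sub>1 L\<^sub>2 :: real
    and \<Gamma> :: "real \<times> real \<Rightarrow> real"
    and f :: "real \<Rightarrow> 'a \<Rightarrow> 'a"
    and T :: "real \<Rightarrow> real \<Rightarrow> 'a \<Rightarrow> 'a"
    and Df :: "real \<Rightarrow> 'a \<Rightarrow> 'a \<Rightarrow>\<^sub>L 'a"
  defines "z \<equiv> backward_solution L Q \<gamma> \<rho> \<Gamma> f \<sigma>"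
    and "\<Sigma> \<equiv> manifold_map L Q \<gamma> \<rho> \<Gamma> f \<sigma>"
  assumes "linear_evolution_process L"
    and "exponential_splitting L Q M \<gamma> \<rho>"
    and "admissible_norm \<Gamma>"
    and "continuous_on UNIV (\<lambda>(t, u). f t u)"
    and "\<forall>t. f t 0 = 0"
    and "L\<^sub>1 > 0" and "L\<^sub>2 > 0"
    and "splitting_lipschitz L Q \<gamma> \<rho> \<Gamma> f L\<^sub>1 L\<^sub>2"
    and "nonlinear_process L f T"
    and "\<sigma> \<in> {\<rho><..<\<gamma>}"
    and "\<Gamma> (L\<^sub>1 / (\<sigma> - \<rho>), L\<^sub>2 / (\<gamma> - \<sigma>)) < 1"
    and "\<forall>t u. (f t has_derivative blinfun_apply (Df t u)) (at u)"
  shows "\<forall>\<tau> \<eta>.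
    \<Sigma> \<tau> differentiable (at \<eta>) \<and>
    (\<forall>s\<le>\<tau>. (\<lambda>\<zeta>. z \<tau> \<zeta> s) differentiable (at \<eta>)) \<and>
    (\<forall>\<xi>. ((\<lambda>s. blinfun_apply (L \<tau> s)
                 (blinfun_apply (id_blinfun - Q s)
                   (blinfun_apply (Df s (z \<tau> \<eta> s))
                     (frechet_derivative (\<lambda>\<zeta>. z \<tau> \<zeta> s) (at \<eta>) \<xi>))))
          has_integral frechet_derivative (\<Sigma> \<tau>) (at \<eta>) \<xi>) {..\<tau>})"
proof -
  interpret smooth_splitting_system L Q M \<gamma> \<rho> \<Gamma> f L\<^sub>1 L\<^sub>2 \<sigma> Df
    by unfold_locales (use assms in auto)
  have z: "z = sol" by (simp add: z_def sol_def)
  have \<Sigma>: "\<Sigma> = (\<lambda>\<tau> \<zeta>. (id_blinfun - Q \<tau>) (sol \<tau> \<zeta> \<tau>))"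
    by (intro ext) (simp add: \<Sigma>_def manifold_map_def sol_def)
  show ?thesis
    unfolding z \<Sigma> using complement_sol_derivative[unfolded V_def] sol_differentiable by blast
qed

end
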